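(* Let $(\mathcal M,\tau)$ be a von Neumann algebra with a normal faithful finite normalized trace, let $0<p<\infty$, let $x_1,\dots,x_n\in\mathcal M$ ($n\ge1$) and $\varepsilon_1,\dots,\varepsilon_n\in\{1,*\}$. Let $a_1,\dots,a_n\in M_m$ be complex $m\times m$ matrices such that for every permutation $\sigma$ of $\{1,\dots,n\}$, $\mathrm{tr}_m(a_{\sigma(1)}a_{\sigma(2)}\cdots a_{\sigma(n)})$ equals $1$ if $\sigma$ is circular and $0$ otherwise. For $z\in\mathbb C^n$ set $$S(z_1,\dots,z_n)=1+\sum_{j=1}^n z_j\,a_j^{\varepsilon_j}\otimes x_j\in M_m(\mathcal M),$$ and define $\varphi:\mathbb R^n\to\mathbb C$ by $$\varphi(r_1,\dots,r_n)=\frac1{(2\pi)^n}\int_{[0,2\pi]^n}\big\|S(r_1e^{i\theta_1},\dots,r_ne^{i\theta_n})\big\|_p^p\ \prod_{j}\big(\exp(-i\theta_j)\big)^{\varepsilon_j}\,d\theta_1\cdots d\theta_n .$$ Then $\varphi$ is indefinitely differentiable on a neighborhood of $0$, and $$\frac{\partial^n\varphi}{\partial r_1\cdots\partial r_n}(0,\dots,0)=\lim_{r_1,\dots,r_n\to0}\frac{1}{r_1\cdots r_n}\varphi(r_1,\dots,r_n)=\tau(x_1^{\varepsilon_1}x_2^{\varepsilon_2}\cdots x_n^{\varepsilon_n})\sum_{k=0}^{\alpha}(n-k)\binom{p/2}{n-k}\binom{\alpha}{k},$$ where $\alpha$ is the number of indices $1\le j\le n$ such that $\varepsilon_j=*$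 and $\varepsilon_{j+1}=1$ (with $\varepsilon_{n+1}=\varepsilon_1$).
   Context: For an operator, matrix or complex number $x$ and $\varepsilon\in\{1,*\}$, $x^\varepsilon=x$ if $\varepsilon=1$ and $x^\varepsilon=x^*$ if $\varepsilon=*$ (for a complex number $z$, $z^*=\overline z$). $\mathrm{tr}_m=\frac1m\mathrm{Tr}$ on $M_m$, and for $S\in M_m(\mathcal M)=M_m\otimes\mathcal M$, $\|S\|_p=\big((\mathrm{tr}_m\otimes\tau)(|S|^p)\big)^{1/p}$. A permutation $\sigma$ of $\{1,\dots,n\}$ is circular if there is an integer $k$ such that $\sigma(j)\equiv j+k \bmod n$ for all $j$. $\binom{\beta}{n}=\beta(\beta-1)\cdots(\beta-n+1)/n!$ for $\beta\in\mathbb C$, $n\in\mathbb N$. *)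

theory Defs
  imports "HOL-Analysis.Analysis" "HOL-Computational_Algebra.Polynomial"
    "HOL-Combinatorics.Permutations" "HOL-Number_Theory.Cong"
begin

section \<open>Complex Hilbert spaces\<close>

text \<open>The inner product is conjugate-linear in its first argument. The axiom
  \<open>cinner_self\<close> says that it is positive definite and induces the norm; completeness
  comes from \<^class>\<open>banach\<close>.\<close>

class complex_hilbert = banach +
  fixes scaleC :: "complex \<Rightarrow> 'a \<Rightarrow> 'a"
    and cinner :: "'a \<Rightarrow> 'a \<Rightarrow> complex"
  assumes scaleC_add_right: "scaleC c (x + y) = scaleC c x + scaleC c y"
    and scaleC_add_left: "scaleC (c + d) x = scaleC c x + scaleC d x"
    and scaleC_scaleC: "scaleC c (scaleC d x) = scaleC (c * d) x"
    and scaleC_of_real: "scaleC (complex_of_real r) x = r *\<^sub>R x"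
    and cinner_commute: "cinner x y = cnj (cinner y x)"
    and cinner_add_left: "cinner (x + y) z = cinner x z + cinner y z"
    and cinner_scaleC_left: "cinner (scaleC c x) y = cnj c * cinner x y"
    and cinner_self: "cinner x x = complex_of_real ((norm x)\<^sup>2)"

text \<open>The Hilbert space direct sum \<open>H\<^sup>m\<close>, on which \<open>M\<^sub>m(B(H)) = B(H\<^sup>m)\<close> acts.\<close>

instantiation vec :: (complex_hilbert, finite) complex_hilbert
begin

definition "scaleC c x = (\<chi> i. scaleC c (x $ i))"

definition "cinner x y = (\<Sum>i\<in>UNIV. cinner (x $ i) (y $ i))"

instance
proof
  fix c d :: complex and r :: real and x y z :: "'a ^ 'b"
  show "scaleC c (x + y) = scaleC c x + scaleC c y"
    by (simp add: scaleC_vec_def vec_eq_iff scaleC_add_right)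
  show "scaleC (c + d) x = scaleC c x + scaleC d x"
    by (simp add: scaleC_vec_def vec_eq_iff scaleC_add_left)
  show "scaleC c (scaleC d x) = scaleC (c * d) x"
    by (simp add: scaleC_vec_def vec_eq_iff scaleC_scaleC)
  show "scaleC (complex_of_real r) x = r *\<^sub>R x"
    by (simp add: scaleC_vec_def vec_eq_iff scaleC_of_real)
  show "cinner x y = cnj (cinner y x)"
    unfolding cinner_vec_def cnj_sum by (rule sum.cong[OF refl]) (rule cinner_commute)
  show "cinner (x + y) z = cinner x z + cinner y z"
    by (simp add: cinner_vec_def cinner_add_left sum.distrib)
  show "cinner (scaleC c x) y = cnj c * cinner x y"
    by (simp add: cinner_vec_def scaleC_vec_def cinner_scaleC_left sum_distrib_left)
  show "cinner x x = complex_of_real ((norm x)\<^sup>2)"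
    by (simp add: cinner_vec_def cinner_self norm_vec_def L2_set_def sum_nonneg)
qed

end

section \<open>Bounded operators\<close>

text \<open>The type \<open>'h \<Rightarrow>\<^sub>L 'h\<close> consists of the bounded \<^emph>\<open>real\<close>-linear maps; \<open>B(H)\<close> is the subset
  of the complex-linear ones.\<close>

definition bounded_clinear_ops :: "('h::complex_hilbert \<Rightarrow>\<^sub>L 'h) set" where
  "bounded_clinear_ops = {T. \<forall>c \<xi>. blinfun_apply T (scaleC c \<xi>) = scaleC c (T \<xi>)}"

definition op_adj :: "('h::complex_hilbert \<Rightarrow>\<^sub>L 'h) \<Rightarrow> ('h \<Rightarrow>\<^sub>L 'h)" where
  "op_adj T = (THE T' :: 'h \<Rightarrow>\<^sub>L 'h. \<forall>\<xi> \<eta>. cinner (T' \<xi>) \<eta> = cinner \<xi> (T \<eta>))"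

definition op_scaleC :: "complex \<Rightarrow> ('h::complex_hilbert \<Rightarrow>\<^sub>L 'h) \<Rightarrow> ('h \<Rightarrow>\<^sub>L 'h)" where
  "op_scaleC c T = Blinfun (\<lambda>\<xi>. scaleC c (T \<xi>))"

definition op_positive :: "('h::complex_hilbert \<Rightarrow>\<^sub>L 'h) \<Rightarrow> bool" where
  "op_positive T \<longleftrightarrow> (\<forall>\<xi>. Im (cinner \<xi> (T \<xi>)) = 0 \<and> Re (cinner \<xi> (T \<xi>)) \<ge> 0)"

definition op_le :: "('h::complex_hilbert \<Rightarrow>\<^sub>L 'h) \<Rightarrow> ('h \<Rightarrow>\<^sub>L 'h) \<Rightarrow> bool" where
  "op_le S T \<longleftrightarrow> op_positive (T - S)"

definition op_spectrum :: "('h::complex_hilbert \<Rightarrow>\<^sub>L 'h) \<Rightarrow> complex set" where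
  "op_spectrum T = {z. \<not> (\<exists>R\<in>bounded_clinear_ops.
     R o\<^sub>L (op_scaleC z id_blinfun - T) = id_blinfun \<and>
     (op_scaleC z id_blinfun - T) o\<^sub>L R = id_blinfun)}"

definition op_poly :: "real poly \<Rightarrow> ('h::complex_hilbert \<Rightarrow>\<^sub>L 'h) \<Rightarrow> ('h \<Rightarrow>\<^sub>L 'h)" where
  "op_poly P T = (\<Sum>i\<le>degree P. coeff P i *\<^sub>R (((o\<^sub>L) T ^^ i) id_blinfun))"

text \<open>Continuous functional calculus \<open>f(T)\<close> for self-adjoint \<open>T\<close> and \<open>f\<close> real-valued and
  continuous on the spectrum of \<open>T\<close>, which is a compact set of reals: \<open>f(T)\<close> is the common norm
  limit of \<open>P\<^sub>k(T)\<close> over all sequences of polynomials \<open>P\<^sub>k\<close> that converge to \<open>f\<close> uniformly on the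
  spectrum. The result is meaningless if \<open>T\<close> is not self-adjoint.\<close>

definition op_cfc :: "(real \<Rightarrow> real) \<Rightarrow> ('h::complex_hilbert \<Rightarrow>\<^sub>L 'h) \<Rightarrow> ('h \<Rightarrow>\<^sub>L 'h)" where
  "op_cfc f T = (THE R. \<forall>P :: nat \<Rightarrow> real poly.
     uniform_limit {t. complex_of_real t \<in> op_spectrum T} (\<lambda>k t. poly (P k) t) f sequentially
       \<longrightarrow> (\<lambda>k. op_poly (P k) T) \<longlonglongrightarrow> R)"

definition op_abs :: "('h::complex_hilbert \<Rightarrow>\<^sub>L 'h) \<Rightarrow> ('h \<Rightarrow>\<^sub>L 'h)" where
  "op_abs S = op_cfc sqrt (op_adj S o\<^sub>L S)"

definition op_abs_powr :: "('h::complex_hilbert \<Rightarrow>\<^sub>L 'h) \<Rightarrow> real \<Rightarrow> ('h \<Rightarrow>\<^sub>L 'h)" where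
  "op_abs_powr S p = op_cfc (\<lambda>t. t powr p) (op_abs S)"

section \<open>Von Neumann algebras and traces\<close>

definition commutant :: "('h::complex_hilbert \<Rightarrow>\<^sub>L 'h) set \<Rightarrow> ('h \<Rightarrow>\<^sub>L 'h) set" where
  "commutant M = {T \<in> bounded_clinear_ops. \<forall>S\<in>M. T o\<^sub>L S = S o\<^sub>L T}"

text \<open>That \<open>M\<close> is a unital subalgebra of \<open>B(H)\<close> follows from \<open>M'' = M\<close>.\<close>

definition von_neumann_algebra :: "('h::complex_hilbert \<Rightarrow>\<^sub>L 'h) set \<Rightarrow> bool" where
  "von_neumann_algebra M \<longleftrightarrow>
     M \<subseteq> bounded_clinear_ops \<and> (\<forall>x\<in>M. op_adj x \<in> M) \<and> commutant (commutant M) = M"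

definition op_is_lub ::
  "('h::complex_hilbert \<Rightarrow>\<^sub>L 'h) set \<Rightarrow> ('h \<Rightarrow>\<^sub>L 'h) set \<Rightarrow> ('h \<Rightarrow>\<^sub>L 'h) \<Rightarrow> bool" where
  "op_is_lub M D x \<longleftrightarrow> x \<in> M \<and> op_adj x = x \<and> (\<forall>d\<in>D. op_le d x) \<and>
     (\<forall>y\<in>M. op_adj y = y \<and> (\<forall>d\<in>D. op_le d y) \<longrightarrow> op_le x y)"

text \<open>Normality: \<open>\<tau>\<close> preserves suprema of upward directed sets of positive elements.\<close>

definition normal_on ::
  "('h::complex_hilbert \<Rightarrow>\<^sub>L 'h) set \<Rightarrow> (('h \<Rightarrow>\<^sub>L 'h) \<Rightarrow> complex) \<Rightarrow> bool" where
  "normal_on M \<tau> \<longleftrightarrow>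
     (\<forall>D x. D \<noteq> {} \<and> D \<subseteq> M \<and> (\<forall>d\<in>D. op_positive d) \<and>
            (\<forall>d\<in>D. \<forall>d'\<in>D. \<exists>d''\<in>D. op_le d d'' \<and> op_le d' d'') \<and> op_is_lub M D x
        \<longrightarrow> Re (\<tau> x) = (SUP d\<in>D. Re (\<tau> d)))"

text \<open>Only the values of \<open>\<tau>\<close> on \<open>M\<close> are constrained.\<close>

definition normal_faithful_normalized_trace ::
  "('h::complex_hilbert \<Rightarrow>\<^sub>L 'h) set \<Rightarrow> (('h \<Rightarrow>\<^sub>L 'h) \<Rightarrow> complex) \<Rightarrow> bool" where
  "normal_faithful_normalized_trace M \<tau> \<longleftrightarrow>
     (\<forall>x\<in>M. \<forall>y\<in>M. \<tau> (x + y) = \<tau> x + \<tau> y) \<and>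
     (\<forall>x\<in>M. \<forall>c. \<tau> (op_scaleC c x) = c * \<tau> x) \<and>
     (\<forall>x\<in>M. op_positive x \<longrightarrow> Im (\<tau> x) = 0 \<and> Re (\<tau> x) \<ge> 0) \<and>
     (\<forall>x\<in>M. \<forall>y\<in>M. \<tau> (x o\<^sub>L y) = \<tau> (y o\<^sub>L x)) \<and>
     (\<forall>x\<in>M. \<tau> (op_adj x o\<^sub>L x) = 0 \<longrightarrow> x = 0) \<and>
     normal_on M \<tau> \<and>
     \<tau> id_blinfun = 1"

section \<open>Matrices over the algebra\<close>

definition tr_normalized :: "complex ^ 'm ^ 'm \<Rightarrow> complex" where
  "tr_normalized a = trace a / of_nat CARD('m)"

definition mat_adj :: "complex ^ 'm ^ 'm \<Rightarrow> complex ^ 'm ^ 'm" where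
  "mat_adj a = (\<chi> i k. cnj (a $ k $ i))"

text \<open>An element of \<open>M\<^sub>m(M) = M\<^sub>m \<otimes> M\<close> is represented by the operator on \<open>H\<^sup>m\<close> it defines.\<close>

definition mat_tensor ::
  "complex ^ 'm ^ 'm \<Rightarrow> ('h::complex_hilbert \<Rightarrow>\<^sub>L 'h) \<Rightarrow> (('h ^ 'm) \<Rightarrow>\<^sub>L ('h ^ 'm))" where
  "mat_tensor a x = Blinfun (\<lambda>\<xi>. \<chi> i. \<Sum>k\<in>UNIV. scaleC (a $ i $ k) (x (\<xi> $ k)))"

definition op_entry ::
  "(('h::complex_hilbert ^ 'm) \<Rightarrow>\<^sub>L ('h ^ 'm)) \<Rightarrow> 'm \<Rightarrow> 'm \<Rightarrow> ('h \<Rightarrow>\<^sub>L 'h)" where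
  "op_entry R i k = Blinfun (\<lambda>\<xi>. R (axis k \<xi>) $ i)"

definition tr_tensor ::
  "(('h::complex_hilbert \<Rightarrow>\<^sub>L 'h) \<Rightarrow> complex) \<Rightarrow> (('h ^ 'm) \<Rightarrow>\<^sub>L ('h ^ 'm)) \<Rightarrow> complex" where
  "tr_tensor \<tau> R = (\<Sum>i\<in>UNIV. \<tau> (op_entry R i i)) / of_nat CARD('m)"

definition Lp_norm ::
  "(('h::complex_hilbert \<Rightarrow>\<^sub>L 'h) \<Rightarrow> complex) \<Rightarrow> real \<Rightarrow> (('h ^ 'm) \<Rightarrow>\<^sub>L ('h ^ 'm)) \<Rightarrow> real" where
  "Lp_norm \<tau> p S = Re (tr_tensor \<tau> (op_abs_powr S p)) powr (1 / p)"

section \<open>Exponents in \<open>{1, *}\<close>, products and circular permutations\<close>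

datatype exponent = One | Star

text \<open>\<open>x\<^sup>\<epsilon>\<close>, where \<open>star\<close> is the involution of the structure containing \<open>x\<close>.\<close>

fun epow :: "('a \<Rightarrow> 'a) \<Rightarrow> 'a \<Rightarrow> exponent \<Rightarrow> 'a" where
  "epow star x One = x"
| "epow star x Star = star x"

text \<open>The products \<open>a\<^sub>1 a\<^sub>2 \<cdots> a\<^sub>n\<close> and \<open>x\<^sub>1 x\<^sub>2 \<cdots> x\<^sub>n\<close>, in this order.\<close>

definition mat_prod :: "nat \<Rightarrow> (nat \<Rightarrow> complex ^ 'm ^ 'm) \<Rightarrow> complex ^ 'm ^ 'm" where
  "mat_prod n a = foldr (\<lambda>j b. a j ** b) [1..<n+1] (mat 1)"

definition op_prod :: "nat \<Rightarrow> (nat \<Rightarrow> ('h::complex_hilbert \<Rightarrow>\<^sub>L 'h)) \<Rightarrow> ('h \<Rightarrow>\<^sub>L 'h)" where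
  "op_prod n x = foldr (\<lambda>j y. x j o\<^sub>L y) [1..<n+1] id_blinfun"

definition circular :: "nat \<Rightarrow> (nat \<Rightarrow> nat) \<Rightarrow> bool" where
  "circular n \<sigma> \<longleftrightarrow> (\<exists>k::int. \<forall>j\<in>{1..n}. [int (\<sigma> j) = int j + k] (mod int n))"

definition star_one_count :: "nat \<Rightarrow> (nat \<Rightarrow> exponent) \<Rightarrow> nat" where
  "star_one_count n \<epsilon> =
     card {j\<in>{1..n}. \<epsilon> j = Star \<and> \<epsilon> (if j = n then 1 else j + 1) = One}"

section \<open>Smoothness and partial derivatives\<close>

fun times_differentiable_on ::
  "nat \<Rightarrow> 'a::real_normed_vector set \<Rightarrow> ('a \<Rightarrow> 'b::real_normed_vector) \<Rightarrow> bool" where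
  "times_differentiable_on 0 U f \<longleftrightarrow> continuous_on U f"
| "times_differentiable_on (Suc k) U f \<longleftrightarrow>
     (\<forall>x\<in>U. f differentiable (at x)) \<and>
     (\<forall>v. times_differentiable_on k U (\<lambda>x. frechet_derivative f (at x) v))"

definition smooth_on ::
  "'a::real_normed_vector set \<Rightarrow> ('a \<Rightarrow> 'b::real_normed_vector) \<Rightarrow> bool" where
  "smooth_on U f \<longleftrightarrow> (\<forall>k. times_differentiable_on k U f)"

definition partial_deriv :: "'n \<Rightarrow> (real ^ 'n \<Rightarrow> complex) \<Rightarrow> real ^ 'n \<Rightarrow> complex" where
  "partial_deriv i f r = vector_derivative (\<lambda>t. f (r + t *\<^sub>R axis i 1)) (at 0)"

end

theory Submission
  imports Defs "HOL-Computational_Algebra.Fundamental_Theorem_Algebra"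
begin

text \<open>Write \<open>S = 1 + T\<close> with \<open>T = \<Sum> z\<^sub>j Y\<^sub>j\<close>, where \<open>Y\<^sub>j\<close> is the \<open>j\<close>-th elementary tensor. For small
  \<open>z\<close> the operator \<open>S\<^sup>* S = 1 + U\<close>, with \<open>U = T + T\<^sup>* + T\<^sup>* T\<close>, is close to the identity, and
  \<open>\<bar>S\<bar>\<^sup>p = (1 + U) powr (p / 2)\<close> is the binomial series \<open>\<Sum>\<^sub>d (p/2 choose d) U\<^sup>d\<close>. Expanding \<open>U\<^sup>d\<close>
  turns the norm into an absolutely convergent power series in the \<open>z\<^sub>j\<close> and their conjugates.
  Its terms are words of \<open>d\<close> blocks, a block being \<open>Y\<^sub>j\<close>, \<open>Y\<^sub>j\<^sup>*\<close> or \<open>Y\<^sub>i\<^sup>* Y\<^sub>j\<close>, and the coefficient of a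
  word is the trace of the product of its symbols.

  Averaging over the torus keeps exactly those words in which the number of \<open>z\<^sub>j\<close> minus the number
  of conjugates is \<open>1\<close> or \<open>-1\<close>, as prescribed by \<open>\<epsilon>\<^sub>j\<close>. In particular each variable occurs in such a
  word, so \<open>\<phi>(r) = r\<^sub>1 \<cdots> r\<^sub>n g(r)\<close> for another convergent power series \<open>g\<close>. Smoothness is termwise
  differentiation, and both the mixed derivative at \<open>0\<close> and the limit are equal to \<open>g(0)\<close>.

  The words that contribute to \<open>g(0)\<close> contain every index once, and the symbol of index \<open>j\<close> is the
  tensor of \<open>a\<^sub>j\<close> and \<open>x\<^sub>j\<^sup>\<epsilon>\<close>. By the hypothesis on the matrices only words that spell a rotation of
  \<open>1, \<dots>, n\<close> can have non-zero trace, and this trace is always \<open>\<tau>(x\<^sub>1\<^sup>\<epsilon> \<cdots> x\<^sub>n\<^sup>\<epsilon>)\<close> because \<open>\<tau>\<close> is tracial. It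
  remains to count the ways of cutting the rotations into \<open>n - k\<close> blocks, that is, of merging \<open>k\<close> of
  the \<open>\<alpha>\<close> adjacent pairs with exponents \<open>*, 1\<close> on the cycle and cutting the cycle at one of the \<open>n - k\<close>
  gaps that remain: there are \<open>(n - k) (\<alpha> choose k)\<close> of them.

  The operator theory behind the binomial series is developed from the definitions. Riesz
  representation (\<open>Riesz_representation_real\<close>) provides adjoints; the spectral bound
  \<open>norm_op_poly_le\<close> shows that the continuous functional calculus can be computed along a single
  approximating sequence of polynomials (\<open>op_cfc_eqI\<close>); and \<open>op_abs_powr_eq\<close> is the resulting
  binomial series. The other pillars are \<open>Lp_norm_sums\<close> for the expansion into words,
  \<open>circle_average_eq_series\<close> for the average over the torus, \<open>times_differentiable_on_series\<close> for
  smoothness, and \<open>sum_factorisations\<close> with \<open>sum_rotations\<close> for the count.\<close>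

section \<open>Geometry of complex Hilbert spaces\<close>

lemma scaleC_one [simp]: "scaleC 1 x = (x::'a::complex_hilbert)"
  using scaleC_of_real[of 1 x] by simp

lemma scaleC_minus_one: "scaleC (-1) x = - (x::'a::complex_hilbert)"
  using scaleC_of_real[of "-1" x] by simp

lemma scaleC_zero_right [simp]: "scaleC c (0::'a::complex_hilbert) = 0"
  using scaleC_add_right[of c "0::'a" 0] by simp

lemma scaleC_zero_left [simp]: "scaleC 0 (x::'a::complex_hilbert) = 0"
  using scaleC_of_real[of 0 x] by simp

lemma scaleC_minus_right: "scaleC c (- x) = - scaleC c (x::'a::complex_hilbert)"
  using scaleC_add_right[of c x "-x"] by (simp add: minus_unique)

lemma scaleC_diff_right: "scaleC c (x - y) = scaleC c x - scaleC c (y::'a::complex_hilbert)"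
  using scaleC_add_right[of c x "-y"] by (simp add: scaleC_minus_right)

lemma scaleC_sum_right: "scaleC c (\<Sum>i\<in>I. f i) = (\<Sum>i\<in>I. scaleC c (f i :: 'a::complex_hilbert))"
  by (induction I rule: infinite_finite_induct) (auto simp: scaleC_add_right)

lemma scaleC_sum_left: "scaleC (\<Sum>i\<in>I. f i) x = (\<Sum>i\<in>I. scaleC (f i) (x :: 'a::complex_hilbert))"
  by (induction I rule: infinite_finite_induct) (auto simp: scaleC_add_left)

lemma scaleC_scaleR: "scaleC c (r *\<^sub>R x) = r *\<^sub>R scaleC c (x::'a::complex_hilbert)"
  by (metis scaleC_of_real scaleC_scaleC mult.commute)

lemma cinner_add_right: "cinner x (y + z) = cinner x y + cinner (x::'a::complex_hilbert) z"
  by (metis cinner_commute cinner_add_left complex_cnj_add)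

lemma cinner_scaleC_right: "cinner x (scaleC c y) = c * cinner (x::'a::complex_hilbert) y"
  by (metis cinner_commute cinner_scaleC_left complex_cnj_mult complex_cnj_cnj)

lemma cinner_minus_right: "cinner x (- y) = - cinner (x::'a::complex_hilbert) y"
  by (metis cinner_scaleC_right scaleC_minus_one mult_minus1)

lemma cinner_minus_left: "cinner (- x) y = - cinner (x::'a::complex_hilbert) y"
  by (metis cinner_scaleC_left scaleC_minus_one complex_cnj_minus complex_cnj_one mult_minus1)

lemma cinner_diff_right: "cinner x (y - z) = cinner x y - cinner (x::'a::complex_hilbert) z"
  using cinner_add_right[of x y "-z"] by (simp add: cinner_minus_right)

lemma cinner_diff_left: "cinner (x - y) z = cinner x z - cinner (y::'a::complex_hilbert) z"
  using cinner_add_left[of x "-y" z] by (simp add: cinner_minus_left)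

lemma cinner_scaleR_right: "cinner x (r *\<^sub>R y) = of_real r * cinner (x::'a::complex_hilbert) y"
  by (metis cinner_scaleC_right scaleC_of_real)

lemma cinner_scaleR_left: "cinner (r *\<^sub>R x) y = of_real r * cinner (x::'a::complex_hilbert) y"
  by (metis cinner_scaleC_left scaleC_of_real complex_cnj_complex_of_real)

lemma cinner_zero_right [simp]: "cinner x (0::'a::complex_hilbert) = 0"
  using cinner_add_right[of x 0 0] by simp

lemma cinner_zero_left [simp]: "cinner (0::'a::complex_hilbert) x = 0"
  using cinner_add_left[of 0 0 x] by simp

lemma cinner_sum_right: "cinner x (\<Sum>i\<in>I. f i) = (\<Sum>i\<in>I. cinner (x::'a::complex_hilbert) (f i))"
  by (induction I rule: infinite_finite_induct) (auto simp: cinner_add_right)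

lemma cinner_sum_left: "cinner (\<Sum>i\<in>I. f i) x = (\<Sum>i\<in>I. cinner (f i) (x::'a::complex_hilbert))"
  by (induction I rule: infinite_finite_induct) (auto simp: cinner_add_left)

lemmas cinner_simps = cinner_add_left cinner_add_right cinner_diff_left cinner_diff_right
  cinner_minus_left cinner_minus_right cinner_scaleR_left cinner_scaleR_right
  cinner_scaleC_left cinner_scaleC_right

lemma Re_cinner_commute: "Re (cinner x y) = Re (cinner y (x::'a::complex_hilbert))"
  by (subst cinner_commute) simp

lemma norm_sq_cinner: "(norm (x::'a::complex_hilbert))\<^sup>2 = Re (cinner x x)"
  by (simp add: cinner_self)

lemma norm_add_sq:
  "(norm (x + y))\<^sup>2 = (norm x)\<^sup>2 + 2 * Re (cinner x y) + (norm (y::'a::complex_hilbert))\<^sup>2"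
  using Re_cinner_commute[of x y] by (simp add: norm_sq_cinner cinner_simps)

lemma norm_diff_sq:
  "(norm (x - y))\<^sup>2 = (norm x)\<^sup>2 - 2 * Re (cinner x y) + (norm (y::'a::complex_hilbert))\<^sup>2"
  using Re_cinner_commute[of x y] by (simp add: norm_sq_cinner cinner_simps)

lemma norm_scaleC: "norm (scaleC c x) = cmod c * norm (x::'a::complex_hilbert)"
proof -
  have "(norm (scaleC c x))\<^sup>2 = Re ((c * cnj c) * cinner x x)"
    by (simp only: norm_sq_cinner cinner_scaleC_left cinner_scaleC_right mult.assoc)
  also have "\<dots> = (cmod c * norm x)\<^sup>2"
    by (simp only: complex_norm_square[symmetric] cinner_self) (simp add: power_mult_distrib)
  finally show ?thesis by (simp add: power2_eq_iff_nonneg)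
qed

lemma cinner_Cauchy_Schwarz: "cmod (cinner x y) \<le> norm x * norm (y::'a::complex_hilbert)"
proof (cases "y = 0")
  case False
  \<comment> \<open>\<open>c y\<close> is the orthogonal projection of \<open>x\<close> to the line through \<open>y\<close>.\<close>
  define c where "c = cinner y x / of_real ((norm y)\<^sup>2)"
  have ny: "(norm y)\<^sup>2 > 0" using False by simp
  have "cinner x (scaleC c y) = of_real ((cmod (cinner x y))\<^sup>2 / (norm y)\<^sup>2)"
    unfolding c_def cinner_scaleC_right using complex_norm_square[of "cinner x y"]
    by (subst cinner_commute[of y x]) (simp add: mult.commute)
  hence 1: "Re (cinner x (scaleC c y)) = (cmod (cinner x y))\<^sup>2 / (norm y)\<^sup>2" by simp
  have cc: "cmod (cinner y x) = cmod (cinner x y)"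
    by (subst cinner_commute) simp
  have 2: "(norm (scaleC c y))\<^sup>2 = (cmod (cinner x y))\<^sup>2 / (norm y)\<^sup>2"
  proof -
    have "cmod c = cmod (cinner x y) / (norm y)\<^sup>2"
      by (simp add: c_def norm_divide norm_power cc)
    hence C: "cmod (cinner x y) = cmod c * (norm y)\<^sup>2" using ny by simp
    show ?thesis unfolding C norm_scaleC using ny by (simp add: power2_eq_square)
  qed
  have "0 \<le> (norm (x - scaleC c y))\<^sup>2" by simp
  also have "\<dots> = (norm x)\<^sup>2 - (cmod (cinner x y))\<^sup>2 / (norm y)\<^sup>2"
    unfolding norm_diff_sq 1 2 by simp
  finally have "(cmod (cinner x y))\<^sup>2 \<le> (norm x * norm y)\<^sup>2"
    using ny by (simp add: field_simps power_mult_distrib)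
  thus ?thesis by (rule power2_le_imp_le) simp
qed simp

lemma bounded_bilinear_cinner: "bounded_bilinear (cinner :: 'a::complex_hilbert \<Rightarrow> 'a \<Rightarrow> complex)"
proof
  show "\<exists>K. \<forall>a b :: 'a. cmod (cinner a b) \<le> norm a * norm b * K"
    by (intro exI[of _ 1]) (simp add: cinner_Cauchy_Schwarz)
qed (simp_all add: cinner_simps scaleR_conv_of_real)

lemmas tendsto_cinner = bounded_bilinear.tendsto[OF bounded_bilinear_cinner]

lemma cinner_eqI: "(\<And>\<eta>. cinner x \<eta> = cinner y \<eta>) \<Longrightarrow> x = (y::'a::complex_hilbert)"
proof -
  assume "\<And>\<eta>. cinner x \<eta> = cinner y \<eta>"
  hence "cinner (x - y) (x - y) = 0" by (simp add: cinner_diff_left)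
  thus ?thesis by (simp add: cinner_self)
qed

text \<open>The representing vector minimises \<open>J x = \<parallel>x\<parallel>\<^sup>2 - 2 f x\<close>: by the parallelogram law a
  minimising sequence is Cauchy, and at the minimum the derivative of \<open>J\<close> vanishes. The real
  part of the inner product suffices here; complex-linearity is exploited afterwards.\<close>

lemma Riesz_representation_real:
  fixes f :: "'a::complex_hilbert \<Rightarrow> real"
  assumes f: "bounded_linear f"
  shows "\<exists>y. \<forall>x. f x = Re (cinner y x)"
proof -
  interpret f: bounded_linear f by fact
  obtain K where K: "\<And>x. norm (f x) \<le> norm x * K" "K \<ge> 0" using f.nonneg_bounded by metis
  define J where "J x = (norm x)\<^sup>2 - 2 * f x" for x
  have lower: "J x \<ge> - K\<^sup>2" for x
  proof -
    have "f x \<le> norm x * K" using K(1)[of x] by simp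
    moreover have "0 \<le> (norm x - K)\<^sup>2" by simp
    ultimately show ?thesis unfolding J_def power2_diff by simp
  qed
  hence bdd: "bdd_below (range J)" by (auto intro!: bdd_belowI)
  define m where "m = (INF x. J x)"
  have mle: "m \<le> J x" for x unfolding m_def by (rule cINF_lower[OF bdd]) simp
  have "\<exists>x. J x < m + 1 / real (Suc k)" for k
    using cINF_less_iff[of UNIV J "m + 1 / real (Suc k)"] bdd unfolding m_def by simp
  then obtain X where X: "\<And>k. J (X k) < m + 1 / real (Suc k)" by metis
  have par: "(norm (x - y))\<^sup>2 \<le> 2 * (J x - m) + 2 * (J y - m)" for x y
  proof -
    have "J ((1/2) *\<^sub>R (x + y)) = (norm (x + y))\<^sup>2 / 4 - (f x + f y)"
      unfolding J_def f.scaleR f.add norm_scaleR by (simp add: power_mult_distrib power_divide add_divide_distrib)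
    moreover have "(norm (x + y))\<^sup>2 + (norm (x - y))\<^sup>2 = 2 * (norm x)\<^sup>2 + 2 * (norm y)\<^sup>2"
      by (simp add: norm_add_sq norm_diff_sq)
    ultimately show ?thesis using mle[of "(1/2) *\<^sub>R (x + y)"] by (simp add: J_def)
  qed
  have "Cauchy X"
  proof (rule metric_CauchyI)
    fix e :: real assume e: "e > 0"
    then obtain N where N: "1 / real (Suc N) < e\<^sup>2 / 4"
      using nat_approx_posE[of "e\<^sup>2/4"] by (metis zero_less_power zero_less_divide_iff zero_less_numeral)
    have *: "J (X k) - m < e\<^sup>2 / 4" if "k \<ge> N" for k
    proof -
      have "1 / real (Suc k) \<le> 1 / real (Suc N)" using that by (simp add: frac_le)
      thus ?thesis using X[of k] N by linarith
    qed
    show "\<exists>N. \<forall>k\<ge>N. \<forall>l\<ge>N. dist (X k) (X l) < e"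
    proof (intro exI[of _ N] allI impI)
      fix k l assume "N \<le> k" "N \<le> l"
      hence "(norm (X k - X l))\<^sup>2 < e\<^sup>2" using par[of "X k" "X l"] *[of k] *[of l] by simp
      thus "dist (X k) (X l) < e" using e by (simp add: dist_norm power_less_imp_less_base)
    qed
  qed
  then obtain y where y: "X \<longlonglongrightarrow> y" using Cauchy_convergent_iff convergent_def by blast
  have "(\<lambda>k. J (X k)) \<longlonglongrightarrow> J y"
    unfolding J_def by (intro tendsto_intros y f.tendsto)
  moreover have "(\<lambda>k. m + 1 / real (Suc k)) \<longlonglongrightarrow> m + 0"
    unfolding inverse_eq_divide[symmetric] by (intro tendsto_intros LIMSEQ_inverse_real_of_nat)
  ultimately have Jy: "J y \<le> m"
    using X by (intro LIMSEQ_le) (auto intro: less_imp_le)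
  have "f x = Re (cinner y x)" for x
  proof (rule ccontr)
    define b where "b = Re (cinner y x) - f x"
    assume "f x \<noteq> Re (cinner y x)"
    hence b: "b \<noteq> 0" by (simp add: b_def)
    have *: "0 \<le> t\<^sup>2 * (norm x)\<^sup>2 + 2 * t * b" for t
    proof -
      have "J (y + t *\<^sub>R x) = J y + t\<^sup>2 * (norm x)\<^sup>2 + 2 * t * b"
        by (simp add: J_def b_def norm_add_sq cinner_simps f.add f.scaleR algebra_simps power_mult_distrib)
      thus ?thesis using mle[of "y + t *\<^sub>R x"] Jy by linarith
    qed
    \<comment> \<open>The choice \<open>t = - b / q\<close> makes the quadratic polynomial negative.\<close>
    define q where "q = (norm x)\<^sup>2 + 1"
    have q: "q > 0" "(norm x)\<^sup>2 < q" by (auto simp: q_def add_nonneg_pos)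
    have "(- b/q)\<^sup>2 * (norm x)\<^sup>2 \<le> (b/q)\<^sup>2 * q" using q by (simp add: mult_left_mono)
    also have "\<dots> = b\<^sup>2 / q" using q by (simp add: power2_eq_square)
    finally have "0 \<le> b\<^sup>2 / q + 2 * (-b / q) * b" using *[of "-b/q"] by linarith
    also have "\<dots> = - (b\<^sup>2 / q)" by (simp add: power2_eq_square)
    finally have "b\<^sup>2 / q \<le> 0" by simp
    moreover have "b\<^sup>2 / q > 0" using b q by simp
    ultimately show False by linarith
  qed
  thus ?thesis by blast
qed

section \<open>Adjoints of bounded operators\<close>

lemma clin_apply: "T \<in> bounded_clinear_ops \<Longrightarrow> blinfun_apply T (scaleC c \<xi>) = scaleC c (T \<xi>)"
  by (simp add: bounded_clinear_ops_def)

lemma clinI: "(\<And>c \<xi>. blinfun_apply T (scaleC c \<xi>) = scaleC c (T \<xi>)) \<Longrightarrow> T \<in> bounded_clinear_ops"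
  by (simp add: bounded_clinear_ops_def)

text \<open>The real Riesz theorem represents the real part of \<open>\<eta> \<mapsto> \<langle>\<xi>, T \<eta>\<rangle>\<close>; its imaginary part is the
  real part at a multiple of \<open>\<eta>\<close> by \<open>\<i>\<close>, so complex-linearity of \<open>T\<close> gives the whole functional.\<close>

lemma adjoint_exists:
  fixes T :: "'h::complex_hilbert \<Rightarrow>\<^sub>L 'h"
  assumes T: "T \<in> bounded_clinear_ops"
  shows "\<exists>T' :: 'h \<Rightarrow>\<^sub>L 'h. \<forall>\<xi> \<eta>. cinner (T' \<xi>) \<eta> = cinner \<xi> (T \<eta>)"
proof -
  have "\<exists>y. \<forall>\<eta>. cinner y \<eta> = cinner \<xi> (T \<eta>)" for \<xi>
  proof -
    have "bounded_linear (\<lambda>\<eta>. Re (cinner \<xi> (T \<eta>)))"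
      by (intro bounded_linear_compose[OF bounded_linear_Re]
          bounded_linear_compose[OF bounded_bilinear.bounded_linear_right[OF bounded_bilinear_cinner]]
          blinfun.bounded_linear_right)
    then obtain y where y: "\<And>\<eta>. Re (cinner \<xi> (T \<eta>)) = Re (cinner y \<eta>)"
      using Riesz_representation_real by metis
    have "cinner y \<eta> = cinner \<xi> (T \<eta>)" for \<eta>
    proof (rule complex_eqI)
      show "Re (cinner y \<eta>) = Re (cinner \<xi> (T \<eta>))" by (simp add: y)
      show "Im (cinner y \<eta>) = Im (cinner \<xi> (T \<eta>))"
        using y[of "scaleC \<i> \<eta>"] by (simp add: clin_apply[OF T] cinner_simps)
    qed
    thus ?thesis by blast
  qed
  then obtain g where g: "\<And>\<xi> \<eta>. cinner (g \<xi>) \<eta> = cinner \<xi> (T \<eta>)" by metis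
  have "bounded_linear g"
  proof (rule bounded_linear_intro)
    show "g (x + y) = g x + g y" for x y
      by (rule cinner_eqI) (simp add: g cinner_simps)
    show "g (r *\<^sub>R x) = r *\<^sub>R g x" for r x
      by (rule cinner_eqI) (simp add: g cinner_simps)
    show "norm (g x) \<le> norm x * norm T" for x
    proof (cases "g x = 0")
      case False
      have "(norm (g x))\<^sup>2 = Re (cinner x (T (g x)))" by (simp add: norm_sq_cinner g)
      also have "\<dots> \<le> cmod (cinner x (T (g x)))" by (rule complex_Re_le_cmod)
      also have "\<dots> \<le> norm x * norm (T (g x))" by (rule cinner_Cauchy_Schwarz)
      also have "\<dots> \<le> norm x * (norm T * norm (g x))"
        by (intro mult_left_mono norm_blinfun) simp
      finally show ?thesis using False by (simp add: power2_eq_square)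
    qed simp
  qed
  thus ?thesis using g by (intro exI[of _ "Blinfun g"]) (simp add: bounded_linear_Blinfun_apply)
qed

text \<open>Uniqueness, which identifies explicit adjoints also on \<open>H\<^sup>m\<close>.\<close>

lemma op_adj_eqI:
  assumes "\<And>\<xi> \<eta>. cinner (blinfun_apply T' \<xi>) \<eta> = cinner \<xi> (blinfun_apply T \<eta>)"
  shows "op_adj T = T'"
  unfolding op_adj_def
proof (rule the_equality)
  show "\<forall>\<xi> \<eta>. cinner (T' \<xi>) \<eta> = cinner \<xi> (T \<eta>)" using assms by blast
  fix R assume "\<forall>\<xi> \<eta>. cinner (blinfun_apply R \<xi>) \<eta> = cinner \<xi> (blinfun_apply T \<eta>)"
  thus "R = T'" by (intro blinfun_eqI cinner_eqI) (simp add: assms)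
qed

lemma cinner_op_adj:
  assumes "T \<in> bounded_clinear_ops"
  shows "cinner (op_adj T \<xi>) \<eta> = cinner \<xi> (T \<eta>)"
  using adjoint_exists[OF assms] op_adj_eqI[of _ T] by metis

lemma cinner_op_adj_right:
  assumes "T \<in> bounded_clinear_ops"
  shows "cinner \<xi> (op_adj T \<eta>) = cinner (T \<xi>) \<eta>"
  by (metis cinner_op_adj[OF assms] cinner_commute)

lemma norm_op_adj_le:
  assumes T: "T \<in> bounded_clinear_ops"
  shows "norm (op_adj T) \<le> norm T"
proof (rule norm_blinfun_bound)
  fix x
  let ?y = "op_adj T x"
  show "norm ?y \<le> norm T * norm x"
  proof (cases "?y = 0")
    case False
    have "(norm ?y)\<^sup>2 = Re (cinner x (T ?y))" by (simp add: norm_sq_cinner cinner_op_adj[OF T])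
    also have "\<dots> \<le> norm x * norm (T ?y)"
      using complex_Re_le_cmod cinner_Cauchy_Schwarz order_trans by blast
    also have "\<dots> \<le> norm x * (norm T * norm ?y)"
      by (intro mult_left_mono norm_blinfun) simp
    finally show ?thesis using False by (simp add: power2_eq_square mult_ac)
  qed simp
qed simp

section \<open>The algebra of complex-linear operators\<close>

lemma op_scaleC_apply [simp]: "blinfun_apply (op_scaleC c T) \<xi> = scaleC c (T \<xi>)"
proof -
  have "bounded_linear (\<lambda>\<xi>. scaleC c (T \<xi>))"
    by (rule bounded_linear_intro[where K = "cmod c * norm T"])
       (auto simp: blinfun.bilinear_simps scaleC_add_right scaleC_scaleR norm_scaleC mult.assoc mult.commute[of "norm _" "cmod c * _"] intro!: mult_left_mono norm_blinfun)
  thus ?thesis by (simp add: op_scaleC_def bounded_linear_Blinfun_apply)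
qed

lemma op_scaleC_of_real: "op_scaleC (complex_of_real r) T = r *\<^sub>R T"
  by (rule blinfun_eqI) (simp add: scaleC_of_real blinfun.bilinear_simps)

lemma norm_op_scaleC_le: "norm (op_scaleC c T) \<le> cmod c * norm T"
  by (rule norm_blinfun_bound) (auto simp: norm_scaleC mult.assoc intro!: mult_left_mono norm_blinfun)

lemma clin_id [simp]: "id_blinfun \<in> bounded_clinear_ops"
  by (rule clinI) simp

lemma clin_zero [simp]: "0 \<in> bounded_clinear_ops"
  by (rule clinI) simp

lemma clin_add: "S \<in> bounded_clinear_ops \<Longrightarrow> T \<in> bounded_clinear_ops \<Longrightarrow> S + T \<in> bounded_clinear_ops"
  by (rule clinI) (simp add: clin_apply blinfun.bilinear_simps scaleC_add_right)

lemma clin_diff: "S \<in> bounded_clinear_ops \<Longrightarrow> T \<in> bounded_clinear_ops \<Longrightarrow> S - T \<in> bounded_clinear_ops"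
  by (rule clinI) (simp add: clin_apply blinfun.bilinear_simps scaleC_diff_right)

lemma clin_scaleR: "T \<in> bounded_clinear_ops \<Longrightarrow> r *\<^sub>R T \<in> bounded_clinear_ops"
  by (rule clinI) (simp add: clin_apply blinfun.bilinear_simps scaleC_scaleR)

lemma clin_scaleC: "T \<in> bounded_clinear_ops \<Longrightarrow> op_scaleC c T \<in> bounded_clinear_ops"
  by (rule clinI) (simp add: clin_apply scaleC_scaleC mult.commute)

lemma clin_compose: "S \<in> bounded_clinear_ops \<Longrightarrow> T \<in> bounded_clinear_ops \<Longrightarrow> S o\<^sub>L T \<in> bounded_clinear_ops"
  by (rule clinI) (simp add: clin_apply)

lemma clin_sum: "(\<And>i. i \<in> I \<Longrightarrow> f i \<in> bounded_clinear_ops) \<Longrightarrow> (\<Sum>i\<in>I. f i) \<in> bounded_clinear_ops"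
  by (induction I rule: infinite_finite_induct) (auto intro: clin_add)

lemma tendsto_blinfun_apply_const: "(T \<longlongrightarrow> R) F \<Longrightarrow> ((\<lambda>k. blinfun_apply (T k) \<xi>) \<longlongrightarrow> R \<xi>) F"
  by (intro blinfun.tendsto tendsto_const)

lemma bounded_linear_scaleC: "bounded_linear (scaleC c :: 'a::complex_hilbert \<Rightarrow> 'a)"
  by (rule bounded_linear_intro[where K = "cmod c"])
     (auto simp: scaleC_add_right scaleC_scaleR norm_scaleC)

lemma clin_lim:
  assumes "\<And>k. T k \<in> bounded_clinear_ops" "(T :: nat \<Rightarrow> _) \<longlonglongrightarrow> R"
  shows "R \<in> bounded_clinear_ops"
proof (rule clinI)
  fix c \<xi>
  have "(\<lambda>k. blinfun_apply (T k) (scaleC c \<xi>)) \<longlonglongrightarrow> scaleC c (R \<xi>)"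
    unfolding clin_apply[OF assms(1)]
    by (intro bounded_linear.tendsto[OF bounded_linear_scaleC] tendsto_blinfun_apply_const assms)
  thus "R (scaleC c \<xi>) = scaleC c (R \<xi>)"
    using LIMSEQ_unique tendsto_blinfun_apply_const[OF assms(2)] by blast
qed

lemma clin_adj:
  assumes "T \<in> bounded_clinear_ops"
  shows "op_adj T \<in> bounded_clinear_ops"
  by (rule clinI, rule cinner_eqI) (simp add: cinner_op_adj[OF assms] cinner_simps)

lemma compose_assoc: "(R o\<^sub>L S) o\<^sub>L T = R o\<^sub>L (S o\<^sub>L T)"
  by (rule blinfun_eqI) simp

lemma compose_id [simp]: "T o\<^sub>L id_blinfun = T" "id_blinfun o\<^sub>L T = T"
  by (auto intro: blinfun_eqI)

interpretation op_compose: bounded_bilinear "(o\<^sub>L)"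
  by (rule bounded_bilinear_blinfun_compose)

lemmas compose_simps = op_compose.add_left op_compose.add_right op_compose.diff_left
  op_compose.diff_right op_compose.scaleR_left op_compose.scaleR_right op_compose.minus_left
  op_compose.minus_right

section \<open>Powers, polynomials and inverses of operators\<close>

abbreviation op_pow :: "('h::complex_hilbert \<Rightarrow>\<^sub>L 'h) \<Rightarrow> nat \<Rightarrow> ('h \<Rightarrow>\<^sub>L 'h)" where
  "op_pow T k \<equiv> ((o\<^sub>L) T ^^ k) id_blinfun"

lemma op_pow_commute:
  assumes "S o\<^sub>L T = T o\<^sub>L S"
  shows "S o\<^sub>L op_pow T k = op_pow T k o\<^sub>L S"
proof (induction k)
  case (Suc k)
  thus ?case by (simp add: compose_assoc) (metis compose_assoc assms Suc)
qed simp

lemma norm_op_pow_le: "norm (op_pow T k) \<le> norm T ^ k"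
proof (induction k)
  case (Suc k)
  have "norm (op_pow T (Suc k)) \<le> norm T * norm (op_pow T k)" by (simp add: norm_blinfun_compose)
  also have "\<dots> \<le> norm T * norm T ^ k" by (intro mult_left_mono Suc) simp
  finally show ?case by simp
qed (simp add: norm_blinfun_id_le)

lemma clin_op_pow: "T \<in> bounded_clinear_ops \<Longrightarrow> op_pow T k \<in> bounded_clinear_ops"
  by (induction k) (auto intro: clin_compose)

definition op_invertible :: "('h::complex_hilbert \<Rightarrow>\<^sub>L 'h) \<Rightarrow> bool" where
  "op_invertible T \<longleftrightarrow> (\<exists>R\<in>bounded_clinear_ops. R o\<^sub>L T = id_blinfun \<and> T o\<^sub>L R = id_blinfun)"

lemma op_spectrum_of_real_iff:
  "complex_of_real t \<in> op_spectrum T \<longleftrightarrow> \<not> op_invertible (t *\<^sub>R id_blinfun - T)"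
  by (simp add: op_spectrum_def op_invertible_def op_scaleC_of_real)

lemma op_invertible_compose:
  assumes "op_invertible S" "op_invertible T"
  shows "op_invertible (S o\<^sub>L T)"
proof -
  obtain R R' where R: "R \<in> bounded_clinear_ops" "R o\<^sub>L S = id_blinfun" "S o\<^sub>L R = id_blinfun"
    and R': "R' \<in> bounded_clinear_ops" "R' o\<^sub>L T = id_blinfun" "T o\<^sub>L R' = id_blinfun"
    using assms unfolding op_invertible_def by blast
  have "(R' o\<^sub>L R) o\<^sub>L (S o\<^sub>L T) = R' o\<^sub>L (R o\<^sub>L S) o\<^sub>L T" by (simp only: compose_assoc)
  moreover have "(S o\<^sub>L T) o\<^sub>L (R' o\<^sub>L R) = S o\<^sub>L (T o\<^sub>L R') o\<^sub>L R" by (simp only: compose_assoc)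
  ultimately show ?thesis using R R' clin_compose[of R' R]
    unfolding op_invertible_def by (intro bexI[of _ "R' o\<^sub>L R"]) auto
qed

lemma op_invertible_scaleR:
  assumes "op_invertible S" "c \<noteq> 0"
  shows "op_invertible (c *\<^sub>R S)"
proof -
  obtain R where R: "R \<in> bounded_clinear_ops" "R o\<^sub>L S = id_blinfun" "S o\<^sub>L R = id_blinfun"
    using assms unfolding op_invertible_def by blast
  show ?thesis unfolding op_invertible_def
    by (rule bexI[of _ "inverse c *\<^sub>R R"]) (auto simp: R assms compose_simps clin_scaleR)
qed

lemma op_invertible_id: "op_invertible id_blinfun"
  unfolding op_invertible_def by (rule bexI[of _ id_blinfun]) auto

text \<open>A factor of an invertible product of commuting operators has a left and a right inverse,
  which then agree.\<close>

lemma op_invertible_factor: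
  assumes S: "S \<in> bounded_clinear_ops" and T: "T \<in> bounded_clinear_ops"
    and comm: "S o\<^sub>L T = T o\<^sub>L S" and inv: "op_invertible (S o\<^sub>L T)"
  shows "op_invertible S"
proof -
  obtain R where R: "R \<in> bounded_clinear_ops" "R o\<^sub>L (S o\<^sub>L T) = id_blinfun" "(S o\<^sub>L T) o\<^sub>L R = id_blinfun"
    using inv unfolding op_invertible_def by blast
  define L where "L = R o\<^sub>L T"
  have 1: "L o\<^sub>L S = id_blinfun" using R(2) by (simp add: L_def compose_assoc comm)
  have 2: "S o\<^sub>L (T o\<^sub>L R) = id_blinfun" using R(3) by (simp add: compose_assoc)
  have "L = L o\<^sub>L (S o\<^sub>L (T o\<^sub>L R))" using 2 by simp
  also have "\<dots> = T o\<^sub>L R" using 1 by (simp flip: compose_assoc)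
  finally have "L = T o\<^sub>L R" .
  thus ?thesis using 1 2 R(1) T unfolding op_invertible_def
    by (intro bexI[of _ L]) (auto simp: clin_compose)
qed

lemma Neumann_invertible:
  assumes X: "X \<in> bounded_clinear_ops" and norm: "norm X < 1"
  shows "op_invertible (id_blinfun - X)"
proof -
  have summ: "summable (op_pow X)"
    by (rule summable_comparison_test[OF _ summable_geometric[of "norm X"]])
       (use norm norm_op_pow_le in auto)
  define R where "R = (\<Sum>k. op_pow X k)"
  have R: "(\<lambda>n. \<Sum>k<n. op_pow X k) \<longlonglongrightarrow> R"
    unfolding R_def by (rule summable_LIMSEQ[OF summ])
  have pow0: "(\<lambda>n. id_blinfun - op_pow X n) \<longlonglongrightarrow> id_blinfun - 0"
    by (intro tendsto_intros summable_LIMSEQ_zero summ)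
  have com: "X o\<^sub>L op_pow X k = op_pow X k o\<^sub>L X" for k by (rule op_pow_commute) simp
  have tele: "(id_blinfun - X) o\<^sub>L (\<Sum>k<n. op_pow X k) = id_blinfun - op_pow X n" for n
    by (induction n) (auto simp: compose_simps op_compose.zero_right)
  have tele': "(\<Sum>k<n. op_pow X k) o\<^sub>L (id_blinfun - X) = id_blinfun - op_pow X n" for n
  proof (induction n)
    case (Suc n)
    thus ?case by (simp add: compose_simps com) (simp add: algebra_simps)
  qed (simp add: op_compose.zero_left)
  have "(id_blinfun - X) o\<^sub>L R = id_blinfun"
    using LIMSEQ_unique[OF op_compose.tendsto[OF tendsto_const R, of "id_blinfun - X"] ]
      pow0 unfolding tele by simp
  moreover have "R o\<^sub>L (id_blinfun - X) = id_blinfun"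
    using LIMSEQ_unique[OF op_compose.tendsto[OF R tendsto_const, of "id_blinfun - X"] ]
      pow0 unfolding tele' by simp
  moreover have "R \<in> bounded_clinear_ops"
    by (rule clin_lim[OF _ R]) (intro clin_sum clin_op_pow X)
  ultimately show ?thesis unfolding op_invertible_def by blast
qed

text \<open>For a small step \<open>s > 0\<close>, coercivity makes \<open>1 - s D\<close> a strict contraction, so that \<open>s D\<close> is
  invertible by a Neumann series.\<close>

lemma coercive_invertible:
  fixes D :: "'h::complex_hilbert \<Rightarrow>\<^sub>L 'h"
  assumes D: "D \<in> bounded_clinear_ops" and \<delta>: "\<delta> > 0"
    and coer: "\<And>\<xi>. Re (cinner \<xi> (D \<xi>)) \<ge> \<delta> * (norm \<xi>)\<^sup>2"
  shows "op_invertible D"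
proof -
  define K where "K = (norm D)\<^sup>2 + \<delta>\<^sup>2"
  have K: "K > 0" "(norm D)\<^sup>2 \<le> K" "\<delta>\<^sup>2 \<le> K" using \<delta> by (auto simp: K_def add_nonneg_pos)
  define s where "s = \<delta> / K"
  have s: "s > 0" using \<delta> K by (simp add: s_def)
  define X where "X = id_blinfun - s *\<^sub>R D"
  have X: "X \<in> bounded_clinear_ops" unfolding X_def by (intro clin_diff clin_scaleR D clin_id)
  define \<theta> where "\<theta> = 1 - \<delta>\<^sup>2 / K"
  have \<theta>: "0 \<le> \<theta>" "\<theta> < 1" using K \<delta> by (auto simp: \<theta>_def)
  have "norm X \<le> sqrt \<theta>"
  proof (rule norm_blinfun_bound)
    fix \<xi>
    have "(norm (X \<xi>))\<^sup>2 = (norm \<xi>)\<^sup>2 - 2 * s * Re (cinner \<xi> (D \<xi>)) + s\<^sup>2 * (norm (D \<xi>))\<^sup>2"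
      by (simp add: X_def blinfun.bilinear_simps norm_diff_sq cinner_simps power_mult_distrib)
    also have "\<dots> \<le> (norm \<xi>)\<^sup>2 - 2 * s * (\<delta> * (norm \<xi>)\<^sup>2) + s\<^sup>2 * (K * (norm \<xi>)\<^sup>2)"
    proof -
      have "(norm (D \<xi>))\<^sup>2 \<le> (norm D * norm \<xi>)\<^sup>2" by (intro power_mono norm_blinfun) simp
      also have "\<dots> \<le> K * (norm \<xi>)\<^sup>2" using K by (simp add: power_mult_distrib mult_right_mono)
      finally have "s\<^sup>2 * (norm (D \<xi>))\<^sup>2 \<le> s\<^sup>2 * (K * (norm \<xi>)\<^sup>2)" by (intro mult_left_mono) auto
      moreover have "2 * s * (\<delta> * (norm \<xi>)\<^sup>2) \<le> 2 * s * Re (cinner \<xi> (D \<xi>))"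
        using s by (intro mult_left_mono coer) simp
      ultimately show ?thesis by linarith
    qed
    also have "\<dots> = (1 - 2 * s * \<delta> + s\<^sup>2 * K) * (norm \<xi>)\<^sup>2" by (simp add: algebra_simps)
    also have "1 - 2 * s * \<delta> + s\<^sup>2 * K = \<theta>"
      using K by (simp add: s_def \<theta>_def field_simps power2_eq_square)
    finally have "(norm (X \<xi>))\<^sup>2 \<le> (sqrt \<theta> * norm \<xi>)\<^sup>2" using \<theta> by (simp add: power_mult_distrib)
    thus "norm (X \<xi>) \<le> sqrt \<theta> * norm \<xi>" by (rule power2_le_imp_le) (use \<theta> in simp)
  qed (use \<theta> in simp)
  also have "sqrt \<theta> < 1" using \<theta> by simp
  finally have "op_invertible (id_blinfun - X)" by (rule Neumann_invertible[OF X])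
  hence "op_invertible (inverse s *\<^sub>R (s *\<^sub>R D))"
    using s by (intro op_invertible_scaleR[of "s *\<^sub>R D"]) (auto simp: X_def)
  moreover have "inverse s *\<^sub>R (s *\<^sub>R D) = D" using s by simp
  ultimately show ?thesis by (simp only:)
qed

lemma op_poly_alt: "degree P \<le> n \<Longrightarrow> op_poly P T = (\<Sum>i\<le>n. coeff P i *\<^sub>R op_pow T i)"
  unfolding op_poly_def by (rule sum.mono_neutral_left) (auto simp: coeff_eq_0)

lemma op_poly_0 [simp]: "op_poly 0 T = 0" by (simp add: op_poly_def)

lemma op_poly_pCons: "op_poly (pCons c P) T = c *\<^sub>R id_blinfun + (T o\<^sub>L op_poly P T)"
proof -
  have "op_poly (pCons c P) T = (\<Sum>i\<le>Suc (degree P). coeff (pCons c P) i *\<^sub>R op_pow T i)"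
    by (rule op_poly_alt) (simp add: degree_pCons_le)
  also have "\<dots> = c *\<^sub>R id_blinfun + (\<Sum>i\<le>degree P. coeff P i *\<^sub>R (T o\<^sub>L op_pow T i))"
    by (subst sum.atMost_Suc_shift) simp
  also have "(\<Sum>i\<le>degree P. coeff P i *\<^sub>R (T o\<^sub>L op_pow T i)) = T o\<^sub>L op_poly P T"
    by (simp add: op_poly_def op_compose.sum_right compose_simps)
  finally show ?thesis .
qed

lemma op_poly_add: "op_poly (P + Q) T = op_poly P T + op_poly Q T"
proof -
  let ?n = "max (degree P) (degree Q)"
  have "degree (P + Q) \<le> ?n" by (rule degree_add_le) auto
  thus ?thesis by (simp add: op_poly_alt[of _ ?n] sum.distrib scaleR_add_left)
qed

lemma op_poly_smult: "op_poly (smult c P) T = c *\<^sub>R op_poly P T"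
  by (induction P) (simp_all add: op_poly_pCons compose_simps scaleR_add_right)

lemma op_poly_diff: "op_poly (P - Q) T = op_poly P T - op_poly Q T"
  using op_poly_add[of "P - Q" Q T] by simp

lemma op_poly_mult: "op_poly (P * Q) T = op_poly P T o\<^sub>L op_poly Q T"
  by (induction P) (simp_all add: op_poly_pCons op_poly_add op_poly_smult compose_simps compose_assoc)

lemma op_poly_const: "op_poly [:c:] T = c *\<^sub>R id_blinfun"
  by (simp add: op_poly_pCons)

lemma op_poly_1: "op_poly 1 T = id_blinfun"
  using op_poly_const[of 1 T] by (simp add: one_pCons)

lemma op_poly_linear: "op_poly [:c, 1:] T = c *\<^sub>R id_blinfun + T"
  by (simp add: op_poly_pCons)

lemma op_poly_sum: "op_poly (\<Sum>i\<in>I. P i) T = (\<Sum>i\<in>I. op_poly (P i) T)"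
  by (induction I rule: infinite_finite_induct) (auto simp: op_poly_add)

lemma op_poly_power: "op_poly (P ^ k) T = op_pow (op_poly P T) k"
  by (induction k) (auto simp: op_poly_1 op_poly_mult)

lemma op_poly_pcompose: "op_poly (pcompose P Q) T = op_poly P (op_poly Q T)"
  by (induction P) (simp_all add: op_poly_pCons pcompose_pCons op_poly_add op_poly_mult)

section \<open>Spectral bounds for self-adjoint operators\<close>

definition self_adjoint :: "('h::complex_hilbert \<Rightarrow>\<^sub>L 'h) \<Rightarrow> bool" where
  "self_adjoint A \<longleftrightarrow> A \<in> bounded_clinear_ops \<and> (\<forall>\<xi> \<eta>. cinner (A \<xi>) \<eta> = cinner \<xi> (A \<eta>))"

lemma self_adjoint_clin: "self_adjoint A \<Longrightarrow> A \<in> bounded_clinear_ops"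
  by (simp add: self_adjoint_def)

lemma self_adjoint_cinner: "self_adjoint A \<Longrightarrow> cinner (A \<xi>) \<eta> = cinner \<xi> (A \<eta>)"
  by (simp add: self_adjoint_def)

lemma self_adjoint_id [simp]: "self_adjoint id_blinfun"
  by (simp add: self_adjoint_def)

lemma self_adjoint_scaleR: "self_adjoint A \<Longrightarrow> self_adjoint (c *\<^sub>R A)"
  by (auto simp: self_adjoint_def clin_scaleR blinfun.bilinear_simps cinner_simps)

lemma self_adjoint_add: "self_adjoint A \<Longrightarrow> self_adjoint B \<Longrightarrow> self_adjoint (A + B)"
  by (auto simp: self_adjoint_def clin_add blinfun.bilinear_simps cinner_simps)

lemma self_adjoint_op_poly:
  assumes A: "self_adjoint A"
  shows "self_adjoint (op_poly P A)"
proof (induction P)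
  case 0
  then show ?case by (simp add: self_adjoint_def)
next
  case (pCons c P)
  have comm: "op_poly P A o\<^sub>L A = A o\<^sub>L op_poly P A"
    using op_poly_mult[of P "[:0,1:]" A] op_poly_mult[of "[:0,1:]" P A]
    by (simp add: op_poly_linear mult.commute)
  have "self_adjoint (A o\<^sub>L op_poly P A)"
    unfolding self_adjoint_def
  proof (intro conjI allI)
    show "A o\<^sub>L op_poly P A \<in> bounded_clinear_ops"
      by (intro clin_compose self_adjoint_clin A pCons)
    fix \<xi> \<eta>
    have "cinner ((A o\<^sub>L op_poly P A) \<xi>) \<eta> = cinner \<xi> ((op_poly P A o\<^sub>L A) \<eta>)"
      by (simp add: self_adjoint_cinner[OF A] self_adjoint_cinner[OF pCons(2)])
    thus "cinner ((A o\<^sub>L op_poly P A) \<xi>) \<eta> = cinner \<xi> ((A o\<^sub>L op_poly P A) \<eta>)" by (simp only: comm)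
  qed
  thus ?case by (simp add: op_poly_pCons self_adjoint_add self_adjoint_scaleR)
qed

lemma self_adjoint_lim:
  assumes "\<And>k. self_adjoint (T k)" "(T :: nat \<Rightarrow> _) \<longlonglongrightarrow> R"
  shows "self_adjoint R"
  unfolding self_adjoint_def
proof (intro conjI allI)
  show "R \<in> bounded_clinear_ops"
    using clin_lim[OF _ assms(2)] assms(1) self_adjoint_clin by blast
  fix \<xi> \<eta>
  have 1: "(\<lambda>k. cinner (T k \<xi>) \<eta>) \<longlonglongrightarrow> cinner (R \<xi>) \<eta>"
    by (intro tendsto_cinner tendsto_blinfun_apply_const assms tendsto_const)
  have 2: "(\<lambda>k. cinner \<xi> (T k \<eta>)) \<longlonglongrightarrow> cinner \<xi> (R \<eta>)"
    by (intro tendsto_cinner tendsto_blinfun_apply_const assms tendsto_const)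
  show "cinner (R \<xi>) \<eta> = cinner \<xi> (R \<eta>)"
    using LIMSEQ_unique[OF 1] 2 by (simp add: self_adjoint_cinner[OF assms(1)])
qed

lemma poly_of_real_add:
  "poly (map_poly complex_of_real (P + Q)) z = poly (map_poly of_real P) z + poly (map_poly of_real Q) z"
proof (induction P Q rule: poly_induct2)
  case (pCons a p b q)
  then show ?case by (simp add: map_poly_pCons algebra_simps)
qed simp

lemma poly_of_real_smult:
  "poly (map_poly complex_of_real (smult c P)) z = of_real c * poly (map_poly of_real P) z"
  by (induction P) (auto simp: map_poly_pCons algebra_simps)

lemma poly_of_real_mult:
  "poly (map_poly complex_of_real (P * Q)) z = poly (map_poly of_real P) z * poly (map_poly of_real Q) z"
proof (induction P)
  case (pCons a p)
  then show ?case
    by (simp add: map_poly_pCons poly_of_real_add poly_of_real_smult algebra_simps)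
qed simp

lemma poly_of_real_of_real: "poly (map_poly complex_of_real P) (of_real t) = of_real (poly P t)"
  by (induction P) (auto simp: map_poly_pCons)

text \<open>By induction on the degree, splitting off the factor of a complex root. The linear factor of a
  real root is invertible because the root lies outside the spectrum; the quadratic factor
  \<open>(t - b)\<^sup>2 + d\<^sup>2\<close> of a pair of conjugate roots \<open>b \<plusminus> \<i> d\<close> gives a coercive operator. So only the
  real points of the spectrum matter.\<close>

lemma op_invertible_op_poly:
  fixes A :: "'h::complex_hilbert \<Rightarrow>\<^sub>L 'h"
  assumes A: "self_adjoint A"
  shows "Q \<noteq> 0 \<Longrightarrow> (\<And>t. complex_of_real t \<in> op_spectrum A \<Longrightarrow> poly Q t \<noteq> 0) \<Longrightarrow> op_invertible (op_poly Q A)"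
proof (induction "degree Q" arbitrary: Q rule: less_induct)
  case less
  show ?case
  proof (cases "degree Q = 0")
    case True
    then obtain c where c: "Q = [:c:]" by (metis degree_eq_zeroE)
    with less.prems have "c \<noteq> 0" by auto
    thus ?thesis by (simp add: c op_poly_const op_invertible_scaleR op_invertible_id)
  next
    case False
    have "degree (map_poly complex_of_real Q) = degree Q" by (rule degree_map_poly) simp
    hence "\<not> constant (poly (map_poly complex_of_real Q))" using False by (simp add: constant_degree)
    then obtain z where z: "poly (map_poly complex_of_real Q) z = 0"
      using fundamental_theorem_of_algebra by blast
    have main: "op_invertible (op_poly Q A)" if q: "q dvd Q" "degree q > 0" "op_invertible (op_poly q A)" for q
    proof -
      obtain k where k: "Q = q * k" using q(1) by (rule dvdE)
      have "k \<noteq> 0" "q \<noteq> 0" using k less.prems(1) by auto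
      hence "degree k < degree Q" using k q(2) by (simp add: degree_mult_eq)
      moreover have "poly k t \<noteq> 0" if "complex_of_real t \<in> op_spectrum A" for t
        using less.prems(2)[OF that] k by auto
      ultimately have "op_invertible (op_poly k A)" using less.hyps \<open>k \<noteq> 0\<close> by blast
      thus ?thesis unfolding k op_poly_mult by (intro op_invertible_compose q(3))
    qed
    show ?thesis
    proof (cases "Im z = 0")
      case True
      define t where "t = Re z"
      have zt: "z = of_real t" using True by (simp add: t_def complex_eq_iff)
      hence "poly Q t = 0" using z by (simp add: poly_of_real_of_real)
      hence "[:-t, 1:] dvd Q" by (simp add: poly_eq_0_iff_dvd)
      moreover have "complex_of_real t \<notin> op_spectrum A" using less.prems(2) \<open>poly Q t = 0\<close> by blast
      hence "op_invertible ((-1) *\<^sub>R (t *\<^sub>R id_blinfun - A))"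
        by (intro op_invertible_scaleR) (auto simp: op_spectrum_of_real_iff)
      hence "op_invertible (op_poly [:-t, 1:] A)" by (simp add: op_poly_linear)
      ultimately show ?thesis by (intro main[of "[:-t,1:]"]) auto
    next
      case False
      define b d where "b = Re z" and "d = Im z"
      have zbd: "z = Complex b d" by (simp add: b_def d_def)
      define q where "q = [:b\<^sup>2 + d\<^sup>2, -2 * b, 1:]"
      have qz: "poly (map_poly complex_of_real q) z = 0"
        by (simp add: q_def zbd map_poly_pCons complex_eq_iff power2_eq_square algebra_simps)
      have deg: "degree q = 2" by (simp add: q_def)
      have "q \<noteq> 0" using deg by auto
      have "poly (map_poly complex_of_real (q * (Q div q) + Q mod q)) z = 0"
        using z by simp
      hence rz: "poly (map_poly complex_of_real (Q mod q)) z = 0"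
        by (simp only: poly_of_real_add poly_of_real_mult qz) simp
      have "Q mod q = 0"
      proof (rule ccontr)
        assume nz: "Q mod q \<noteq> 0"
        hence "degree (Q mod q) < 2" using degree_mod_less'[OF \<open>q \<noteq> 0\<close> nz] deg by simp
        hence "Q mod q = [:coeff (Q mod q) 0, coeff (Q mod q) 1:]"
          by (intro poly_eqI) (auto simp: coeff_pCons coeff_eq_0 split: nat.splits)
        then obtain u v where uv: "Q mod q = [:u, v:]" by blast
        have "v * d = 0" "u + v * b = 0"
          using rz unfolding uv by (auto simp: map_poly_pCons zbd complex_eq_iff algebra_simps)
        hence "v = 0" "u = 0" using False by (auto simp: d_def)
        thus False using nz uv by simp
      qed
      hence "q dvd Q" by auto
      moreover have "op_invertible (op_poly q A)"
      proof (rule coercive_invertible)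
        show "op_poly q A \<in> bounded_clinear_ops" by (intro self_adjoint_clin self_adjoint_op_poly A)
        show "d\<^sup>2 > 0" using False by (simp add: d_def)
        fix \<xi>
        have q: "q = [:-b,1:] * [:-b,1:] + [:d\<^sup>2:]" by (simp add: q_def power2_eq_square)
        define C where "C = op_poly [:-b,1:] A"
        have C: "self_adjoint C" unfolding C_def by (rule self_adjoint_op_poly[OF A])
        have "op_poly q A = (C o\<^sub>L C) + d\<^sup>2 *\<^sub>R id_blinfun"
          unfolding q op_poly_add op_poly_mult op_poly_const C_def ..
        hence "Re (cinner \<xi> (op_poly q A \<xi>)) = (norm (C \<xi>))\<^sup>2 + d\<^sup>2 * (norm \<xi>)\<^sup>2"
          by (simp add: blinfun.bilinear_simps cinner_simps norm_sq_cinner flip: self_adjoint_cinner[OF C])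
        thus "d\<^sup>2 * (norm \<xi>)\<^sup>2 \<le> Re (cinner \<xi> (op_poly q A \<xi>))" by simp
      qed
      ultimately show ?thesis using deg by (intro main[of q]) auto
    qed
  qed
qed

text \<open>One of \<open>\<plusminus>\<parallel>B\<parallel>\<close> lies in the spectrum, because vectors that nearly attain the norm of \<open>B\<close> are
  approximate eigenvectors of \<open>B\<^sup>2\<close> for \<open>\<parallel>B\<parallel>\<^sup>2\<close>.\<close>

lemma norm_in_spectrum:
  fixes B :: "'h::complex_hilbert \<Rightarrow>\<^sub>L 'h"
  assumes B: "self_adjoint B" and pos: "norm B > 0"
    and i1: "op_invertible (B - norm B *\<^sub>R id_blinfun)"
    and i2: "op_invertible (B + norm B *\<^sub>R id_blinfun)"
  shows False
proof -
  define l where "l = norm B"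
  define D where "D = (B - l *\<^sub>R id_blinfun) o\<^sub>L (B + l *\<^sub>R id_blinfun)"
  have "op_invertible D" unfolding D_def l_def by (rule op_invertible_compose[OF i1 i2])
  then obtain R where R: "R o\<^sub>L D = id_blinfun" unfolding op_invertible_def by blast
  have D: "D \<xi> = B (B \<xi>) - l\<^sup>2 *\<^sub>R \<xi>" for \<xi>
    by (simp add: D_def blinfun.bilinear_simps algebra_simps power2_eq_square)
  define K where "K = norm R + 1"
  have K: "K > 0" by (simp add: K_def add_nonneg_pos)
  have l: "l > 0" using pos by (simp add: l_def)
  \<comment> \<open>If \<open>B\<^sup>2 - \<parallel>B\<parallel>\<^sup>2\<close> had an inverse of norm at most \<open>K\<close>, then \<open>\<parallel>B\<parallel>\<^sup>2\<close> could be lowered by \<open>\<kappa>\<close>.\<close>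
  define \<kappa> where "\<kappa> = 1 / (2 * l\<^sup>2 * K\<^sup>2)"
  have \<kappa>: "\<kappa> > 0" using l K by (simp add: \<kappa>_def)
  have key: "(norm (B \<xi>))\<^sup>2 \<le> (l\<^sup>2 - \<kappa>) * (norm \<xi>)\<^sup>2" for \<xi>
  proof -
    have "norm \<xi> = norm (R (D \<xi>))" using R by (metis blinfun_apply_blinfun_compose blinfun_apply_id_blinfun id_apply)
    also have "\<dots> \<le> norm R * norm (D \<xi>)" by (rule norm_blinfun)
    also have "\<dots> \<le> K * norm (D \<xi>)" by (intro mult_right_mono) (auto simp: K_def)
    finally have "(norm \<xi>)\<^sup>2 \<le> (K * norm (D \<xi>))\<^sup>2" by (intro power_mono) auto
    hence 1: "(norm \<xi>)\<^sup>2 \<le> K\<^sup>2 * (norm (D \<xi>))\<^sup>2" by (simp add: power_mult_distrib)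
    have "Re (cinner (B (B \<xi>)) \<xi>) = (norm (B \<xi>))\<^sup>2"
      by (simp add: self_adjoint_cinner[OF B] norm_sq_cinner)
    hence N: "(norm (D \<xi>))\<^sup>2 = (norm (B (B \<xi>)))\<^sup>2 - 2 * l\<^sup>2 * (norm (B \<xi>))\<^sup>2 + l ^ 4 * (norm \<xi>)\<^sup>2"
      unfolding D norm_diff_sq by (simp add: cinner_simps power_mult_distrib flip: power_mult)
    have "(norm (B (B \<xi>)))\<^sup>2 \<le> (l * norm (B \<xi>))\<^sup>2"
      unfolding l_def by (intro power_mono norm_blinfun) simp
    hence N2: "(norm (B (B \<xi>)))\<^sup>2 \<le> l\<^sup>2 * (norm (B \<xi>))\<^sup>2" by (simp add: power_mult_distrib)
    have "(norm (B \<xi>))\<^sup>2 \<le> (l * norm \<xi>)\<^sup>2"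
      unfolding l_def by (intro power_mono norm_blinfun) simp
    hence N1: "l\<^sup>2 * (norm (B \<xi>))\<^sup>2 \<le> l\<^sup>2 * (l\<^sup>2 * (norm \<xi>)\<^sup>2)"
      by (intro mult_left_mono) (auto simp: power_mult_distrib)
    have l4: "l ^ 4 * (norm \<xi>)\<^sup>2 = l\<^sup>2 * (l\<^sup>2 * (norm \<xi>)\<^sup>2)" by (simp flip: power_add mult.assoc)
    have 2: "(norm (D \<xi>))\<^sup>2 \<le> 2 * l\<^sup>2 * (l\<^sup>2 * (norm \<xi>)\<^sup>2 - (norm (B \<xi>))\<^sup>2)"
      unfolding right_diff_distrib mult.assoc using N N1 N2 l4 by linarith
    have "(norm \<xi>)\<^sup>2 \<le> K\<^sup>2 * (2 * l\<^sup>2 * (l\<^sup>2 * (norm \<xi>)\<^sup>2 - (norm (B \<xi>))\<^sup>2))"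
      using 1 mult_left_mono[OF 2, of "K\<^sup>2"] by simp
    hence "\<kappa> * (norm \<xi>)\<^sup>2 \<le> \<kappa> * (K\<^sup>2 * (2 * l\<^sup>2 * (l\<^sup>2 * (norm \<xi>)\<^sup>2 - (norm (B \<xi>))\<^sup>2)))"
      using \<kappa> by (intro mult_left_mono) auto
    also have "\<dots> = l\<^sup>2 * (norm \<xi>)\<^sup>2 - (norm (B \<xi>))\<^sup>2"
      using K l by (simp add: \<kappa>_def)
    finally show ?thesis by (simp add: algebra_simps)
  qed
  define c where "c = max 0 (l\<^sup>2 - \<kappa>)"
  have "norm B \<le> sqrt c"
  proof (rule norm_blinfun_bound)
    fix \<xi>
    have "(norm (B \<xi>))\<^sup>2 \<le> c * (norm \<xi>)\<^sup>2"
      using key[of \<xi>] by (rule order_trans) (auto simp: c_def intro: mult_right_mono)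
    also have "\<dots> = (sqrt c * norm \<xi>)\<^sup>2" by (simp add: power_mult_distrib c_def)
    finally show "norm (B \<xi>) \<le> sqrt c * norm \<xi>" by (rule power2_le_imp_le) (simp add: c_def)
  qed (simp add: c_def)
  moreover have "sqrt c < sqrt (l\<^sup>2)" using l \<kappa> by (intro real_sqrt_less_mono) (simp add: c_def)
  ultimately show False using l by (simp add: l_def)
qed

text \<open>If \<open>l = \<parallel>P(A)\<parallel>\<close> exceeded the bound, then \<open>P + l\<close> and \<open>P - l\<close> would have no zeros in the spectrum of
  \<open>A\<close>, so both \<open>P(A) + l\<close> and \<open>P(A) - l\<close> would be invertible.\<close>

lemma norm_op_poly_le:
  fixes A :: "'a::complex_hilbert \<Rightarrow>\<^sub>L 'a"
  assumes A: "self_adjoint A" and c: "c \<ge> 0"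
    and bound: "\<And>t. complex_of_real t \<in> op_spectrum A \<Longrightarrow> \<bar>poly P t\<bar> \<le> c"
  shows "norm (op_poly P A) \<le> c"
proof (rule ccontr)
  assume "\<not> ?thesis"
  define l where "l = norm (op_poly P A)"
  have l: "l > c" using \<open>\<not> norm (op_poly P A) \<le> c\<close> by (simp add: l_def)
  have inv: "op_invertible (op_poly P A + s *\<^sub>R id_blinfun)" if s: "\<bar>s\<bar> = l" for s
  proof -
    have "op_invertible (op_poly (P + [:s:]) A)"
    proof (cases "P + [:s:] = 0")
      case False
      show ?thesis
      proof (rule op_invertible_op_poly[OF A False])
        fix t assume "complex_of_real t \<in> op_spectrum A"
        from bound[OF this] show "poly (P + [:s:]) t \<noteq> 0" using s l by auto
      qed
    next
      case True
      \<comment> \<open>Then no real number lies in the spectrum, which forces the space to be trivial.\<close>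
      have "P = (P + [:s:]) - [:s:]" by simp
      also have "\<dots> = [:-s:]" using True by simp
      finally have P: "P = [:-s:]" .
      have "complex_of_real t \<notin> op_spectrum A" for t using bound[of t] s l by (auto simp: P)
      hence spec: "op_invertible (t *\<^sub>R id_blinfun - A)" for t using op_spectrum_of_real_iff by blast
      have "A = 0"
      proof (rule ccontr)
        assume "A \<noteq> 0"
        have "op_invertible ((-1) *\<^sub>R (t *\<^sub>R id_blinfun - A))" for t
          by (intro op_invertible_scaleR spec) simp
        hence i: "op_invertible (A - t *\<^sub>R id_blinfun)" for t by simp
        show False
          using norm_in_spectrum[OF A] i[of "norm A"] i[of "- norm A"] \<open>A \<noteq> 0\<close> by simp
      qed
      with spec[of 0] have "op_invertible (0 :: 'a \<Rightarrow>\<^sub>L 'a)" by simp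
      hence "id_blinfun = (0 :: 'a \<Rightarrow>\<^sub>L 'a)"
        unfolding op_invertible_def by (auto simp: op_compose.zero_left)
      hence "op_poly P A = 0" by (simp add: P op_poly_const)
      thus ?thesis using l c by (simp add: l_def)
    qed
    thus ?thesis by (simp add: op_poly_add op_poly_const)
  qed
  have pos: "norm (op_poly P A) > 0" using l c unfolding l_def by linarith
  show False
    using norm_in_spectrum[OF self_adjoint_op_poly[OF A] pos] inv[of l] inv[of "-l"] pos
    by (simp add: l_def)
qed

section \<open>Continuous functional calculus near the identity\<close>

lemma spectrum_near:
  assumes A: "self_adjoint A" and t: "complex_of_real t \<in> op_spectrum A"
  shows "\<bar>t - s\<bar> \<le> norm (A - s *\<^sub>R id_blinfun)"
proof (rule ccontr)
  assume less: "\<not> ?thesis"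
  define X where "X = A - s *\<^sub>R id_blinfun"
  have ts: "t - s \<noteq> 0" and nX: "norm X < \<bar>t - s\<bar>" using less by (auto simp: X_def)
  have "op_invertible (id_blinfun - inverse (t - s) *\<^sub>R X)"
  proof (rule Neumann_invertible)
    show "inverse (t - s) *\<^sub>R X \<in> bounded_clinear_ops"
      unfolding X_def by (intro clin_scaleR clin_diff self_adjoint_clin A clin_id)
    show "norm (inverse (t - s) *\<^sub>R X) < 1" using nX ts by (simp add: field_simps)
  qed
  hence "op_invertible ((t - s) *\<^sub>R (id_blinfun - inverse (t - s) *\<^sub>R X))"
    by (rule op_invertible_scaleR[OF _ ts])
  also have "(t - s) *\<^sub>R (id_blinfun - inverse (t - s) *\<^sub>R X) = t *\<^sub>R id_blinfun - A"
    using ts by (simp add: scaleR_diff_right X_def scaleR_diff_left)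
  finally show False using t by (simp add: op_spectrum_of_real_iff)
qed

text \<open>Two sequences of polynomials with the same uniform limit on the spectrum have the same limit at
  \<open>A\<close> by the spectral bound, so one convergent sequence already determines \<open>f(A)\<close>.\<close>

lemma op_cfc_eqI:
  assumes A: "self_adjoint A"
    and P: "uniform_limit {t. complex_of_real t \<in> op_spectrum A} (\<lambda>k t. poly (P k) t) f sequentially"
    and R: "(\<lambda>k. op_poly (P k) A) \<longlonglongrightarrow> R"
  shows "op_cfc f A = R"
proof -
  let ?S = "{t. complex_of_real t \<in> op_spectrum A}"
  have conv: "(\<lambda>k. op_poly (Q k) A) \<longlonglongrightarrow> R"
    if Q: "uniform_limit ?S (\<lambda>k t. poly (Q k) t) f sequentially" for Q
  proof -
    have "uniform_limit ?S (\<lambda>k t. poly (Q k) t - poly (P k) t) (\<lambda>t. f t - f t) sequentially"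
      by (intro uniform_limit_intros Q P)
    hence ul: "uniform_limit ?S (\<lambda>k t. poly (Q k - P k) t) (\<lambda>t. 0) sequentially" by simp
    have "(\<lambda>k. op_poly (Q k - P k) A) \<longlonglongrightarrow> 0"
    proof (rule tendstoI)
      fix e :: real assume e: "e > 0"
      hence "\<forall>\<^sub>F k in sequentially. \<forall>t\<in>?S. dist (poly (Q k - P k) t) 0 < e / 2"
        using ul by (intro uniform_limitD) auto
      thus "\<forall>\<^sub>F k in sequentially. dist (op_poly (Q k - P k) A) 0 < e"
      proof eventually_elim
        case (elim k)
        have "norm (op_poly (Q k - P k) A) \<le> e / 2"
          using elim e by (intro norm_op_poly_le[OF A]) (auto intro: less_imp_le)
        thus ?case using e by simp
      qed
    qed
    from tendsto_add[OF this R] show ?thesis by (simp add: op_poly_diff)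
  qed
  show ?thesis unfolding op_cfc_def
  proof (rule the_equality)
    show "\<forall>Q. uniform_limit ?S (\<lambda>k t. poly (Q k) t) f sequentially \<longrightarrow> (\<lambda>k. op_poly (Q k) A) \<longlonglongrightarrow> R"
      using conv by blast
    fix R' assume "\<forall>Q. uniform_limit ?S (\<lambda>k t. poly (Q k) t) f sequentially \<longrightarrow> (\<lambda>k. op_poly (Q k) A) \<longlonglongrightarrow> R'"
    thus "R' = R" using P R LIMSEQ_unique by blast
  qed
qed

lemma op_cfc_eqI':
  assumes A: "self_adjoint A" and S: "\<And>t. complex_of_real t \<in> op_spectrum A \<Longrightarrow> t \<in> S"
    and P: "uniform_limit S (\<lambda>k t. poly (P k) t) f sequentially"
    and R: "(\<lambda>k. op_poly (P k) A) \<longlonglongrightarrow> R"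
  shows "op_cfc f A = R"
  by (rule op_cfc_eqI[OF A uniform_limit_on_subset[OF P] R]) (use S in auto)

text \<open>Taylor polynomials of \<open>t powr s\<close> at \<open>1\<close>, and the binomial series \<open>(1 + U)\<^sup>s\<close>.\<close>

definition binomial_poly :: "real \<Rightarrow> nat \<Rightarrow> real poly" where
  "binomial_poly s k = (\<Sum>d<k. smult (s gchoose d) ([:-1, 1:] ^ d))"

definition op_binomial :: "real \<Rightarrow> ('h::complex_hilbert \<Rightarrow>\<^sub>L 'h) \<Rightarrow> ('h \<Rightarrow>\<^sub>L 'h)" where
  "op_binomial s U = (\<Sum>d. (s gchoose d) *\<^sub>R op_pow U d)"

lemma poly_binomial_poly: "poly (binomial_poly s k) t = (\<Sum>d<k. (s gchoose d) * (t - 1) ^ d)"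
  by (simp add: binomial_poly_def poly_sum poly_power)

lemma op_poly_binomial_poly:
  "op_poly (binomial_poly s k) A = (\<Sum>d<k. (s gchoose d) *\<^sub>R op_pow (A - id_blinfun) d)"
  by (simp add: binomial_poly_def op_poly_sum op_poly_smult op_poly_power op_poly_linear)

lemma summable_gbinomial:
  assumes "0 \<le> q" "q < (1::real)"
  shows "summable (\<lambda>d. \<bar>s gchoose d\<bar> * q ^ d)"
proof -
  obtain q' where q': "q < q'" "q' < 1" using dense[OF assms(2)] by blast
  have "summable (\<lambda>d. (s gchoose d) * q' ^ d)"
    using gen_binomial_real[of q' s] q' assms by (auto simp: sums_iff)
  from powser_insidea[OF this, of q] q' assms show ?thesis by (simp add: abs_mult)
qed

lemma uniform_limit_binomial_poly:
  assumes "q < 1"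
  shows "uniform_limit {t. \<bar>t - 1\<bar> \<le> q} (\<lambda>k t. poly (binomial_poly s k) t) (\<lambda>t. t powr s) sequentially"
proof (cases "q \<ge> 0")
  case True
  have "uniform_limit {t. \<bar>t - 1\<bar> \<le> q} (\<lambda>k t. \<Sum>d<k. (s gchoose d) * (t - 1) ^ d)
          (\<lambda>t. \<Sum>d. (s gchoose d) * (t - 1) ^ d) sequentially"
    by (rule Weierstrass_m_test[OF _ summable_gbinomial[OF True assms, of s]])
       (auto simp: abs_mult power_abs intro!: mult_left_mono power_mono)
  moreover have "(\<Sum>d. (s gchoose d) * (t - 1) ^ d) = t powr s" if "\<bar>t - 1\<bar> \<le> q" for t
    using gen_binomial_real[of "t - 1" s] that assms by (simp add: sums_iff)
  ultimately show ?thesis unfolding poly_binomial_poly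
    by (subst uniform_limit_cong'[where g = "\<lambda>k t. \<Sum>d<k. (s gchoose d) * (t - 1) ^ d"
          and i = "\<lambda>t. \<Sum>d. (s gchoose d) * (t - 1) ^ d"]) auto
next
  case False
  hence "{t. \<bar>t - 1\<bar> \<le> q} = {}" by auto
  thus ?thesis by (simp add: uniform_limit_iff)
qed

lemma summable_op_binomial:
  assumes "norm U < 1"
  shows "summable (\<lambda>d. (s gchoose d) *\<^sub>R op_pow U d)"
  by (rule summable_comparison_test[OF _ summable_gbinomial[of "norm U" s]])
     (use assms norm_op_pow_le[where T = U] in \<open>auto intro!: mult_left_mono\<close>)

lemma op_poly_binomial_tendsto:
  assumes "norm (A - id_blinfun) < 1"
  shows "(\<lambda>k. op_poly (binomial_poly s k) A) \<longlonglongrightarrow> op_binomial s (A - id_blinfun)"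
  unfolding op_poly_binomial_poly op_binomial_def by (rule summable_LIMSEQ[OF summable_op_binomial[OF assms]])

context
  fixes A :: "'h::complex_hilbert \<Rightarrow>\<^sub>L 'h"
  assumes A: "self_adjoint A" and near: "norm (A - id_blinfun) < 1"
begin

lemma spectrum_near_1: "complex_of_real t \<in> op_spectrum A \<Longrightarrow> t \<in> {t. \<bar>t - 1\<bar> \<le> norm (A - id_blinfun)}"
  using spectrum_near[OF A, of t 1] by simp

lemma op_cfc_near:
  assumes "uniform_limit {t. \<bar>t - 1\<bar> \<le> norm (A - id_blinfun)} (\<lambda>k t. poly (P k) t) f sequentially"
    and "(\<lambda>k. op_poly (P k) A) \<longlonglongrightarrow> R"
  shows "op_cfc f A = R"
  by (rule op_cfc_eqI'[OF A _ assms]) (rule spectrum_near_1)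

lemma op_cfc_powr: "op_cfc (\<lambda>t. t powr s) A = op_binomial s (A - id_blinfun)"
  by (rule op_cfc_near[OF uniform_limit_binomial_poly[OF near] op_poly_binomial_tendsto[OF near]])

lemma self_adjoint_op_binomial: "self_adjoint (op_binomial s (A - id_blinfun))"
  by (rule self_adjoint_lim[OF self_adjoint_op_poly[OF A] op_poly_binomial_tendsto[OF near]])

text \<open>Both sides are \<open>t powr s\<close> of \<open>A\<close>; the left one is computed with the squares of the
  approximants for \<open>t powr (s / 2)\<close>.\<close>

lemma op_binomial_half_square:
  "op_binomial (s/2) (A - id_blinfun) o\<^sub>L op_binomial (s/2) (A - id_blinfun) = op_binomial s (A - id_blinfun)"
proof -
  let ?q = "norm (A - id_blinfun)"
  let ?S = "{t::real. \<bar>t - 1\<bar> \<le> ?q}"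
  let ?b = "\<lambda>k. binomial_poly (s/2) k"
  have "?S \<subseteq> {1 - ?q..1 + ?q}" by auto
  moreover have "compact ((\<lambda>t. t powr (s/2)) ` {1 - ?q..1 + ?q})"
    using near by (intro compact_continuous_image continuous_intros) auto
  ultimately have bd: "bounded ((\<lambda>t. t powr (s/2)) ` ?S)"
    by (meson bounded_subset compact_imp_bounded image_mono)
  have "uniform_limit ?S (\<lambda>k t. poly (?b k) t * poly (?b k) t) (\<lambda>t. t powr (s/2) * t powr (s/2)) sequentially"
    by (intro uniform_lim_mult uniform_limit_binomial_poly near bd)
  hence "uniform_limit ?S (\<lambda>k t. poly (?b k * ?b k) t) (\<lambda>t. t powr s) sequentially"
    by (simp flip: powr_add)
  moreover have "(\<lambda>k. op_poly (?b k * ?b k) A) \<longlonglongrightarrow>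
      (op_binomial (s/2) (A - id_blinfun) o\<^sub>L op_binomial (s/2) (A - id_blinfun))"
    unfolding op_poly_mult by (intro op_compose.tendsto op_poly_binomial_tendsto near)
  ultimately have "op_cfc (\<lambda>t. t powr s) A =
      op_binomial (s/2) (A - id_blinfun) o\<^sub>L op_binomial (s/2) (A - id_blinfun)"
    by (rule op_cfc_near)
  thus ?thesis by (simp add: op_cfc_powr)
qed

text \<open>The operator is the square of a self-adjoint one.\<close>

lemma op_positive_op_binomial: "op_positive (op_binomial s (A - id_blinfun))"
proof -
  let ?W = "op_binomial (s/2) (A - id_blinfun)"
  have "cinner \<xi> (op_binomial s (A - id_blinfun) \<xi>) = cinner (?W \<xi>) (?W \<xi>)" for \<xi>
    by (subst op_binomial_half_square[symmetric]) (simp add: self_adjoint_cinner[OF self_adjoint_op_binomial])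
  thus ?thesis unfolding op_positive_def by (simp add: cinner_self)
qed

lemma op_binomial_1: "op_binomial 1 (A - id_blinfun) = A"
proof -
  have "uniform_limit {t::real. \<bar>t - 1\<bar> \<le> norm (A - id_blinfun)} (\<lambda>(k::nat) t. poly [:0,1:] t) (\<lambda>t. t powr 1) sequentially"
    using near by (subst uniform_limit_cong'[where i = "\<lambda>t. t" and g = "\<lambda>k t. t"])
       (auto simp: uniform_limit_const)
  hence "op_cfc (\<lambda>t. t powr 1) A = A"
    by (rule op_cfc_near) (simp add: op_poly_linear)
  thus ?thesis by (simp only: op_cfc_powr)
qed

lemma op_cfc_sqrt: "op_cfc sqrt A = op_binomial (1/2) (A - id_blinfun)"
proof -
  let ?S = "{t. complex_of_real t \<in> op_spectrum A}"
  have "uniform_limit ?S (\<lambda>k t. poly (binomial_poly (1/2) k) t) (\<lambda>t. t powr (1/2)) sequentially"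
    by (rule uniform_limit_on_subset[OF uniform_limit_binomial_poly[OF near]]) (use spectrum_near_1 in auto)
  moreover have "t powr (1/2) = sqrt t" if "t \<in> ?S" for t
    using spectrum_near_1[of t] near that by (intro powr_half_sqrt) auto
  ultimately have "uniform_limit ?S (\<lambda>k t. poly (binomial_poly (1/2) k) t) sqrt sequentially"
    by (subst uniform_limit_cong'[where i = "\<lambda>t. t powr (1/2)" and g = "\<lambda>k t. poly (binomial_poly (1/2) k) t"]) auto
  thus ?thesis by (rule op_cfc_eqI[OF A _ op_poly_binomial_tendsto[OF near]])
qed

text \<open>This is \<open>\<bar>S\<bar>\<^sup>p = (S\<^sup>* S) powr (p / 2)\<close> for \<open>A = S\<^sup>* S\<close>. With \<open>B = \<surd>A\<close>, a spectral value \<open>t\<close> of \<open>B\<close> is positive and \<open>t\<^sup>2\<close> lies in the spectrum of \<open>A\<close>,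
  so substituting \<open>t\<^sup>2\<close> into approximants of \<open>t powr (p / 2)\<close> yields approximants of \<open>t powr p\<close>.\<close>

lemma op_cfc_powr_sqrt: "op_cfc (\<lambda>t. t powr p) (op_cfc sqrt A) = op_binomial (p/2) (A - id_blinfun)"
proof -
  define B where "B = op_binomial (1/2) (A - id_blinfun)"
  have B: "self_adjoint B" unfolding B_def by (rule self_adjoint_op_binomial)
  have BB: "B o\<^sub>L B = A" using op_binomial_half_square[of 1] by (simp add: B_def op_binomial_1)
  have pos: "op_positive B" unfolding B_def by (rule op_positive_op_binomial)
  let ?S = "{t. complex_of_real t \<in> op_spectrum B}"
  let ?q = "norm (A - id_blinfun)"
  have sq: "\<bar>t\<^sup>2 - 1\<bar> \<le> ?q" if t: "complex_of_real t \<in> op_spectrum B" for t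
  proof -
    have "\<not> op_invertible ((t\<^sup>2) *\<^sub>R id_blinfun - A)"
    proof
      assume "op_invertible ((t\<^sup>2) *\<^sub>R id_blinfun - A)"
      also have "(t\<^sup>2) *\<^sub>R id_blinfun - A = (t *\<^sub>R id_blinfun - B) o\<^sub>L (t *\<^sub>R id_blinfun + B)"
        by (simp add: compose_simps BB power2_eq_square algebra_simps)
      finally have "op_invertible (t *\<^sub>R id_blinfun - B)"
        by (rule op_invertible_factor[rotated 3])
           (auto simp: compose_simps algebra_simps self_adjoint_clin[OF B] clin_scaleR clin_diff clin_add)
      thus False using t by (simp add: op_spectrum_of_real_iff)
    qed
    hence "complex_of_real (t\<^sup>2) \<in> op_spectrum A" by (subst op_spectrum_of_real_iff)
    thus ?thesis using spectrum_near_1 by blast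
  qed
  have tpos: "t > 0" if t: "complex_of_real t \<in> op_spectrum B" for t
  proof (rule ccontr)
    assume "\<not> t > 0"
    moreover have "t \<noteq> 0" using sq[OF t] near by auto
    ultimately have t0: "- t > 0" by simp
    have "op_invertible (B - t *\<^sub>R id_blinfun)"
    proof (rule coercive_invertible[OF _ t0])
      show "B - t *\<^sub>R id_blinfun \<in> bounded_clinear_ops"
        by (intro clin_diff clin_scaleR clin_id self_adjoint_clin B)
      fix \<xi>
      have "Re (cinner \<xi> (B \<xi>)) \<ge> 0" using pos by (simp add: op_positive_def)
      thus "- t * (norm \<xi>)\<^sup>2 \<le> Re (cinner \<xi> ((B - t *\<^sub>R id_blinfun) \<xi>))"
        by (simp add: blinfun.bilinear_simps cinner_simps norm_sq_cinner)
    qed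
    hence "op_invertible ((-1) *\<^sub>R (B - t *\<^sub>R id_blinfun))" by (rule op_invertible_scaleR) simp
    thus False using t by (simp add: op_spectrum_of_real_iff)
  qed
  let ?P = "\<lambda>k. pcompose (binomial_poly (p/2) k) [:0, 0, 1:]"
  have "uniform_limit ?S (\<lambda>k t. poly (binomial_poly (p/2) k) (t\<^sup>2)) (\<lambda>t. (t\<^sup>2) powr (p/2)) sequentially"
    using uniform_limit_binomial_poly[OF near, of "p/2"] sq unfolding uniform_limit_iff
    by (auto elim!: eventually_mono)
  hence "uniform_limit ?S (\<lambda>k t. poly (?P k) t) (\<lambda>t. (t\<^sup>2) powr (p/2)) sequentially"
    by (simp add: poly_pcompose power2_eq_square)
  moreover have "(t\<^sup>2) powr (p/2) = t powr p" if "t \<in> ?S" for t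
    using tpos[of t] that powr_powr[of t 2 "p/2"] by (simp add: powr_numeral)
  ultimately have "uniform_limit ?S (\<lambda>k t. poly (?P k) t) (\<lambda>t. t powr p) sequentially"
    by (subst uniform_limit_cong'[where i = "\<lambda>t. (t\<^sup>2) powr (p/2)" and g = "\<lambda>k t. poly (?P k) t"]) auto
  moreover have "op_poly [:0, 0, 1:] B = A" by (simp add: op_poly_pCons BB)
  hence "(\<lambda>k. op_poly (?P k) B) \<longlonglongrightarrow> op_binomial (p/2) (A - id_blinfun)"
    by (simp add: op_poly_pcompose op_poly_binomial_tendsto near)
  ultimately have "op_cfc (\<lambda>t. t powr p) B = op_binomial (p/2) (A - id_blinfun)"
    by (rule op_cfc_eqI[OF B])
  thus ?thesis by (simp add: op_cfc_sqrt B_def)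
qed

end

lemma self_adjoint_adj_compose:
  assumes "S \<in> bounded_clinear_ops"
  shows "self_adjoint (op_adj S o\<^sub>L S)"
  using assms by (auto simp: self_adjoint_def clin_compose clin_adj cinner_op_adj cinner_op_adj_right)

lemma op_abs_powr_eq:
  assumes "S \<in> bounded_clinear_ops" "norm ((op_adj S o\<^sub>L S) - id_blinfun) < 1"
  shows "op_abs_powr S p = op_binomial (p/2) ((op_adj S o\<^sub>L S) - id_blinfun)"
  unfolding op_abs_powr_def op_abs_def
  by (rule op_cfc_powr_sqrt[OF self_adjoint_adj_compose[OF assms(1)] assms(2)])

section \<open>Von Neumann algebras with a finite trace\<close>

locale tracial_vn_algebra =
  fixes M :: "('h::complex_hilbert \<Rightarrow>\<^sub>L 'h) set" and \<tau> :: "('h \<Rightarrow>\<^sub>L 'h) \<Rightarrow> complex"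
  assumes vn: "von_neumann_algebra M" and trace: "normal_faithful_normalized_trace M \<tau>"
begin

lemma M_clin: "x \<in> M \<Longrightarrow> x \<in> bounded_clinear_ops"
  using vn by (auto simp: von_neumann_algebra_def)

lemma M_adj: "x \<in> M \<Longrightarrow> op_adj x \<in> M"
  using vn by (auto simp: von_neumann_algebra_def)

text \<open>The bicommutant condition supplies all closure properties of \<open>M\<close>, including norm limits.\<close>

lemma M_iff: "x \<in> M \<longleftrightarrow> x \<in> bounded_clinear_ops \<and> (\<forall>S\<in>commutant M. x o\<^sub>L S = S o\<^sub>L x)"
  using vn unfolding von_neumann_algebra_def commutant_def by blast

lemma M_commutes: "x \<in> M \<Longrightarrow> S \<in> commutant M \<Longrightarrow> x o\<^sub>L S = S o\<^sub>L x"
  using M_iff by blast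

lemma commutant_clin: "S \<in> commutant M \<Longrightarrow> S \<in> bounded_clinear_ops"
  by (simp add: commutant_def)

lemma M_id: "id_blinfun \<in> M"
  by (subst M_iff) auto

lemma M_add: "x \<in> M \<Longrightarrow> y \<in> M \<Longrightarrow> x + y \<in> M"
  by (subst M_iff) (auto simp: M_clin clin_add compose_simps M_commutes)

lemma M_scaleC: "x \<in> M \<Longrightarrow> op_scaleC c x \<in> M"
proof (subst M_iff, intro conjI ballI)
  assume x: "x \<in> M"
  show "op_scaleC c x \<in> bounded_clinear_ops" by (intro clin_scaleC M_clin x)
  fix S assume S: "S \<in> commutant M"
  have "x o\<^sub>L S = S o\<^sub>L x" using x S M_iff by blast
  hence "x (S \<xi>) = S (x \<xi>)" for \<xi> by (metis blinfun_apply_blinfun_compose)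
  thus "op_scaleC c x o\<^sub>L S = S o\<^sub>L op_scaleC c x"
    by (intro blinfun_eqI) (simp add: clin_apply[OF commutant_clin[OF S]])
qed

lemma M_scaleR: "x \<in> M \<Longrightarrow> r *\<^sub>R x \<in> M"
  using M_scaleC[of x "of_real r"] by (simp add: op_scaleC_of_real)

lemma M_diff: "x \<in> M \<Longrightarrow> y \<in> M \<Longrightarrow> x - y \<in> M"
  using M_add[of x "(-1) *\<^sub>R y"] M_scaleR[of y "-1"] by simp

lemma M_zero: "0 \<in> M"
  using M_scaleR[OF M_id, of 0] by simp

lemma M_compose: "x \<in> M \<Longrightarrow> y \<in> M \<Longrightarrow> x o\<^sub>L y \<in> M"
proof (subst M_iff, intro conjI ballI)
  assume xy: "x \<in> M" "y \<in> M"
  show "x o\<^sub>L y \<in> bounded_clinear_ops" by (intro clin_compose M_clin xy)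
  fix S assume "S \<in> commutant M"
  hence "x o\<^sub>L S = S o\<^sub>L x" "y o\<^sub>L S = S o\<^sub>L y" using xy M_iff by blast+
  thus "x o\<^sub>L y o\<^sub>L S = S o\<^sub>L (x o\<^sub>L y)" by (metis compose_assoc)
qed

lemma M_lim:
  assumes "\<And>k. x k \<in> M" "(x :: nat \<Rightarrow> _) \<longlonglongrightarrow> R"
  shows "R \<in> M"
proof (subst M_iff, intro conjI ballI)
  show "R \<in> bounded_clinear_ops" by (rule clin_lim[OF M_clin[OF assms(1)] assms(2)])
  fix S assume S: "S \<in> commutant M"
  have "x k o\<^sub>L S = S o\<^sub>L x k" for k using S assms(1) M_iff by blast
  hence "(\<lambda>k. x k o\<^sub>L S) \<longlonglongrightarrow> (S o\<^sub>L R)"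
    using op_compose.tendsto[OF tendsto_const assms(2), of S] by simp
  thus "R o\<^sub>L S = S o\<^sub>L R"
    using LIMSEQ_unique op_compose.tendsto[OF assms(2) tendsto_const, of S] by blast
qed

lemma tau_add: "x \<in> M \<Longrightarrow> y \<in> M \<Longrightarrow> \<tau> (x + y) = \<tau> x + \<tau> y"
  and tau_scaleC: "x \<in> M \<Longrightarrow> \<tau> (op_scaleC c x) = c * \<tau> x"
  and tau_positive: "x \<in> M \<Longrightarrow> op_positive x \<Longrightarrow> Im (\<tau> x) = 0 \<and> Re (\<tau> x) \<ge> 0"
  and tau_commute: "x \<in> M \<Longrightarrow> y \<in> M \<Longrightarrow> \<tau> (x o\<^sub>L y) = \<tau> (y o\<^sub>L x)"
  and tau_id: "\<tau> id_blinfun = 1"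
  using trace by (simp_all add: normal_faithful_normalized_trace_def)

lemma tau_scaleR: "x \<in> M \<Longrightarrow> \<tau> (r *\<^sub>R x) = of_real r * \<tau> x"
  using tau_scaleC[of x "of_real r"] by (simp add: op_scaleC_of_real)

lemma tau_diff: "x \<in> M \<Longrightarrow> y \<in> M \<Longrightarrow> \<tau> (x - y) = \<tau> x - \<tau> y"
  using tau_add[of x "(-1) *\<^sub>R y"] M_scaleR[of y "-1"] tau_scaleR[of y "-1"] by simp

lemma tau_zero: "\<tau> 0 = 0"
  using tau_scaleR[OF M_id, of 0] by simp

text \<open>Both \<open>\<parallel>x\<parallel> + x\<close> and \<open>\<parallel>x\<parallel> - x\<close> are positive.\<close>

lemma tau_self_adjoint:
  assumes x: "x \<in> M" "self_adjoint x"
  shows "cmod (\<tau> x) \<le> norm x"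
proof -
  have bound: "\<bar>Re (cinner \<xi> (x \<xi>))\<bar> \<le> norm x * Re (cinner \<xi> \<xi>)" for \<xi>
  proof -
    have "\<bar>Re (cinner \<xi> (x \<xi>))\<bar> \<le> norm \<xi> * norm (x \<xi>)"
      using abs_Re_le_cmod cinner_Cauchy_Schwarz order_trans by blast
    also have "\<dots> \<le> norm \<xi> * (norm x * norm \<xi>)" by (intro mult_left_mono norm_blinfun) simp
    finally show ?thesis by (simp add: power2_eq_square mult_ac flip: norm_sq_cinner)
  qed
  have real: "Im (cinner \<xi> (x \<xi>)) = 0" for \<xi>
    using cinner_commute[of \<xi> "x \<xi>"] self_adjoint_cinner[OF x(2), of \<xi> \<xi>]
    by (metis cnj.simps(2) neg_equal_zero)
  have "op_positive (norm x *\<^sub>R id_blinfun + s *\<^sub>R x)" if "s = 1 \<or> s = -1" for s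
    unfolding op_positive_def
  proof (intro allI conjI)
    fix \<xi>
    show "Im (cinner \<xi> ((norm x *\<^sub>R id_blinfun + s *\<^sub>R x) \<xi>)) = 0"
      using that by (auto simp: blinfun.bilinear_simps cinner_simps real cinner_self)
    show "0 \<le> Re (cinner \<xi> ((norm x *\<^sub>R id_blinfun + s *\<^sub>R x) \<xi>))"
      using that bound[of \<xi>] by (auto simp: blinfun.bilinear_simps cinner_simps)
  qed
  hence "Im (\<tau> (norm x *\<^sub>R id_blinfun + s *\<^sub>R x)) = 0 \<and> Re (\<tau> (norm x *\<^sub>R id_blinfun + s *\<^sub>R x)) \<ge> 0"
    if "s = 1 \<or> s = -1" for s
    using that by (intro tau_positive M_add M_scaleR M_id x) auto
  from this[of 1] this[of "-1"] show ?thesis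
    using x by (simp add: tau_add M_scaleR M_id tau_scaleR tau_id tau_diff cmod_def abs_le_iff)
qed

text \<open>Decompose \<open>x = h + \<i> k\<close> with \<open>h\<close> and \<open>k\<close> self-adjoint; this is where adjoints of elements of \<open>M\<close>
  are needed.\<close>

lemma tau_bound:
  assumes x: "x \<in> M"
  shows "cmod (\<tau> x) \<le> 2 * norm x"
proof -
  define h where "h = (1/2) *\<^sub>R (x + op_adj x)"
  define k where "k = op_scaleC (- \<i> / 2) (x - op_adj x)"
  note [simp] = cinner_op_adj[OF M_clin[OF x]] cinner_op_adj_right[OF M_clin[OF x]]
  have h: "h \<in> M" unfolding h_def by (intro M_scaleR M_add M_adj x)
  have "self_adjoint h" unfolding self_adjoint_def
    by (intro conjI allI M_clin h) (simp add: h_def blinfun.bilinear_simps cinner_simps)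
  moreover have "norm h \<le> norm x"
    using norm_triangle_ineq[of x "op_adj x"] norm_op_adj_le[OF M_clin[OF x]] by (simp add: h_def)
  ultimately have 1: "cmod (\<tau> h) \<le> norm x" using tau_self_adjoint[OF h] by simp
  have k: "k \<in> M" unfolding k_def by (intro M_scaleC M_diff M_adj x)
  have "self_adjoint k" unfolding self_adjoint_def
    by (intro conjI allI M_clin k) (simp add: k_def blinfun.bilinear_simps cinner_simps algebra_simps)
  moreover have "norm k \<le> norm x"
    using norm_op_scaleC_le[of "- \<i> / 2" "x - op_adj x"] norm_triangle_ineq4[of x "op_adj x"]
      norm_op_adj_le[OF M_clin[OF x]] by (simp add: k_def norm_divide)
  ultimately have 2: "cmod (\<tau> k) \<le> norm x" using tau_self_adjoint[OF k] by simp
  have th: "\<tau> h = (\<tau> x + \<tau> (op_adj x)) / 2"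
    unfolding h_def by (subst tau_scaleR) (simp_all add: tau_add M_add M_adj x)
  have "\<tau> k = - \<i> / 2 * (\<tau> x - \<tau> (op_adj x))"
    unfolding k_def by (subst tau_scaleC) (simp_all add: tau_diff M_diff M_adj x)
  moreover have "\<i> * (- \<i> / 2 * z) = z / 2" for z :: complex by (simp add: complex_eq_iff)
  ultimately have tk: "\<i> * \<tau> k = (\<tau> x - \<tau> (op_adj x)) / 2" by (simp only:)
  have "\<tau> x = \<tau> h + \<i> * \<tau> k" unfolding th tk by (simp add: field_simps)
  thus ?thesis using norm_triangle_ineq[of "\<tau> h" "\<i> * \<tau> k"] 1 2 by (simp add: norm_mult)
qed

lemma tau_lim:
  assumes "\<And>k. x k \<in> M" "(x :: nat \<Rightarrow> _) \<longlonglongrightarrow> R"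
  shows "(\<lambda>k. \<tau> (x k)) \<longlonglongrightarrow> \<tau> R"
proof -
  have R: "R \<in> M" by (rule M_lim[OF assms])
  have "(\<lambda>k. \<tau> (x k) - \<tau> R) \<longlonglongrightarrow> 0"
  proof (rule Lim_null_comparison)
    show "\<forall>\<^sub>F k in sequentially. norm (\<tau> (x k) - \<tau> R) \<le> 2 * norm (x k - R)"
      using tau_bound[OF M_diff[OF assms(1) R]] by (auto simp: tau_diff assms(1) R)
    show "(\<lambda>k. 2 * norm (x k - R)) \<longlonglongrightarrow> 0"
      using tendsto_mult_right_zero[OF tendsto_norm_zero[OF LIM_zero[OF assms(2)]]] .
  qed
  thus ?thesis by (rule LIM_zero_cancel)
qed

end

section \<open>Matrices over the algebra\<close>

lemma norm_vec_le_sum: "norm (x :: 'a::real_normed_vector ^ 'm) \<le> (\<Sum>i\<in>UNIV. norm (x $ i))"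
  unfolding norm_vec_def by (rule L2_set_le_sum) simp

lemma mat_tensor_apply:
  "blinfun_apply (mat_tensor a x) \<xi> = (\<chi> i. \<Sum>k\<in>UNIV. scaleC (a $ i $ k) (x (\<xi> $ k)))"
proof -
  have "bounded_linear (\<lambda>\<xi>. \<chi> i. \<Sum>k\<in>UNIV. scaleC (a $ i $ k) (x (\<xi> $ k)))"
  proof (rule bounded_linear_intro[where K = "\<Sum>i\<in>UNIV. \<Sum>k\<in>UNIV. cmod (a $ i $ k) * norm x"])
    fix \<xi>
    have "norm (\<chi> i. \<Sum>k\<in>UNIV. scaleC (a $ i $ k) (x (\<xi> $ k))) \<le>
        (\<Sum>i\<in>UNIV. norm (\<Sum>k\<in>UNIV. scaleC (a $ i $ k) (x (\<xi> $ k))))"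
      by (rule order_trans[OF norm_vec_le_sum]) simp
    also have "\<dots> \<le> (\<Sum>i\<in>UNIV. \<Sum>k\<in>UNIV. norm \<xi> * (cmod (a $ i $ k) * norm x))"
    proof (intro sum_mono order_trans[OF norm_sum] sum_mono)
      fix i k
      have "norm (x (\<xi> $ k)) \<le> norm x * norm \<xi>"
        by (rule order_trans[OF norm_blinfun]) (intro mult_left_mono Finite_Cartesian_Product.norm_nth_le, simp)
      hence "cmod (a $ i $ k) * norm (x (\<xi> $ k)) \<le> cmod (a $ i $ k) * (norm x * norm \<xi>)"
        by (intro mult_left_mono) auto
      thus "norm (scaleC (a $ i $ k) (x (\<xi> $ k))) \<le> norm \<xi> * (cmod (a $ i $ k) * norm x)"
        by (simp add: norm_scaleC mult_ac)
    qed
    finally show "norm (\<chi> i. \<Sum>k\<in>UNIV. scaleC (a $ i $ k) (x (\<xi> $ k))) \<le>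
        norm \<xi> * (\<Sum>i\<in>UNIV. \<Sum>k\<in>UNIV. cmod (a $ i $ k) * norm x)"
      by (simp add: sum_distrib_left)
  qed (simp_all add: vec_eq_iff blinfun.bilinear_simps scaleC_add_right sum.distrib scaleC_scaleR scaleR_sum_right)
  thus ?thesis by (simp add: mat_tensor_def bounded_linear_Blinfun_apply)
qed

lemma clin_mat_tensor: "x \<in> bounded_clinear_ops \<Longrightarrow> mat_tensor a x \<in> bounded_clinear_ops"
  by (rule clinI) (simp add: mat_tensor_apply vec_eq_iff scaleC_vec_def clin_apply scaleC_sum_right
      scaleC_scaleC mult.commute)

lemma mat_tensor_compose:
  assumes "x \<in> bounded_clinear_ops"
  shows "mat_tensor a x o\<^sub>L mat_tensor b y = mat_tensor (a ** b) (x o\<^sub>L y)"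
proof (rule blinfun_eqI)
  fix \<xi>
  have "(mat_tensor a x o\<^sub>L mat_tensor b y) \<xi> $ i = mat_tensor (a ** b) (x o\<^sub>L y) \<xi> $ i" for i
  proof -
    have "(mat_tensor a x o\<^sub>L mat_tensor b y) \<xi> $ i =
        (\<Sum>k\<in>UNIV. \<Sum>l\<in>UNIV. scaleC (a $ i $ k * b $ k $ l) (x (y (\<xi> $ l))))"
      by (simp add: mat_tensor_apply blinfun.sum_right clin_apply[OF assms] scaleC_sum_right scaleC_scaleC)
    also have "\<dots> = (\<Sum>l\<in>UNIV. \<Sum>k\<in>UNIV. scaleC (a $ i $ k * b $ k $ l) (x (y (\<xi> $ l))))"
      by (rule sum.swap)
    finally show ?thesis
      by (simp add: mat_tensor_apply matrix_matrix_mult_def scaleC_sum_left)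
  qed
  thus "(mat_tensor a x o\<^sub>L mat_tensor b y) \<xi> = mat_tensor (a ** b) (x o\<^sub>L y) \<xi>"
    by (simp add: vec_eq_iff)
qed

lemma mat_tensor_id: "mat_tensor (mat 1) id_blinfun = id_blinfun"
  by (rule blinfun_eqI) (simp add: mat_tensor_apply vec_eq_iff mat_def if_distrib[of "\<lambda>c. scaleC c _"] cong: if_cong)

lemma mat_tensor_adj:
  assumes "x \<in> bounded_clinear_ops"
  shows "op_adj (mat_tensor a x) = mat_tensor (mat_adj a) (op_adj x)"
proof (rule op_adj_eqI)
  fix \<xi> \<eta> :: "'a ^ 'b"
  have "cinner (mat_tensor (mat_adj a) (op_adj x) \<xi>) \<eta> =
      (\<Sum>i\<in>UNIV. \<Sum>k\<in>UNIV. a $ k $ i * cinner (\<xi> $ k) (x (\<eta> $ i)))"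
    by (simp add: cinner_vec_def mat_tensor_apply mat_adj_def cinner_sum_left cinner_simps cinner_op_adj[OF assms])
  also have "\<dots> = (\<Sum>k\<in>UNIV. \<Sum>i\<in>UNIV. a $ k $ i * cinner (\<xi> $ k) (x (\<eta> $ i)))"
    by (rule sum.swap)
  also have "\<dots> = cinner \<xi> (mat_tensor a x \<eta>)"
    by (simp add: cinner_vec_def mat_tensor_apply cinner_sum_right cinner_simps)
  finally show "cinner (mat_tensor (mat_adj a) (op_adj x) \<xi>) \<eta> = cinner \<xi> (mat_tensor a x \<eta>)" .
qed

lemma mat_adj_adj: "mat_adj (mat_adj a) = a"
  by (simp add: mat_adj_def vec_eq_iff)

lemma norm_axis: "norm (axis k \<xi> :: 'a::real_normed_vector ^ 'm) = norm \<xi>"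
proof -
  have "(\<Sum>i\<in>UNIV. (norm ((axis k \<xi> :: 'a ^ 'm) $ i))\<^sup>2) = (\<Sum>i\<in>UNIV. if i = k then (norm \<xi>)\<^sup>2 else 0)"
    by (rule sum.cong) (auto simp: axis_def)
  thus ?thesis by (simp add: norm_vec_def L2_set_def)
qed

lemma op_entry_apply: "blinfun_apply (op_entry R i k) \<xi> = R (axis k \<xi>) $ i"
  and norm_op_entry_le: "norm (op_entry R i k) \<le> norm R"
proof -
  have le: "norm (R (axis k \<xi>) $ i) \<le> norm R * norm \<xi>" for \<xi>
    using order_trans[OF Finite_Cartesian_Product.norm_nth_le norm_blinfun[of R "axis k \<xi>"]] by (simp add: norm_axis)
  have "bounded_linear (\<lambda>\<xi>. R (axis k \<xi>) $ i)"
  proof (rule bounded_linear_intro[where K = "norm R"])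
    fix x y :: 'a and r :: real
    have "axis k (x + y) = axis k x + (axis k y :: 'a ^ 'b)" by (simp add: axis_def vec_eq_iff)
    thus "R (axis k (x + y)) $ i = R (axis k x) $ i + R (axis k y) $ i" by (simp add: blinfun.bilinear_simps)
    have "axis k (r *\<^sub>R x) = r *\<^sub>R (axis k x :: 'a ^ 'b)" by (simp add: axis_def vec_eq_iff)
    thus "R (axis k (r *\<^sub>R x)) $ i = r *\<^sub>R (R (axis k x) $ i)" by (simp add: blinfun.bilinear_simps)
    show "norm (R (axis k x) $ i) \<le> norm x * norm R" using le[of x] by (simp add: mult.commute)
  qed
  thus *: "blinfun_apply (op_entry R i k) \<xi> = R (axis k \<xi>) $ i" for \<xi>
    by (simp add: op_entry_def bounded_linear_Blinfun_apply)
  show "norm (op_entry R i k) \<le> norm R"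
    by (rule norm_blinfun_bound) (auto simp: * le)
qed

lemma op_entry_add: "op_entry (R + R') i k = op_entry R i k + op_entry R' i k"
  by (rule blinfun_eqI) (simp add: op_entry_apply blinfun.bilinear_simps)

lemma op_entry_zero [simp]: "op_entry 0 i k = 0"
  by (rule blinfun_eqI) (simp add: op_entry_apply)

lemma op_entry_diff: "op_entry (R - R') i k = op_entry R i k - op_entry R' i k"
  by (rule blinfun_eqI) (simp add: op_entry_apply blinfun.bilinear_simps)

lemma op_entry_scaleC: "op_entry (op_scaleC c R) i k = op_scaleC c (op_entry R i k)"
  by (rule blinfun_eqI) (simp add: op_entry_apply scaleC_vec_def)

lemma op_entry_mat_tensor: "op_entry (mat_tensor a x) i k = op_scaleC (a $ i $ k) x"
proof (rule blinfun_eqI)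
  fix \<xi>
  have "scaleC (a $ i $ l) (x (axis k \<xi> $ l)) = (if l = k then scaleC (a $ i $ k) (x \<xi>) else 0)" for l
    by (auto simp: axis_def)
  thus "op_entry (mat_tensor a x) i k \<xi> = op_scaleC (a $ i $ k) x \<xi>"
    by (simp add: op_entry_apply mat_tensor_apply)
qed

lemma op_entry_tendsto: "(R \<longlongrightarrow> R') F \<Longrightarrow> ((\<lambda>n. op_entry (R n) i k) \<longlongrightarrow> op_entry R' i k) F"
proof -
  assume R: "(R \<longlongrightarrow> R') F"
  have "((\<lambda>n. op_entry (R n) i k - op_entry R' i k) \<longlongrightarrow> 0) F"
    by (rule Lim_null_comparison[OF _ tendsto_norm_zero[OF LIM_zero[OF R]]])
       (simp add: norm_op_entry_le flip: op_entry_diff)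
  thus ?thesis by (rule LIM_zero_cancel)
qed

lemma op_positive_entry: "op_positive R \<Longrightarrow> op_positive (op_entry R i i)"
proof -
  assume "op_positive R"
  moreover have "cinner \<xi> (op_entry R i i \<xi>) = cinner (axis i \<xi>) (R (axis i \<xi>))" for \<xi>
  proof -
    have "cinner (axis i \<xi>) (R (axis i \<xi>)) = (\<Sum>l\<in>UNIV. if l = i then cinner \<xi> (R (axis i \<xi>) $ i) else 0)"
      unfolding cinner_vec_def by (rule sum.cong) (auto simp: axis_def)
    thus ?thesis by (simp add: op_entry_apply)
  qed
  ultimately show ?thesis by (simp add: op_positive_def)
qed

context tracial_vn_algebra
begin

text \<open>The trace \<open>tr \<otimes> \<tau>\<close> sees only the diagonal entries, so its linearity, positivity and continuity
  are inherited from \<open>\<tau>\<close> as soon as these entries belong to \<open>M\<close>.\<close>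

definition diagonal_in :: "(('h ^ 'm::finite) \<Rightarrow>\<^sub>L ('h ^ 'm)) set" where
  "diagonal_in = {R. \<forall>i. op_entry R i i \<in> M}"

lemma diagonal_in_mat_tensor: "x \<in> M \<Longrightarrow> mat_tensor a x \<in> diagonal_in"
  by (simp add: diagonal_in_def op_entry_mat_tensor M_scaleC)

lemma diagonal_in_scaleC: "R \<in> diagonal_in \<Longrightarrow> op_scaleC c R \<in> diagonal_in"
  by (simp add: diagonal_in_def op_entry_scaleC M_scaleC)

lemma diagonal_in_add: "R \<in> diagonal_in \<Longrightarrow> R' \<in> diagonal_in \<Longrightarrow> R + R' \<in> diagonal_in"
  by (simp add: diagonal_in_def op_entry_add M_add)

lemma diagonal_in_zero: "0 \<in> diagonal_in"
  by (simp add: diagonal_in_def M_zero)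

lemma diagonal_in_sum: "(\<And>i. i \<in> I \<Longrightarrow> f i \<in> diagonal_in) \<Longrightarrow> (\<Sum>i\<in>I. f i) \<in> diagonal_in"
  by (induction I rule: infinite_finite_induct) (auto intro: diagonal_in_add diagonal_in_zero)

lemma tr_tensor_mat_tensor: "x \<in> M \<Longrightarrow> tr_tensor \<tau> (mat_tensor a x) = tr_normalized a * \<tau> x"
  by (simp add: tr_tensor_def tr_normalized_def op_entry_mat_tensor tau_scaleC trace_def sum_distrib_right)

lemma tr_tensor_add:
  "R \<in> diagonal_in \<Longrightarrow> R' \<in> diagonal_in \<Longrightarrow> tr_tensor \<tau> (R + R') = tr_tensor \<tau> R + tr_tensor \<tau> R'"
  by (simp add: tr_tensor_def op_entry_add diagonal_in_def tau_add sum.distrib add_divide_distrib)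

lemma tr_tensor_scaleC: "R \<in> diagonal_in \<Longrightarrow> tr_tensor \<tau> (op_scaleC c R) = c * tr_tensor \<tau> R"
  by (simp add: tr_tensor_def op_entry_scaleC diagonal_in_def tau_scaleC sum_distrib_left)

lemma tr_tensor_zero: "tr_tensor \<tau> 0 = 0"
  by (simp add: tr_tensor_def tau_zero)

lemma tr_tensor_sum:
  "(\<And>i. i \<in> I \<Longrightarrow> f i \<in> diagonal_in) \<Longrightarrow> tr_tensor \<tau> (\<Sum>i\<in>I. f i) = (\<Sum>i\<in>I. tr_tensor \<tau> (f i))"
  by (induction I rule: infinite_finite_induct) (auto simp: tr_tensor_add tr_tensor_zero diagonal_in_sum)

lemma tr_tensor_bound:
  fixes R :: "('h ^ 'm::finite) \<Rightarrow>\<^sub>L ('h ^ 'm)"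
  assumes "R \<in> diagonal_in"
  shows "cmod (tr_tensor \<tau> R) \<le> 2 * norm R"
proof -
  have "cmod (\<Sum>i\<in>UNIV. \<tau> (op_entry R i i)) \<le> (\<Sum>i\<in>(UNIV::'m set). 2 * norm R)"
  proof (intro sum_norm_le)
    fix i
    have "cmod (\<tau> (op_entry R i i)) \<le> 2 * norm (op_entry R i i)"
      using assms by (intro tau_bound) (simp add: diagonal_in_def)
    thus "cmod (\<tau> (op_entry R i i)) \<le> 2 * norm R" using norm_op_entry_le[of R i i] by linarith
  qed
  thus ?thesis by (simp add: tr_tensor_def norm_divide field_simps)
qed

lemma diagonal_in_lim:
  assumes "\<And>k. R k \<in> diagonal_in" "(R :: nat \<Rightarrow> _) \<longlonglongrightarrow> R'"
  shows "R' \<in> diagonal_in"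
  using assms M_lim[OF _ op_entry_tendsto[OF assms(2)]] by (simp add: diagonal_in_def)

lemma tr_tensor_lim:
  assumes "\<And>k. R k \<in> diagonal_in" "(R :: nat \<Rightarrow> _) \<longlonglongrightarrow> R'"
  shows "(\<lambda>k. tr_tensor \<tau> (R k)) \<longlonglongrightarrow> tr_tensor \<tau> R'"
  unfolding tr_tensor_def
  by (intro tendsto_divide tendsto_sum tau_lim op_entry_tendsto assms tendsto_const)
     (use assms(1) in \<open>auto simp: diagonal_in_def\<close>)

lemma tr_tensor_positive:
  assumes "R \<in> diagonal_in" "op_positive R"
  shows "Im (tr_tensor \<tau> R) = 0 \<and> Re (tr_tensor \<tau> R) \<ge> 0"
proof -
  have "Im (\<tau> (op_entry R i i)) = 0 \<and> Re (\<tau> (op_entry R i i)) \<ge> 0" for i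
    using assms by (intro tau_positive op_positive_entry) (auto simp: diagonal_in_def)
  thus ?thesis by (simp add: tr_tensor_def sum_nonneg Re_divide_of_nat Im_divide_of_nat)
qed

end

section \<open>Expansion into words\<close>

definition words_of_length :: "'b set \<Rightarrow> nat \<Rightarrow> 'b list set" where
  "words_of_length A d = {w. set w \<subseteq> A \<and> length w = d}"

lemma finite_words_of_length: "finite A \<Longrightarrow> finite (words_of_length A d)"
  unfolding words_of_length_def by (rule finite_lists_length_eq)

lemma sum_words_of_length_Suc:
  assumes "finite A"
  shows "(\<Sum>w\<in>words_of_length A (Suc d). f w) = (\<Sum>b\<in>A. \<Sum>w\<in>words_of_length A d. f (b # w))"
proof -
  have "words_of_length A (Suc d) = (\<lambda>(b, w). b # w) ` (A \<times> words_of_length A d)"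
    by (auto simp: words_of_length_def length_Suc_conv image_iff)
  moreover have "inj_on (\<lambda>(b, w). b # w) (A \<times> words_of_length A d)" by (auto simp: inj_on_def)
  ultimately have "(\<Sum>w\<in>words_of_length A (Suc d). f w) = (\<Sum>(b, w)\<in>A \<times> words_of_length A d. f (b # w))"
    by (simp add: sum.reindex case_prod_unfold)
  thus ?thesis by (simp add: sum.cartesian_product)
qed

lemma words_of_length_0 [simp]: "words_of_length A 0 = {[]}"
  by (auto simp: words_of_length_def)

lemma sum_words_prod_list:
  fixes g :: "'b \<Rightarrow> 'c::comm_semiring_1"
  assumes "finite A"
  shows "(\<Sum>w\<in>words_of_length A d. prod_list (map g w)) = (\<Sum>b\<in>A. g b) ^ d"
  by (induction d) (simp_all add: sum_words_of_length_Suc[OF assms] flip: sum_distrib_left sum_distrib_right)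

definition op_list_prod :: "('b \<Rightarrow> ('h::complex_hilbert \<Rightarrow>\<^sub>L 'h)) \<Rightarrow> 'b list \<Rightarrow> ('h \<Rightarrow>\<^sub>L 'h)" where
  "op_list_prod f l = foldr (\<lambda>v y. f v o\<^sub>L y) l id_blinfun"

definition mat_list_prod :: "('b \<Rightarrow> complex ^ 'm ^ 'm) \<Rightarrow> 'b list \<Rightarrow> complex ^ 'm ^ 'm::finite" where
  "mat_list_prod f l = foldr (\<lambda>v b. f v ** b) l (mat 1)"

lemma op_list_prod_simps [simp]:
  "op_list_prod f [] = id_blinfun" "op_list_prod f (v # l) = f v o\<^sub>L op_list_prod f l"
  by (simp_all add: op_list_prod_def)

lemma mat_list_prod_simps [simp]:
  "mat_list_prod f [] = mat 1" "mat_list_prod f (v # l) = f v ** mat_list_prod f l"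
  by (simp_all add: mat_list_prod_def)

lemma op_list_prod_append: "op_list_prod f (l @ l') = op_list_prod f l o\<^sub>L op_list_prod f l'"
  by (induction l) (simp_all add: compose_assoc)

lemma op_list_prod_concat: "op_list_prod (op_list_prod f) w = op_list_prod f (concat w)"
  by (induction w) (simp_all add: op_list_prod_append)

lemma prod_list_concat: "prod_list (map (\<lambda>b. prod_list (map g b)) w) = prod_list (map g (concat w))"
  for g :: "'b \<Rightarrow> 'c::comm_monoid_mult"
  by (induction w) simp_all

lemma clin_op_list_prod:
  "(\<And>v. v \<in> set l \<Longrightarrow> f v \<in> bounded_clinear_ops) \<Longrightarrow> op_list_prod f l \<in> bounded_clinear_ops"
  by (induction l) (auto intro: clin_compose)

lemma norm_op_list_prod_le: "norm (op_list_prod f l) \<le> prod_list (map (\<lambda>v. norm (f v)) l)"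
proof (induction l)
  case (Cons v l)
  have "norm (op_list_prod f (v # l)) \<le> norm (f v) * norm (op_list_prod f l)"
    by (simp add: norm_blinfun_compose)
  also have "\<dots> \<le> norm (f v) * prod_list (map (\<lambda>v. norm (f v)) l)"
    by (intro mult_left_mono Cons) simp
  finally show ?case by simp
qed (simp add: norm_blinfun_id_le)

lemma mat_tensor_list_prod:
  assumes "\<And>v. v \<in> set l \<Longrightarrow> X v \<in> bounded_clinear_ops"
  shows "op_list_prod (\<lambda>v. mat_tensor (A v) (X v)) l = mat_tensor (mat_list_prod A l) (op_list_prod X l)"
  using assms by (induction l) (simp_all add: mat_tensor_id mat_tensor_compose)

lemma op_scaleC_compose:
  assumes "S \<in> bounded_clinear_ops"
  shows "op_scaleC c S o\<^sub>L op_scaleC d T = op_scaleC (c * d) (S o\<^sub>L T)"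
  by (rule blinfun_eqI) (simp add: clin_apply[OF assms] scaleC_scaleC)

text \<open>The multinomial formula for non-commuting summands.\<close>

lemma op_pow_sum_words:
  assumes "finite A" and "\<And>b. b \<in> A \<Longrightarrow> B b \<in> bounded_clinear_ops"
  shows "op_pow (\<Sum>b\<in>A. op_scaleC (c b) (B b)) d =
    (\<Sum>w\<in>words_of_length A d. op_scaleC (prod_list (map c w)) (op_list_prod B w))"
proof (induction d)
  case 0
  show ?case by (rule blinfun_eqI) simp
next
  case (Suc d)
  have "op_pow (\<Sum>b\<in>A. op_scaleC (c b) (B b)) (Suc d) =
      (\<Sum>b\<in>A. op_scaleC (c b) (B b)) o\<^sub>L
      (\<Sum>w\<in>words_of_length A d. op_scaleC (prod_list (map c w)) (op_list_prod B w))"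
    by (simp add: Suc)
  also have "\<dots> = (\<Sum>b\<in>A. \<Sum>w\<in>words_of_length A d.
      op_scaleC (c b) (B b) o\<^sub>L op_scaleC (prod_list (map c w)) (op_list_prod B w))"
    by (simp add: op_compose.sum_left
        op_compose.sum_right) (rule sum.swap)
  also have "\<dots> = (\<Sum>b\<in>A. \<Sum>w\<in>words_of_length A d.
      op_scaleC (prod_list (map c (b # w))) (op_list_prod B (b # w)))"
    by (intro sum.cong refl) (simp add: op_scaleC_compose assms)
  finally show ?case by (simp add: sum_words_of_length_Suc[OF assms(1)])
qed

text \<open>A symbol \<open>(j, One)\<close> stands for the summand \<open>Y\<^sub>j = a\<^sub>j\<^sup>\<epsilon> \<otimes> x\<^sub>j\<close> and \<open>(j, Star)\<close> for its adjoint.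
  The blocks are the monomials of \<open>T + T\<^sup>* + T\<^sup>* T\<close> for \<open>T = \<Sum> z\<^sub>j Y\<^sub>j\<close>.\<close>

type_synonym symbol = "nat \<times> exponent"

definition blocks :: "nat \<Rightarrow> symbol list set" where
  "blocks n = (\<lambda>j. [(j, One)]) ` {1..n} \<union> (\<lambda>j. [(j, Star)]) ` {1..n} \<union>
     (\<lambda>(i, j). [(i, Star), (j, One)]) ` ({1..n} \<times> {1..n})"

lemma finite_blocks: "finite (blocks n)" by (simp add: blocks_def)

abbreviation words :: "nat \<Rightarrow> nat \<Rightarrow> symbol list list set" where
  "words n \<equiv> words_of_length (blocks n)"

lemma sum_blocks:
  fixes f :: "symbol list \<Rightarrow> 'c::comm_monoid_add"
  shows "(\<Sum>b\<in>blocks n. f b) = (\<Sum>j=1..n. f [(j, One)]) + (\<Sum>j=1..n. f [(j, Star)])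
    + (\<Sum>i=1..n. \<Sum>j=1..n. f [(i, Star), (j, One)])"
proof -
  have "(\<Sum>b\<in>blocks n. f b) = (\<Sum>b\<in>(\<lambda>j. [(j, One)]) ` {1..n} \<union> (\<lambda>j. [(j, Star)]) ` {1..n}. f b)
     + (\<Sum>b\<in>(\<lambda>(i, j). [(i, Star), (j, One)]) ` ({1..n} \<times> {1..n}). f b)"
    unfolding blocks_def by (rule sum.union_disjoint) auto
  also have "(\<Sum>b\<in>(\<lambda>j. [(j, One)]) ` {1..n} \<union> (\<lambda>j. [(j, Star)]) ` {1..n}. f b) =
     (\<Sum>b\<in>(\<lambda>j. [(j, One)]) ` {1..n}. f b) + (\<Sum>b\<in>(\<lambda>j. [(j, Star)]) ` {1..n}. f b)"
    by (rule sum.union_disjoint) auto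
  finally show ?thesis
    by (simp add: sum.reindex inj_on_def sum.cartesian_product case_prod_unfold)
qed

lemma blocks_index: "b \<in> blocks n \<Longrightarrow> v \<in> set b \<Longrightarrow> fst v \<in> {1..n}"
  by (auto simp: blocks_def)

lemma word_index: "w \<in> words n d \<Longrightarrow> v \<in> set (concat w) \<Longrightarrow> fst v \<in> {1..n}"
  unfolding words_of_length_def set_concat mem_Collect_eq UN_iff by (meson blocks_index subsetD)

lemma length_le_length_concat: "set w \<subseteq> blocks n \<Longrightarrow> length w \<le> length (concat w)"
  by (induction w) (auto simp: blocks_def)

locale twisted_family = tracial_vn_algebra M \<tau>
  for M :: "('h::complex_hilbert \<Rightarrow>\<^sub>L 'h) set" and \<tau> +
  fixes n :: nat and x :: "nat \<Rightarrow> ('h \<Rightarrow>\<^sub>L 'h)" and \<epsilon> :: "nat \<Rightarrow> exponent"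
    and a :: "nat \<Rightarrow> complex ^ 'm ^ 'm::finite"
  assumes x_in: "j \<in> {1..n} \<Longrightarrow> x j \<in> M"
begin

definition sym_mat :: "symbol \<Rightarrow> complex ^ 'm ^ 'm" where
  "sym_mat v = epow mat_adj (epow mat_adj (a (fst v)) (\<epsilon> (fst v))) (snd v)"

definition sym_op :: "symbol \<Rightarrow> ('h \<Rightarrow>\<^sub>L 'h)" where
  "sym_op v = epow op_adj (x (fst v)) (snd v)"

definition sym_tensor :: "symbol \<Rightarrow> (('h ^ 'm) \<Rightarrow>\<^sub>L ('h ^ 'm))" where
  "sym_tensor v = mat_tensor (sym_mat v) (sym_op v)"

text \<open>The value of \<open>tr \<otimes> \<tau>\<close> at the product of the symbols of \<open>l\<close>, which is an elementary tensor.\<close>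

definition word_trace :: "symbol list \<Rightarrow> complex" where
  "word_trace l = tr_normalized (mat_list_prod sym_mat l) * \<tau> (op_list_prod sym_op l)"

definition perturbation :: "(nat \<Rightarrow> complex) \<Rightarrow> (('h ^ 'm) \<Rightarrow>\<^sub>L ('h ^ 'm))" where
  "perturbation z = (\<Sum>j=1..n. op_scaleC (z j) (sym_tensor (j, One)))"

definition sym_val :: "(nat \<Rightarrow> complex) \<Rightarrow> symbol \<Rightarrow> complex" where
  "sym_val z v = epow cnj (z (fst v)) (snd v)"

text \<open>The sum of the norms of the blocks when all variables have modulus \<open>R\<close>. It bounds \<open>\<parallel>S\<^sup>* S - 1\<parallel>\<close>, and
  its powers dominate the expansion into words.\<close>

definition majorant :: "real \<Rightarrow> real" where
  "majorant R = (\<Sum>b\<in>blocks n. prod_list (map (\<lambda>v. R * norm (sym_tensor v)) b))"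

lemma sym_op_in: "fst v \<in> {1..n} \<Longrightarrow> sym_op v \<in> M"
  by (cases "snd v") (auto simp: sym_op_def x_in M_adj)

lemma sym_tensor_clin: "fst v \<in> {1..n} \<Longrightarrow> sym_tensor v \<in> bounded_clinear_ops"
  unfolding sym_tensor_def by (intro clin_mat_tensor M_clin sym_op_in)

lemma op_list_prod_in: "(\<And>v. v \<in> set l \<Longrightarrow> fst v \<in> {1..n}) \<Longrightarrow> op_list_prod sym_op l \<in> M"
proof (induction l)
  case (Cons v l)
  have "fst v \<in> {1..n}" by (rule Cons.prems) simp
  moreover have "op_list_prod sym_op l \<in> M" by (rule Cons.IH) (rule Cons.prems, simp)
  ultimately show ?case by (simp only: op_list_prod_simps) (intro M_compose sym_op_in)
qed (simp add: M_id)

lemma sym_tensor_list_prod: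
  assumes "\<And>v. v \<in> set l \<Longrightarrow> fst v \<in> {1..n}"
  shows "op_list_prod sym_tensor l = mat_tensor (mat_list_prod sym_mat l) (op_list_prod sym_op l)"
proof -
  have "sym_tensor = (\<lambda>v. mat_tensor (sym_mat v) (sym_op v))" by (simp add: fun_eq_iff sym_tensor_def)
  thus ?thesis using mat_tensor_list_prod[of l sym_op sym_mat] assms M_clin[OF sym_op_in] by simp
qed

lemma
  assumes "\<And>v. v \<in> set l \<Longrightarrow> fst v \<in> {1..n}"
  shows diagonal_in_word: "op_list_prod sym_tensor l \<in> diagonal_in"
    and tr_tensor_word: "tr_tensor \<tau> (op_list_prod sym_tensor l) = word_trace l"
  using op_list_prod_in[of l] assms
  by (simp_all add: sym_tensor_list_prod diagonal_in_mat_tensor tr_tensor_mat_tensor word_trace_def)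

lemma cmod_word_trace_le:
  assumes "\<And>v. v \<in> set l \<Longrightarrow> fst v \<in> {1..n}"
  shows "cmod (word_trace l) \<le> 2 * prod_list (map (\<lambda>v. norm (sym_tensor v)) l)"
proof -
  have "cmod (word_trace l) \<le> 2 * norm (op_list_prod sym_tensor l)"
    using tr_tensor_bound[OF diagonal_in_word[OF assms]] by (simp only: tr_tensor_word[OF assms])
  also have "\<dots> \<le> 2 * prod_list (map (\<lambda>v. norm (sym_tensor v)) l)"
    by (intro mult_left_mono norm_op_list_prod_le) simp
  finally show ?thesis .
qed

lemma sym_tensor_adj: "j \<in> {1..n} \<Longrightarrow> op_adj (sym_tensor (j, One)) = sym_tensor (j, Star)"
  by (simp add: sym_tensor_def sym_mat_def sym_op_def mat_tensor_adj M_clin x_in)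

lemma perturbation_clin: "perturbation z \<in> bounded_clinear_ops"
  unfolding perturbation_def by (intro clin_sum clin_scaleC sym_tensor_clin) simp

lemma op_adj_perturbation:
  "op_adj (id_blinfun + perturbation z) = id_blinfun + (\<Sum>j=1..n. op_scaleC (cnj (z j)) (sym_tensor (j, Star)))"
proof (rule op_adj_eqI)
  fix \<xi> \<eta>
  have "cinner (sym_tensor (j, Star) \<xi>) \<eta> = cinner \<xi> (sym_tensor (j, One) \<eta>)" if "j \<in> {1..n}" for j
    using cinner_op_adj[OF sym_tensor_clin[of "(j, One)"]] that by (simp flip: sym_tensor_adj)
  thus "cinner ((id_blinfun + (\<Sum>j=1..n. op_scaleC (cnj (z j)) (sym_tensor (j, Star)))) \<xi>) \<eta> =
      cinner \<xi> ((id_blinfun + perturbation z) \<eta>)"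
    by (simp add: perturbation_def blinfun.bilinear_simps blinfun.sum_left cinner_simps cinner_sum_left cinner_sum_right)
qed

text \<open>With \<open>T\<close> the perturbation, this is the expansion of \<open>(1 + T\<^sup>*) (1 + T) - 1\<close> into blocks.\<close>

lemma gram_minus_id:
  "(op_adj (id_blinfun + perturbation z) o\<^sub>L (id_blinfun + perturbation z)) - id_blinfun =
    (\<Sum>b\<in>blocks n. op_scaleC (prod_list (map (sym_val z) b)) (op_list_prod sym_tensor b))"
proof -
  let ?T = "perturbation z" and ?T' = "\<Sum>j=1..n. op_scaleC (cnj (z j)) (sym_tensor (j, Star))"
  have "?T' o\<^sub>L ?T = (\<Sum>i=1..n. \<Sum>j=1..n. op_scaleC (cnj (z i)) (sym_tensor (i, Star)) o\<^sub>L op_scaleC (z j) (sym_tensor (j, One)))"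
    by (simp add: perturbation_def op_compose.sum_left
        op_compose.sum_right) (rule sum.swap)
  also have "\<dots> = (\<Sum>i=1..n. \<Sum>j=1..n. op_scaleC (cnj (z i) * z j) (sym_tensor (i, Star) o\<^sub>L sym_tensor (j, One)))"
    by (intro sum.cong refl op_scaleC_compose sym_tensor_clin) simp
  finally have TT: "?T' o\<^sub>L ?T = \<dots>" .
  have "((id_blinfun + ?T') o\<^sub>L (id_blinfun + ?T)) - id_blinfun = ?T + ?T' + (?T' o\<^sub>L ?T)"
    by (simp add: compose_simps algebra_simps)
  thus ?thesis unfolding op_adj_perturbation TT sum_blocks
    by (simp add: perturbation_def sym_val_def)
qed

lemma majorant_nonneg: "R \<ge> 0 \<Longrightarrow> majorant R \<ge> 0"
  unfolding majorant_def by (intro sum_nonneg prod_list_nonneg) auto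

lemma norm_gram_minus_id_le:
  assumes "\<And>j. j \<in> {1..n} \<Longrightarrow> cmod (z j) \<le> R"
  shows "norm ((op_adj (id_blinfun + perturbation z) o\<^sub>L (id_blinfun + perturbation z)) - id_blinfun) \<le> majorant R"
  unfolding gram_minus_id majorant_def
proof (intro sum_norm_le)
  fix b assume b: "b \<in> blocks n"
  have val: "cmod (sym_val z v) \<le> R" if "v \<in> set b" for v
    using assms[of "fst v"] blocks_index[OF b that] by (cases "snd v") (auto simp: sym_val_def)
  have "norm (op_scaleC (prod_list (map (sym_val z) b)) (op_list_prod sym_tensor b))
      \<le> cmod (prod_list (map (sym_val z) b)) * prod_list (map (\<lambda>v. norm (sym_tensor v)) b)"
    by (rule order_trans[OF norm_op_scaleC_le]) (intro mult_left_mono norm_op_list_prod_le norm_ge_zero)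
  also have "\<dots> \<le> prod_list (map (\<lambda>v. R * norm (sym_tensor v)) b)"
    using val
  proof (induction b)
    case (Cons v b)
    have "0 \<le> R" using Cons.prems[of v] order_trans[OF norm_ge_zero] by simp
    moreover have "cmod (sym_val z v) \<le> R" by (rule Cons.prems) simp
    moreover have "cmod (prod_list (map (sym_val z) b)) * prod_list (map (\<lambda>v. norm (sym_tensor v)) b)
        \<le> prod_list (map (\<lambda>v. R * norm (sym_tensor v)) b)" by (rule Cons.IH) (rule Cons.prems, simp)
    ultimately have "cmod (sym_val z v) * norm (sym_tensor v) * (cmod (prod_list (map (sym_val z) b)) *
        prod_list (map (\<lambda>v. norm (sym_tensor v)) b)) \<le>
        R * norm (sym_tensor v) * prod_list (map (\<lambda>v. R * norm (sym_tensor v)) b)"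
      by (intro mult_mono) (auto intro!: mult_nonneg_nonneg prod_list_nonneg)
    thus ?case by (simp add: norm_mult mult_ac)
  qed simp
  finally show "norm (op_scaleC (prod_list (map (sym_val z) b)) (op_list_prod sym_tensor b)) \<le>
      prod_list (map (\<lambda>v. R * norm (sym_tensor v)) b)" .
qed

lemma sum_words_majorant:
  "(\<Sum>w\<in>words n d. cmod (word_trace (concat w)) * R ^ length (concat w)) \<le> 2 * majorant R ^ d"
  if "R \<ge> 0"
proof -
  have pl: "prod_list (map (\<lambda>v. R * norm (sym_tensor v)) l) = R ^ length l * prod_list (map (\<lambda>v. norm (sym_tensor v)) l)" for l
    by (induction l) auto
  have "(\<Sum>w\<in>words n d. cmod (word_trace (concat w)) * R ^ length (concat w)) \<le>
      (\<Sum>w\<in>words n d. 2 * prod_list (map (\<lambda>v. R * norm (sym_tensor v)) (concat w)))"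
  proof (intro sum_mono)
    fix w assume w: "w \<in> words n d"
    have "cmod (word_trace (concat w)) * R ^ length (concat w) \<le>
        2 * prod_list (map (\<lambda>v. norm (sym_tensor v)) (concat w)) * R ^ length (concat w)"
      using that by (intro mult_right_mono cmod_word_trace_le word_index[OF w]) auto
    thus "cmod (word_trace (concat w)) * R ^ length (concat w) \<le>
        2 * prod_list (map (\<lambda>v. R * norm (sym_tensor v)) (concat w))"
      by (simp only: pl) (simp add: mult_ac)
  qed
  also have "\<dots> = 2 * majorant R ^ d"
    by (simp only: sum_distrib_left[symmetric] prod_list_concat[symmetric] sum_words_prod_list[OF finite_blocks] majorant_def)
  finally show ?thesis .
qed

text \<open>Take the trace of the binomial series of \<open>(S\<^sup>* S) powr (p / 2)\<close> term by term. Its value is real and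
  non-negative by positivity, so that the exponents \<open>1 / p\<close> and \<open>p\<close> cancel.\<close>

lemma Lp_norm_sums:
  assumes p: "p > 0" and z: "\<And>j. j \<in> {1..n} \<Longrightarrow> cmod (z j) \<le> R" and R: "majorant R < 1"
  shows "(\<lambda>d. \<Sum>w\<in>words n d.
      complex_of_real (p/2 gchoose d) * word_trace (concat w) * prod_list (map (sym_val z) (concat w)))
    sums complex_of_real (Lp_norm \<tau> p (id_blinfun + perturbation z) powr p)"
proof -
  let ?S = "id_blinfun + perturbation z"
  define U where "U = (op_adj ?S o\<^sub>L ?S) - id_blinfun"
  have Sc: "?S \<in> bounded_clinear_ops" by (intro clin_add perturbation_clin clin_id)
  have nU: "norm U < 1" using norm_gram_minus_id_le[OF z] R unfolding U_def by force
  have abs: "op_abs_powr ?S p = op_binomial (p/2) U"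
    unfolding U_def by (rule op_abs_powr_eq[OF Sc]) (use nU in \<open>simp add: U_def\<close>)
  have pow: "op_pow U d = (\<Sum>w\<in>words n d.
      op_scaleC (prod_list (map (sym_val z) (concat w))) (op_list_prod sym_tensor (concat w)))" for d
    unfolding U_def gram_minus_id
    by (subst op_pow_sum_words[OF finite_blocks])
       (auto intro!: clin_op_list_prod sym_tensor_clin dest: blocks_index simp: op_list_prod_concat prod_list_concat)
  have diag: "op_pow U d \<in> diagonal_in" for d
    unfolding pow by (intro diagonal_in_sum diagonal_in_scaleC diagonal_in_word word_index)
  have tr: "tr_tensor \<tau> (op_pow U d) = (\<Sum>w\<in>words n d.
      prod_list (map (sym_val z) (concat w)) * word_trace (concat w))" for d
    unfolding pow
    by (subst tr_tensor_sum[OF diagonal_in_scaleC[OF diagonal_in_word[OF word_index]]], assumption, assumption)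
       (intro sum.cong refl, subst tr_tensor_scaleC[OF diagonal_in_word[OF word_index]], assumption, assumption,
        subst tr_tensor_word[OF word_index], assumption, assumption, rule refl)
  have diag_partial: "(\<Sum>d<N. (p/2 gchoose d) *\<^sub>R op_pow U d) \<in> diagonal_in" for N
    unfolding op_scaleC_of_real[symmetric] by (intro diagonal_in_sum diagonal_in_scaleC diag)
  have tr_partial: "tr_tensor \<tau> (\<Sum>d<N. (p/2 gchoose d) *\<^sub>R op_pow U d) =
      (\<Sum>d<N. \<Sum>w\<in>words n d.
      complex_of_real (p/2 gchoose d) * word_trace (concat w) * prod_list (map (sym_val z) (concat w)))" for N
    unfolding op_scaleC_of_real[symmetric]
    by (subst tr_tensor_sum) (auto intro!: diagonal_in_scaleC diag sum.cong
        simp: tr_tensor_scaleC diag tr sum_distrib_left mult_ac)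
  have lim: "(\<lambda>N. \<Sum>d<N. (p/2 gchoose d) *\<^sub>R op_pow U d) \<longlonglongrightarrow> op_binomial (p/2) U"
    unfolding op_binomial_def by (rule summable_LIMSEQ[OF summable_op_binomial[OF nU]])
  have "op_positive (op_binomial (p/2) U)"
    unfolding U_def by (rule op_positive_op_binomial[OF self_adjoint_adj_compose[OF Sc]]) (use nU in \<open>simp add: U_def\<close>)
  with diagonal_in_lim[OF diag_partial lim]
  have "Im (tr_tensor \<tau> (op_binomial (p/2) U)) = 0" "Re (tr_tensor \<tau> (op_binomial (p/2) U)) \<ge> 0"
    using tr_tensor_positive by blast+
  hence "complex_of_real (Lp_norm \<tau> p ?S powr p) = tr_tensor \<tau> (op_binomial (p/2) U)"
    using p by (simp add: Lp_norm_def abs powr_powr complex_eq_iff)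
  thus ?thesis using tr_tensor_lim[OF diag_partial lim] by (simp only: sums_def tr_partial)
qed

lemma majorant_tendsto_0: "(majorant \<longlongrightarrow> 0) (at 0)"
proof -
  have "((\<lambda>R. \<Sum>b\<in>blocks n. prod_list (map (\<lambda>v. R * norm (sym_tensor v)) b)) \<longlongrightarrow> (\<Sum>b\<in>blocks n. 0)) (at 0)"
  proof (intro tendsto_sum)
    fix b assume "b \<in> blocks n"
    then obtain v l where b: "b = v # l" by (auto simp: blocks_def)
    have "((\<lambda>R. prod_list (map (\<lambda>v. R * norm (sym_tensor v)) l)) \<longlongrightarrow> prod_list (map (\<lambda>v. 0 * norm (sym_tensor v)) l)) (at 0)" for l
      by (induction l) (auto intro!: tendsto_eq_intros)
    hence "((\<lambda>R. R * norm (sym_tensor v) * prod_list (map (\<lambda>v. R * norm (sym_tensor v)) l)) \<longlongrightarrow> 0 * norm (sym_tensor v) *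
         prod_list (map (\<lambda>v. 0 * norm (sym_tensor v)) l)) (at 0)"
      by (intro tendsto_mult tendsto_ident_at tendsto_const)
    thus "((\<lambda>R. prod_list (map (\<lambda>v. R * norm (sym_tensor v)) b)) \<longlongrightarrow> 0) (at 0)"
      by (simp add: b)
  qed
  thus ?thesis by (simp add: majorant_def[abs_def])
qed

lemma majorant_mono: "0 \<le> R \<Longrightarrow> R \<le> R' \<Longrightarrow> majorant R \<le> majorant R'"
proof -
  assume R: "0 \<le> R" "R \<le> R'"
  have "prod_list (map (\<lambda>v. R * norm (sym_tensor v)) l) \<le> prod_list (map (\<lambda>v. R' * norm (sym_tensor v)) l)" for l
    using R by (induction l) (auto intro!: mult_mono prod_list_nonneg)
  thus ?thesis unfolding majorant_def by (intro sum_mono)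
qed

lemma majorant_radius: "\<exists>R>0. majorant R < 1"
proof -
  have "\<forall>\<^sub>F R in at 0. majorant R < 1" by (rule order_tendstoD[OF majorant_tendsto_0]) simp
  then obtain d where d: "d > 0" "\<And>R. R \<noteq> 0 \<Longrightarrow> dist R 0 < d \<Longrightarrow> majorant R < 1"
    unfolding eventually_at by auto
  show ?thesis using d(2)[of "d/2"] d(1) by (intro exI[of _ "d/2"]) auto
qed

end

section \<open>Integration over the torus\<close>

lemma integral_exp_circle:
  "integral\<^sup>L lborel (\<lambda>t::real. indicator {0..2*pi} t *\<^sub>R exp (\<i> * of_int k * complex_of_real t)) =
    (if k = 0 then complex_of_real (2 * pi) else 0)"
proof (cases "k = 0")
  case True
  thus ?thesis by (simp add: scaleR_conv_of_real)
next
  case False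
  have "integral\<^sup>L lborel (\<lambda>t::real. indicator {0..2*pi} t *\<^sub>R exp (\<i> * of_int k * complex_of_real t)) =
     exp (\<i> * of_int k * complex_of_real (2*pi)) / (\<i> * of_int k) - exp (\<i> * of_int k * complex_of_real 0) / (\<i> * of_int k)"
  proof (rule integral_FTC_atLeastAtMost)
    show "continuous_on {0..2*pi} (\<lambda>t. exp (\<i> * of_int k * complex_of_real t))"
      by (intro continuous_intros)
    fix t :: real
    show "((\<lambda>t. exp (\<i> * of_int k * complex_of_real t) / (\<i> * of_int k)) has_vector_derivative
        exp (\<i> * of_int k * complex_of_real t)) (at t within {0..2*pi})"
      using False by (auto intro!: derivative_eq_intros has_vector_derivative_real_field)
  qed simp
  also have "exp (\<i> * of_int k * complex_of_real (2*pi)) = 1"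
    using exp_integer_2pi[of "of_int k"] by (simp add: mult_ac)
  finally show ?thesis using False by simp
qed

text \<open>Lebesgue measure on \<open>\<real>\<^sup>n\<close> is the image of a product measure, so the integral of a product of
  functions of the separate coordinates factorises.\<close>

lemma
  fixes h :: "'b::euclidean_space \<Rightarrow> real \<Rightarrow> complex"
  assumes h: "\<And>b. b \<in> Basis \<Longrightarrow> integrable lborel (h b)"
  shows integrable_prod_Basis: "integrable lborel (\<lambda>x. \<Prod>b\<in>Basis. h b (x \<bullet> b))"
    and integral_prod_Basis: "integral\<^sup>L lborel (\<lambda>x. \<Prod>b\<in>Basis. h b (x \<bullet> b)) = (\<Prod>b\<in>Basis. integral\<^sup>L lborel (h b))"
proof -
  interpret product_sigma_finite "\<lambda>_::'b. lborel :: real measure" ..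
  let ?P = "Pi\<^sub>M Basis (\<lambda>_. lborel :: real measure)"
  let ?g = "\<lambda>f. \<Sum>b\<in>Basis. f b *\<^sub>R b :: 'b"
  have g: "?g \<in> measurable ?P borel" by measurable
  have hm: "h b \<in> borel_measurable borel" if "b \<in> Basis" for b
    using borel_measurable_integrable[OF h[OF that]] by simp
  have f: "(\<lambda>x. \<Prod>b\<in>Basis. h b (x \<bullet> b)) \<in> borel_measurable borel"
  proof (rule borel_measurable_prod)
    fix b :: 'b assume b: "b \<in> Basis"
    have "(\<lambda>x. x \<bullet> b) \<in> borel_measurable borel" by measurable
    thus "(\<lambda>x. h b (x \<bullet> b)) \<in> borel_measurable borel"
      using measurable_compose[OF _ hm[OF b]] by blast
  qed
  have comp: "(\<lambda>f. \<Prod>b\<in>Basis. h b (?g f \<bullet> b)) = (\<lambda>f. \<Prod>b\<in>Basis. h b (f b))"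
    by (intro ext prod.cong refl) (simp add: inner_sum_left inner_Basis if_distrib cong: if_cong)
  show "integrable lborel (\<lambda>x. \<Prod>b\<in>Basis. h b (x \<bullet> b))"
    by (subst lborel_eq, subst integrable_distr_eq[OF g f], subst comp)
       (rule product_integrable_prod[OF finite_Basis h])
  show "integral\<^sup>L lborel (\<lambda>x. \<Prod>b\<in>Basis. h b (x \<bullet> b)) = (\<Prod>b\<in>Basis. integral\<^sup>L lborel (h b))"
    by (subst lborel_eq, subst integral_distr[OF g f], subst comp)
       (rule product_integral_prod[OF finite_Basis h])
qed

lemma prod_Basis_vec:
  fixes F :: "real ^ 'n::finite \<Rightarrow> 'c::comm_monoid_mult"
  shows "(\<Prod>b\<in>Basis. F b) = (\<Prod>i\<in>UNIV. F (axis i 1))"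
proof -
  have B: "(Basis :: (real ^ 'n) set) = range (\<lambda>i. axis i 1)" by (auto simp: Basis_vec_def)
  have "inj (\<lambda>i::'n. axis i (1::real))" by (auto simp: inj_def axis_eq_axis)
  thus ?thesis unfolding B by (simp add: prod.reindex)
qed

abbreviation torus_character :: "('n::finite \<Rightarrow> int) \<Rightarrow> real ^ 'n \<Rightarrow> complex" where
  "torus_character \<kappa> \<theta> \<equiv> \<Prod>i\<in>UNIV. exp (\<i> * of_int (\<kappa> i) * complex_of_real (\<theta> $ i))"

lemma has_integral_torus:
  fixes \<kappa> :: "'n::finite \<Rightarrow> int"
  shows "((\<lambda>\<theta>. torus_character \<kappa> \<theta>) has_integral
    (if \<forall>i. \<kappa> i = 0 then complex_of_real ((2 * pi) ^ CARD('n)) else 0)) (cbox 0 (\<chi> i. 2 * pi))"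
proof -
  define h where "h = (\<lambda>(b::real ^ 'n) (t::real). indicator {0..2*pi} t *\<^sub>R
      exp (\<i> * of_int (\<kappa> (axis_index b)) * complex_of_real t))"
  have idx: "axis_index (axis i 1 :: real ^ 'n) = i" for i by (simp add: axis_index_axis)
  have int: "integrable lborel (h b)" for b
    unfolding h_def by (intro borel_integrable_compact compact_Icc continuous_intros)
  have "integral\<^sup>L lborel (\<lambda>x. \<Prod>b\<in>Basis. h b (x \<bullet> b)) = (\<Prod>b\<in>Basis. integral\<^sup>L lborel (h b))"
    by (rule integral_prod_Basis[OF int])
  also have "\<dots> = (\<Prod>i\<in>UNIV. integral\<^sup>L lborel (h (axis i 1)))" by (rule prod_Basis_vec)
  also have "\<dots> = (\<Prod>i\<in>UNIV. if \<kappa> i = 0 then complex_of_real (2 * pi) else 0)"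
    by (simp only: h_def idx integral_exp_circle)
  also have "\<dots> = (if \<forall>i. \<kappa> i = 0 then complex_of_real ((2 * pi) ^ CARD('n)) else 0)"
    by (auto simp: prod_zero_iff)
  finally have "((\<lambda>x. \<Prod>b\<in>Basis. h b (x \<bullet> b)) has_integral (if \<forall>i. \<kappa> i = 0 then complex_of_real ((2 * pi) ^ CARD('n)) else 0)) UNIV"
    using has_integral_integral_lborel[OF integrable_prod_Basis[of h, OF int]] by simp
  also have "(\<lambda>x::real^'n. \<Prod>b\<in>Basis. h b (x \<bullet> b)) =
     (\<lambda>\<theta>. if \<theta> \<in> cbox 0 (\<chi> i. 2 * pi) then torus_character \<kappa> \<theta> else 0)"
  proof
    fix \<theta> :: "real ^ 'n"
    have *: "(\<Prod>b\<in>Basis. h b (\<theta> \<bullet> b)) = (\<Prod>i\<in>UNIV. indicator {0..2*pi} (\<theta> $ i) *\<^sub>R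
       exp (\<i> * of_int (\<kappa> i) * complex_of_real (\<theta> $ i)))"
      by (simp add: prod_Basis_vec h_def idx cart_eq_inner_axis)
    show "(\<Prod>b\<in>Basis. h b (\<theta> \<bullet> b)) = (if \<theta> \<in> cbox 0 (\<chi> i. 2 * pi) then
        torus_character \<kappa> \<theta> else 0)"
    proof (cases "\<theta> \<in> cbox 0 (\<chi> i. 2 * pi)")
      case True
      thus ?thesis unfolding * by (auto simp: mem_box_cart intro!: prod.cong)
    next
      case False
      then obtain i where "\<theta> $ i \<notin> {0..2*pi}" by (auto simp: mem_box_cart)
      hence "(\<Prod>i\<in>UNIV. indicator {0..2*pi} (\<theta> $ i) *\<^sub>R
       exp (\<i> * of_int (\<kappa> i) * complex_of_real (\<theta> $ i))) = 0"
        by (intro prod_zero bexI[of _ i]) auto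
      thus ?thesis using False unfolding * by simp
    qed
  qed
  finally show ?thesis by (simp add: has_integral_restrict_UNIV)
qed

section \<open>Smoothness of multivariate power series\<close>

text \<open>The iterated derivatives are evaluated only at points of the open set \<open>U\<close>, so they depend only on
  the values of the function there.\<close>

lemma times_differentiable_on_cong:
  assumes "open U"
  shows "(\<And>x. x \<in> U \<Longrightarrow> f x = g x) \<Longrightarrow> times_differentiable_on k U f \<Longrightarrow> times_differentiable_on k U g"
proof (induction k arbitrary: f g)
  case 0
  thus ?case by (simp cong: continuous_on_cong)
next
  case (Suc k)
  have der: "(g has_derivative frechet_derivative f (at x)) (at x)" if x: "x \<in> U" for x
  proof (rule has_derivative_transform_within_open[OF _ assms x])
    show "(f has_derivative frechet_derivative f (at x)) (at x)"
      using Suc.prems(2) x unfolding times_differentiable_on.simps frechet_derivative_works by blast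
  qed (rule Suc.prems(1))
  have "times_differentiable_on k U (\<lambda>x. frechet_derivative g (at x) v)" for v
    by (rule Suc.IH[of "\<lambda>x. frechet_derivative f (at x) v"])
       (use Suc.prems in \<open>simp_all add: frechet_derivative_at[OF der, symmetric]\<close>)
  thus ?case using der unfolding times_differentiable_on.simps differentiable_def by blast
qed

lemma times_differentiable_on_add:
  assumes "open U"
  shows "times_differentiable_on k U f \<Longrightarrow> times_differentiable_on k U g \<Longrightarrow> times_differentiable_on k U (\<lambda>x. f x + g x)"
proof (induction k arbitrary: f g)
  case 0
  thus ?case by (simp add: continuous_on_add)
next
  case (Suc k)
  have der: "((\<lambda>x. f x + g x) has_derivative
      (\<lambda>v. frechet_derivative f (at x) v + frechet_derivative g (at x) v)) (at x)" if "x \<in> U" for x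
    by (intro has_derivative_add)
       (use Suc.prems that in \<open>unfold times_differentiable_on.simps frechet_derivative_works, blast+\<close>)
  have "times_differentiable_on k U (\<lambda>x. frechet_derivative (\<lambda>x. f x + g x) (at x) v)" for v
  proof (rule times_differentiable_on_cong[OF assms])
    show "times_differentiable_on k U (\<lambda>x. frechet_derivative f (at x) v + frechet_derivative g (at x) v)"
      using Suc by auto
    show "frechet_derivative f (at x) v + frechet_derivative g (at x) v =
        frechet_derivative (\<lambda>x. f x + g x) (at x) v" if "x \<in> U" for x
      by (rule fun_cong[OF frechet_derivative_at[OF der[OF that]]])
  qed
  thus ?case using der unfolding times_differentiable_on.simps differentiable_def by blast
qed

lemma times_differentiable_on_scaleR:
  assumes "open U"
  shows "times_differentiable_on k U f \<Longrightarrow> times_differentiable_on k U (\<lambda>x. c *\<^sub>R f x)"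
proof (induction k arbitrary: f)
  case 0
  thus ?case by (simp add: continuous_on_scaleR)
next
  case (Suc k)
  have der: "((\<lambda>x. c *\<^sub>R f x) has_derivative (\<lambda>v. c *\<^sub>R frechet_derivative f (at x) v)) (at x)" if "x \<in> U" for x
    by (intro has_derivative_scaleR_right)
       (use Suc.prems that in \<open>unfold times_differentiable_on.simps frechet_derivative_works, blast\<close>)
  have "times_differentiable_on k U (\<lambda>x. frechet_derivative (\<lambda>x. c *\<^sub>R f x) (at x) v)" for v
  proof (rule times_differentiable_on_cong[OF assms])
    show "times_differentiable_on k U (\<lambda>x. c *\<^sub>R frechet_derivative f (at x) v)" using Suc by simp
    show "c *\<^sub>R frechet_derivative f (at x) v = frechet_derivative (\<lambda>x. c *\<^sub>R f x) (at x) v" if "x \<in> U" for x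
      by (rule fun_cong[OF frechet_derivative_at[OF der[OF that]]])
  qed
  thus ?case using der unfolding times_differentiable_on.simps differentiable_def by blast
qed

lemma times_differentiable_on_zero: "times_differentiable_on k U (\<lambda>x. 0)"
  by (induction k) (auto simp: frechet_derivative_const)

lemma times_differentiable_on_sum:
  assumes "open U" "\<And>i. i \<in> I \<Longrightarrow> times_differentiable_on k U (f i)"
  shows "times_differentiable_on k U (\<lambda>x. \<Sum>i\<in>I. f i x)"
  using assms(2)
  by (induction I rule: infinite_finite_induct)
     (auto intro: times_differentiable_on_add[OF assms(1)] times_differentiable_on_zero)

definition monomial :: "('n::finite \<Rightarrow> nat) \<Rightarrow> real ^ 'n \<Rightarrow> complex" where
  "monomial m r = (\<Prod>i\<in>UNIV. complex_of_real (r $ i) ^ m i)"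

definition total_degree :: "('n::finite \<Rightarrow> nat) \<Rightarrow> nat" where
  "total_degree m = (\<Sum>i\<in>UNIV. m i)"

definition polydisc :: "real \<Rightarrow> (real ^ 'n::finite) set" where
  "polydisc R = {r. \<forall>i. \<bar>r $ i\<bar> < R}"

definition lower_degree :: "'n \<Rightarrow> ('n \<Rightarrow> nat) \<Rightarrow> ('n \<Rightarrow> nat)" where
  "lower_degree i m = m(i := m i - 1)"

lemma open_polydisc: "open (polydisc R :: (real ^ 'n::finite) set)"
proof -
  have "polydisc R = (\<Inter>i. {r :: real ^ 'n. \<bar>r $ i\<bar> < R})" by (auto simp: polydisc_def)
  moreover have "open {r :: real ^ 'n. \<bar>r $ i\<bar> < R}" for i
    by (intro open_Collect_less continuous_intros)
  ultimately show ?thesis by (simp add: open_INT)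
qed

lemma convex_polydisc: "convex (polydisc R :: (real ^ 'n::finite) set)"
proof (rule convexI)
  fix x y :: "real ^ 'n" and u v :: real
  assume "x \<in> polydisc R" "y \<in> polydisc R" and uv: "0 \<le> u" "0 \<le> v" "u + v = 1"
  hence xy: "\<bar>x $ i\<bar> < R" "\<bar>y $ i\<bar> < R" for i by (auto simp: polydisc_def)
  have "\<bar>u * x $ i + v * y $ i\<bar> < R" for i
  proof -
    have "\<bar>u * x $ i + v * y $ i\<bar> \<le> u * \<bar>x $ i\<bar> + v * \<bar>y $ i\<bar>"
      using abs_triangle_ineq[of "u * x $ i" "v * y $ i"] uv by (simp add: abs_mult)
    also have "\<dots> < R" by (rule convex_bound_lt[OF xy uv])
    finally show ?thesis .
  qed
  thus "u *\<^sub>R x + v *\<^sub>R y \<in> polydisc R" by (simp add: polydisc_def)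
qed

lemma polydisc_interior_radius:
  assumes "r \<in> polydisc R"
  shows "\<exists>R'. 0 < R' \<and> R' < R \<and> r \<in> polydisc R'"
proof -
  define s where "s = Max (range (\<lambda>i. \<bar>r $ i\<bar>))"
  have s: "\<bar>r $ i\<bar> \<le> s" for i unfolding s_def by (rule Max_ge) auto
  have "s \<in> range (\<lambda>i. \<bar>r $ i\<bar>)" unfolding s_def by (rule Max_in) auto
  hence "0 \<le> s" "s < R" using assms by (auto simp: polydisc_def)
  then obtain R' where "s < R'" "R' < R" using dense by blast
  thus ?thesis using s \<open>0 \<le> s\<close> by (intro exI[of _ R']) (auto simp: polydisc_def intro: le_less_trans)
qed

lemma cmod_monomial_le:
  assumes "r \<in> polydisc R"
  shows "cmod (monomial m r) \<le> R ^ total_degree m"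
proof -
  have "cmod (monomial m r) = (\<Prod>i\<in>UNIV. \<bar>r $ i\<bar> ^ m i)"
    by (simp add: monomial_def norm_power flip: prod_norm)
  also have "\<dots> \<le> (\<Prod>i\<in>UNIV. R ^ m i)"
    using assms by (intro prod_mono conjI power_mono) (auto simp: polydisc_def less_imp_le)
  finally show ?thesis by (simp add: total_degree_def power_sum)
qed

lemma has_derivative_monomial:
  "(monomial m has_derivative (\<lambda>h. \<Sum>i\<in>UNIV. h $ i *\<^sub>R (of_nat (m i) * monomial (lower_degree i m) r))) (at r within S)"
proof -
  have rest: "(\<Prod>j\<in>UNIV - {i}. complex_of_real (r $ j) ^ m j) * complex_of_real (r $ i) ^ (m i - 1) = monomial (lower_degree i m) r" for i
    unfolding monomial_def by (subst (2) prod.remove[of _ i]) (auto simp: lower_degree_def mult.commute intro!: prod.cong arg_cong2[of _ _ _ _ "(*)"])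
  have "((\<lambda>r. complex_of_real (r $ i) ^ m i) has_derivative
      (\<lambda>h. of_nat (m i) * complex_of_real (h $ i) * complex_of_real (r $ i) ^ (m i - 1))) (at r within S)" for i
    by (rule derivative_eq_intros bounded_linear.has_derivative[OF bounded_linear_of_real]
        bounded_linear.has_derivative[OF bounded_linear_vec_nth] has_derivative_ident refl | simp add: mult_ac)+
  hence "((\<lambda>r. \<Prod>i\<in>UNIV. complex_of_real (r $ i) ^ m i) has_derivative (\<lambda>h. \<Sum>i\<in>UNIV.
     of_nat (m i) * complex_of_real (h $ i) * complex_of_real (r $ i) ^ (m i - 1) *
       (\<Prod>j\<in>UNIV - {i}. complex_of_real (r $ j) ^ m j))) (at r within S)"
    by (intro has_derivative_prod)
  moreover have "monomial m = (\<lambda>r. \<Prod>i\<in>UNIV. complex_of_real (r $ i) ^ m i)"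
    by (simp add: fun_eq_iff monomial_def)
  ultimately show ?thesis
    by (simp add: rest[symmetric] scaleR_conv_of_real mult_ac)
qed

text \<open>Power series are kept in the form in which they arise: the \<open>d\<close>-th summand is a finite sum of
  monomials indexed by \<open>W d\<close>, and the same monomial may occur for many indices. Differentiation changes
  coefficients and exponents but not the index sets, so the class is closed under it.\<close>

locale power_series_family =
  fixes W :: "nat \<Rightarrow> 'w set" and R0 :: real
  assumes finite_W: "finite (W d)"
begin

definition abs_convergent :: "('w \<Rightarrow> complex) \<Rightarrow> ('w \<Rightarrow> 'n::finite \<Rightarrow> nat) \<Rightarrow> bool" where
  "abs_convergent c m \<longleftrightarrow> (\<forall>R. 0 \<le> R \<longrightarrow> R < R0 \<longrightarrow> summable (\<lambda>d. \<Sum>w\<in>W d. cmod (c w) * R ^ total_degree (m w)))"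

definition series :: "('w \<Rightarrow> complex) \<Rightarrow> ('w \<Rightarrow> 'n::finite \<Rightarrow> nat) \<Rightarrow> real ^ 'n \<Rightarrow> complex" where
  "series c m r = (\<Sum>d. \<Sum>w\<in>W d. c w * monomial (m w) r)"

lemma term_bound:
  assumes "r \<in> polydisc R"
  shows "cmod (\<Sum>w\<in>W d. c w * monomial (m w) r) \<le> (\<Sum>w\<in>W d. cmod (c w) * R ^ total_degree (m w))"
  by (intro sum_norm_le) (auto simp: norm_mult intro!: mult_left_mono cmod_monomial_le[OF assms])

lemma uniform_limit_series:
  assumes "abs_convergent c m" "0 \<le> R" "R < R0"
  shows "uniform_limit (polydisc R) (\<lambda>N r. \<Sum>d<N. \<Sum>w\<in>W d. c w * monomial (m w) r) (series c m) sequentially"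
  unfolding series_def using assms
  by (intro Weierstrass_m_test[where M = "\<lambda>d. \<Sum>w\<in>W d. cmod (c w) * R ^ total_degree (m w)"] term_bound)
     (auto simp: abs_convergent_def)

lemma series_sums:
  assumes "abs_convergent c m" "r \<in> polydisc R0"
  shows "(\<lambda>d. \<Sum>w\<in>W d. c w * monomial (m w) r) sums series c m r"
proof -
  obtain R where R: "0 < R" "R < R0" "r \<in> polydisc R" using polydisc_interior_radius[OF assms(2)] by blast
  show ?thesis unfolding sums_def
    by (rule tendsto_uniform_limitI[OF uniform_limit_series[OF assms(1) _ R(2)] R(3)]) (use R in simp)
qed

lemma abs_convergent_comparison:
  assumes "abs_convergent c m"
    and "\<And>R. 0 \<le> R \<Longrightarrow> R < R0 \<Longrightarrow> \<exists>R' C. 0 \<le> R' \<and> R' < R0 \<and>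
      (\<forall>w. cmod (c' w) * R ^ total_degree (m' w) \<le> C * (cmod (c w) * R' ^ total_degree (m w)))"
  shows "abs_convergent c' m'"
  unfolding abs_convergent_def
proof (intro allI impI)
  fix R assume R: "0 \<le> R" "R < R0"
  then obtain R' C where R': "0 \<le> R'" "R' < R0"
    and le: "\<And>w. cmod (c' w) * R ^ total_degree (m' w) \<le> C * (cmod (c w) * R' ^ total_degree (m w))"
    using assms(2) by blast
  have summ: "summable (\<lambda>d. C * (\<Sum>w\<in>W d. cmod (c w) * R' ^ total_degree (m w)))"
    using assms(1) R' unfolding abs_convergent_def by (intro summable_mult) auto
  show "summable (\<lambda>d. \<Sum>w\<in>W d. cmod (c' w) * R ^ total_degree (m' w))"
  proof (rule summable_comparison_test[OF _ summ], intro exI allI impI)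
    fix d
    have "norm (\<Sum>w\<in>W d. cmod (c' w) * R ^ total_degree (m' w)) = (\<Sum>w\<in>W d. cmod (c' w) * R ^ total_degree (m' w))"
      using R by (simp add: sum_nonneg)
    also have "\<dots> \<le> (\<Sum>w\<in>W d. C * (cmod (c w) * R' ^ total_degree (m w)))"
      by (intro sum_mono le)
    finally show "norm (\<Sum>w\<in>W d. cmod (c' w) * R ^ total_degree (m' w)) \<le>
        C * (\<Sum>w\<in>W d. cmod (c w) * R' ^ total_degree (m w))"
      by (simp add: sum_distrib_left)
  qed
qed

text \<open>The factor \<open>m i\<close> that differentiation produces is absorbed by a slightly larger radius.\<close>

lemma abs_convergent_lower:
  assumes "abs_convergent c m"
  shows "abs_convergent (\<lambda>w. c w * of_nat (m w i)) (\<lambda>w. lower_degree i (m w))"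
proof (rule abs_convergent_comparison[OF assms])
  fix R assume R: "0 \<le> R" "R < R0"
  obtain R1 where R1: "R < R1" "R1 < R0" using dense R by blast
  obtain R' where R': "R1 < R'" "R' < R0" using dense R1 by blast
  define q where "q = R1 / R'"
  have q: "0 < q" "q < 1" using R R1 R' by (auto simp: q_def)
  have "(\<lambda>k. of_nat k * q ^ k) \<longlonglongrightarrow> 0" using q by (intro powser_times_n_limit_0) simp
  hence "Bseq (\<lambda>k. real k * q ^ k)" by (intro convergent_imp_Bseq convergentI)
  then obtain B where B: "B > 0" "\<And>k. norm (real k * q ^ k) \<le> B" unfolding Bseq_def by blast
  have bound: "cmod (c w * of_nat (m w i)) * R ^ total_degree (lower_degree i (m w)) \<le>
      B / R1 * (cmod (c w) * R' ^ total_degree (m w))" for w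
  proof (cases "m w i = 0")
    case True
    have "0 \<le> B / R1 * (cmod (c w) * R' ^ total_degree (m w))" using B R R1 R' by simp
    thus ?thesis using True by simp
  next
    case False
    let ?k = "total_degree (m w)"
    have k1: "total_degree (m w) = m w i + (\<Sum>j\<in>UNIV - {i}. m w j)"
      unfolding total_degree_def by (rule sum.remove) auto
    have "total_degree (lower_degree i (m w)) = (m w i - 1) + (\<Sum>j\<in>UNIV - {i}. m w j)"
      unfolding total_degree_def by (subst sum.remove[of _ i]) (auto simp: lower_degree_def)
    hence k: "?k = Suc (total_degree (lower_degree i (m w)))" using k1 False by simp
    have "real (m w i) * R ^ total_degree (lower_degree i (m w)) \<le> real ?k * R1 ^ total_degree (lower_degree i (m w))"
    proof (intro mult_mono power_mono)
      show "real (m w i) \<le> real ?k" using k1 by (subst of_nat_le_iff) linarith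
    qed (use R R1 in auto)
    also have "\<dots> = real ?k * q ^ ?k * R' ^ ?k / R1"
      using R R1 R' by (simp add: k q_def power_divide)
    also have "\<dots> \<le> B * R' ^ ?k / R1"
      using B(2)[of ?k] R R1 R' by (intro divide_right_mono mult_right_mono) auto
    finally have "cmod (c w) * (real (m w i) * R ^ total_degree (lower_degree i (m w))) \<le> cmod (c w) * (B * R' ^ ?k / R1)"
      by (intro mult_left_mono) auto
    thus ?thesis by (simp add: norm_mult mult_ac)
  qed
  show "\<exists>R' C. 0 \<le> R' \<and> R' < R0 \<and> (\<forall>w. cmod (c w * of_nat (m w i)) *
      R ^ total_degree (lower_degree i (m w)) \<le> C * (cmod (c w) * R' ^ total_degree (m w)))"
    using bound R R1 R' by (intro exI[of _ R'] exI[of _ "B / R1"]) auto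
qed

text \<open>On a smaller polydisc the partial derivatives converge uniformly by the Weierstrass test, so
  termwise differentiation is legitimate.\<close>

lemma has_derivative_series_monomial:
  fixes m :: "'w \<Rightarrow> 'n::finite \<Rightarrow> nat"
  assumes c: "abs_convergent c m" and r0: "r0 \<in> polydisc R0"
  shows "(series c m has_derivative (\<lambda>h. \<Sum>i\<in>UNIV. h $ i *\<^sub>R
      series (\<lambda>w. c w * of_nat (m w i)) (\<lambda>w. lower_degree i (m w)) r0)) (at r0)"
proof -
  obtain R where R: "0 < R" "R < R0" and r0R: "r0 \<in> polydisc R" using polydisc_interior_radius[OF r0] by blast
  let ?S = "polydisc R :: (real ^ 'n) set"
  define F where "F i d r = (\<Sum>w\<in>W d. c w * of_nat (m w i) * monomial (lower_degree i (m w)) r)" for i d r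
  define G where "G i = series (\<lambda>w. c w * of_nat (m w i)) (\<lambda>w. lower_degree i (m w))" for i
  have "\<exists>g. \<forall>x\<in>?S. (\<lambda>d. \<Sum>w\<in>W d. c w * monomial (m w) x) sums g x \<and>
      (g has_derivative (\<lambda>h. \<Sum>i\<in>UNIV. h $ i *\<^sub>R G i x)) (at x within ?S)"
  proof (rule has_derivative_series)
    show "convex ?S" by (rule convex_polydisc)
    fix d and x :: "real ^ 'n"
    have "((\<lambda>x. \<Sum>w\<in>W d. c w * monomial (m w) x) has_derivative (\<lambda>h. \<Sum>w\<in>W d. c w *
        (\<Sum>i\<in>UNIV. h $ i *\<^sub>R (of_nat (m w i) * monomial (lower_degree i (m w)) x)))) (at x within ?S)"
      by (intro has_derivative_sum has_derivative_mult_right has_derivative_monomial)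
    also have "(\<lambda>h. \<Sum>w\<in>W d. c w * (\<Sum>i\<in>UNIV. h $ i *\<^sub>R (of_nat (m w i) * monomial (lower_degree i (m w)) x))) =
        (\<lambda>h. \<Sum>i\<in>UNIV. h $ i *\<^sub>R F i d x)"
    proof
      fix h :: "real ^ 'n"
      have "(\<Sum>w\<in>W d. c w * (\<Sum>i\<in>UNIV. h $ i *\<^sub>R (of_nat (m w i) * monomial (lower_degree i (m w)) x))) =
        (\<Sum>w\<in>W d. \<Sum>i\<in>UNIV. h $ i *\<^sub>R (c w * of_nat (m w i) * monomial (lower_degree i (m w)) x))"
        by (simp add: sum_distrib_left mult.assoc)
      also have "\<dots> = (\<Sum>i\<in>UNIV. \<Sum>w\<in>W d. h $ i *\<^sub>R (c w * of_nat (m w i) * monomial (lower_degree i (m w)) x))"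
        by (rule sum.swap)
      finally show "(\<Sum>w\<in>W d. c w * (\<Sum>i\<in>UNIV. h $ i *\<^sub>R (of_nat (m w i) * monomial (lower_degree i (m w)) x))) =
        (\<Sum>i\<in>UNIV. h $ i *\<^sub>R F i d x)" by (simp add: F_def scaleR_sum_right)
    qed
    finally show "((\<lambda>x. \<Sum>w\<in>W d. c w * monomial (m w) x) has_derivative (\<lambda>h. \<Sum>i\<in>UNIV. h $ i *\<^sub>R F i d x)) (at x within ?S)" .
  next
    fix e :: real assume e: "e > 0"
    define e' where "e' = e / CARD('n)"
    have e': "e' > 0" using e by (simp add: e'_def)
    have "\<forall>\<^sub>F N in sequentially. \<forall>i. \<forall>x\<in>?S. dist (\<Sum>d<N. F i d x) (G i x) < e'"
    proof (rule eventually_all_finite)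
      fix i
      have "uniform_limit ?S (\<lambda>N r. \<Sum>d<N. F i d r) (G i) sequentially"
        unfolding F_def G_def using R by (intro uniform_limit_series abs_convergent_lower[OF c]) auto
      thus "\<forall>\<^sub>F N in sequentially. \<forall>x\<in>?S. dist (\<Sum>d<N. F i d x) (G i x) < e'"
        by (rule uniform_limitD[OF _ e'])
    qed
    thus "\<forall>\<^sub>F N in sequentially. \<forall>x\<in>?S. \<forall>h. norm ((\<Sum>d<N. \<Sum>i\<in>UNIV. h $ i *\<^sub>R F i d x) - (\<Sum>i\<in>UNIV. h $ i *\<^sub>R G i x)) \<le> e * norm h"
    proof eventually_elim
      case (elim N)
      show ?case
      proof (intro ballI allI)
        fix x h assume x: "x \<in> ?S"
        have "(\<Sum>d<N. \<Sum>i\<in>UNIV. h $ i *\<^sub>R F i d x) - (\<Sum>i\<in>UNIV. h $ i *\<^sub>R G i x) =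
            (\<Sum>i\<in>UNIV. h $ i *\<^sub>R ((\<Sum>d<N. F i d x) - G i x))"
          by (subst sum.swap) (simp add: scaleR_sum_right scaleR_diff_right sum_subtractf)
        also have "norm \<dots> \<le> (\<Sum>i\<in>(UNIV::'n set). norm h * e')"
        proof (rule sum_norm_le)
          fix i
          have "\<bar>h $ i\<bar> \<le> norm h" using Finite_Cartesian_Product.norm_nth_le[of h i] by simp
          moreover have "norm ((\<Sum>d<N. F i d x) - G i x) \<le> e'" using elim x by (auto simp: dist_norm less_imp_le)
          ultimately show "norm (h $ i *\<^sub>R ((\<Sum>d<N. F i d x) - G i x)) \<le> norm h * e'"
            by (simp add: mult_mono)
        qed
        also have "\<dots> = e * norm h" by (simp add: e'_def)
        finally show "norm ((\<Sum>d<N. \<Sum>i\<in>UNIV. h $ i *\<^sub>R F i d x) - (\<Sum>i\<in>UNIV. h $ i *\<^sub>R G i x)) \<le> e * norm h" .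
      qed
    qed
  next
    show "r0 \<in> ?S" by (rule r0R)
    show "(\<lambda>d. \<Sum>w\<in>W d. c w * monomial (m w) r0) sums series c m r0" by (rule series_sums[OF c r0])
  qed
  then obtain g where g: "\<And>x. x \<in> ?S \<Longrightarrow> (\<lambda>d. \<Sum>w\<in>W d. c w * monomial (m w) x) sums g x"
    "(g has_derivative (\<lambda>h. \<Sum>i\<in>UNIV. h $ i *\<^sub>R G i r0)) (at r0 within ?S)" using r0R by blast
  have "(g has_derivative (\<lambda>h. \<Sum>i\<in>UNIV. h $ i *\<^sub>R G i r0)) (at r0)"
    using g(2) at_within_open[OF r0R open_polydisc] by simp
  hence "(series c m has_derivative (\<lambda>h. \<Sum>i\<in>UNIV. h $ i *\<^sub>R G i r0)) (at r0)"
    by (rule has_derivative_transform_within_open[OF _ open_polydisc r0R])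
       (use g(1) in \<open>simp add: series_def sums_iff\<close>)
  thus ?thesis by (simp add: G_def)
qed

text \<open>A directional derivative is a linear combination of the partial derivatives, which are series of
  the same kind.\<close>

lemma times_differentiable_on_series:
  "abs_convergent c m \<Longrightarrow> times_differentiable_on k (polydisc R0) (series c (m :: 'w \<Rightarrow> 'n::finite \<Rightarrow> nat))"
proof (induction k arbitrary: c m)
  case 0
  have "continuous_on (polydisc R0) (series c m)"
    by (intro continuous_at_imp_continuous_on ballI has_derivative_continuous[OF has_derivative_series_monomial[OF 0]])
  thus ?case by simp
next
  case (Suc k)
  note der = has_derivative_series_monomial[OF Suc.prems]
  have "times_differentiable_on k (polydisc R0) (\<lambda>r. frechet_derivative (series c m) (at r) v)" for v
  proof (rule times_differentiable_on_cong[OF open_polydisc])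
    show "times_differentiable_on k (polydisc R0) (\<lambda>r. \<Sum>i\<in>UNIV. v $ i *\<^sub>R
      series (\<lambda>w. c w * of_nat (m w i)) (\<lambda>w. lower_degree i (m w)) r)"
      by (intro times_differentiable_on_sum times_differentiable_on_scaleR open_polydisc Suc.IH
          abs_convergent_lower Suc.prems)
    show "(\<Sum>i\<in>UNIV. v $ i *\<^sub>R series (\<lambda>w. c w * of_nat (m w i)) (\<lambda>w. lower_degree i (m w)) r) =
        frechet_derivative (series c m) (at r) v" if "r \<in> polydisc R0" for r
      by (rule fun_cong[OF frechet_derivative_at[OF der[OF that]]])
  qed
  thus ?case using der unfolding times_differentiable_on.simps differentiable_def by blast
qed

end

section \<open>Iterated partial derivatives at the origin\<close>

lemma has_vector_derivative_times_id:
  fixes H :: "real \<Rightarrow> complex"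
  assumes "(H \<longlongrightarrow> H 0) (at 0)"
  shows "((\<lambda>t. complex_of_real t * H t) has_vector_derivative H 0) (at 0)"
  unfolding has_vector_derivative_def has_derivative_at
proof
  show "bounded_linear (\<lambda>h. h *\<^sub>R H 0)" by (rule bounded_linear_scaleR_left)
  have "((\<lambda>h. norm (H h - H 0)) \<longlongrightarrow> 0) (at 0)"
    by (intro tendsto_norm_zero LIM_zero assms)
  thus "(\<lambda>h. norm (complex_of_real (0 + h) * H (0 + h) - complex_of_real 0 * H 0 - h *\<^sub>R H 0) / norm h) \<midarrow>0\<rightarrow> 0"
  proof (rule Lim_transform_eventually)
    have "norm (complex_of_real h * H h - h *\<^sub>R H 0) = norm h * norm (H h - H 0)" for h
      by (simp add: scaleR_conv_of_real norm_mult flip: right_diff_distrib)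
    thus "\<forall>\<^sub>F h in at 0. norm (H h - H 0) =
        norm (complex_of_real (0 + h) * H (0 + h) - complex_of_real 0 * H 0 - h *\<^sub>R H 0) / norm h"
      by (auto simp: eventually_at intro!: exI[of _ 1])
  qed
qed

text \<open>Differentiating \<open>r\<^sub>i F(r)\<close> in \<open>r\<^sub>i\<close> at \<open>r\<^sub>i = 0\<close> only uses continuity of \<open>F\<close>; the variables of
  the derivatives already taken are set to zero.\<close>

lemma iterated_partial_deriv:
  fixes \<phi> g :: "real ^ 'n::finite \<Rightarrow> complex"
  assumes R: "R > 0" and g: "continuous_on (polydisc R) g"
    and eq: "\<And>r. r \<in> polydisc R \<Longrightarrow> \<phi> r = (\<Prod>i\<in>UNIV. complex_of_real (r $ i)) * g r"
  shows "distinct l \<Longrightarrow> r \<in> polydisc R \<Longrightarrow> (\<And>i. i \<in> set l \<Longrightarrow> r $ i = 0) \<Longrightarrow>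
    foldr partial_deriv l \<phi> r = (\<Prod>i\<in>UNIV - set l. complex_of_real (r $ i)) * g r"
proof (induction l arbitrary: r)
  case Nil
  thus ?case using eq by simp
next
  case (Cons k l)
  let ?F = "foldr partial_deriv l \<phi>"
  let ?e = "\<lambda>t. r + t *\<^sub>R axis k (1::real)"
  have rk: "r $ k = 0" using Cons.prems by simp
  have comp: "?e t $ i = (if i = k then t else r $ i)" for t i
    using rk by (simp add: axis_def)
  define P where "P = (\<Prod>i\<in>UNIV - set (k # l). complex_of_real (r $ i))"
  define H where "H = (\<lambda>t. P * g (?e t))"
  have F: "?F (?e t) = complex_of_real t * H t" if t: "t \<in> {-R<..<R}" for t
  proof -
    have "?e t \<in> polydisc R" using Cons.prems(2) t unfolding polydisc_def mem_Collect_eq comp by auto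
    moreover have "?e t $ i = 0" if "i \<in> set l" for i
      using Cons.prems that by (subst comp) auto
    ultimately have "?F (?e t) = (\<Prod>i\<in>UNIV - set l. complex_of_real (?e t $ i)) * g (?e t)"
      using Cons.prems(1) by (intro Cons.IH) auto
    also have "UNIV - set l = insert k (UNIV - set (k # l))" using Cons.prems(1) by auto
    also have "(\<Prod>i\<in>insert k (UNIV - set (k # l)). complex_of_real (?e t $ i)) =
        complex_of_real (?e t $ k) * (\<Prod>i\<in>UNIV - set (k # l). complex_of_real (?e t $ i))"
      by (rule prod.insert) auto
    also have "(\<Prod>i\<in>UNIV - set (k # l). complex_of_real (?e t $ i)) = P"
      unfolding P_def comp by (rule prod.cong) auto
    finally show ?thesis unfolding comp H_def by (simp add: mult.assoc)
  qed
  have "isCont g r"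
    using g Cons.prems(2) open_polydisc continuous_on_eq_continuous_at by blast
  moreover have "((\<lambda>t. ?e t) \<longlongrightarrow> ?e 0) (at 0)" by (intro tendsto_intros)
  ultimately have "(H \<longlongrightarrow> H 0) (at 0)"
    unfolding H_def by (intro tendsto_mult tendsto_const isCont_tendsto_compose[of _ g]) auto
  hence "((\<lambda>t. complex_of_real t * H t) has_vector_derivative H 0) (at 0)"
    by (rule has_vector_derivative_times_id)
  hence "((\<lambda>t. ?F (?e t)) has_vector_derivative H 0) (at 0)"
    by (rule has_vector_derivative_transform_within_open[where S = "{-R<..<R}"]) (use R F in auto)
  hence "partial_deriv k ?F r = H 0" unfolding partial_deriv_def by (rule vector_derivative_at)
  thus ?case by (simp add: H_def P_def)
qed

section \<open>The power series of the averaged norm\<close>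

lemma monomial_add: "monomial (\<lambda>i. m i + m' i) r = monomial m r * monomial m' r"
  by (simp add: monomial_def power_add prod.distrib)

lemma monomial_single: "monomial (\<lambda>i. if i = k then 1 else 0) r = complex_of_real (r $ k)"
proof -
  have "monomial (\<lambda>i. if i = k then 1 else 0) r = (\<Prod>i\<in>UNIV. if i = k then complex_of_real (r $ k) else 1)"
    unfolding monomial_def by (rule prod.cong) auto
  thus ?thesis by simp
qed

locale twisted_family_on_torus = twisted_family M \<tau> n x \<epsilon> a
  for M :: "('h::complex_hilbert \<Rightarrow>\<^sub>L 'h) set" and \<tau> n x \<epsilon> and a :: "nat \<Rightarrow> complex ^ 'm ^ 'm::finite" +
  fixes coord :: "nat \<Rightarrow> 'n::finite" and p :: real
  assumes coord: "bij_betw coord {1..n} UNIV" and p_pos: "p > 0"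
begin

definition degree_of :: "symbol list \<Rightarrow> 'n \<Rightarrow> nat" where
  "degree_of l i = (\<Sum>v\<leftarrow>l. if coord (fst v) = i then 1 else 0)"

definition exponent_sign :: "exponent \<Rightarrow> int" where
  "exponent_sign e = (if e = One then 1 else -1)"

text \<open>The word \<open>l\<close> contributes \<open>\<Prod> r\<^sub>i ^ degree_of l i\<close> times the character of the torus with frequencies
  \<open>phase_of l i\<close>; averaging against the conjugate phases selects the frequencies \<open>target_phase\<close>.\<close>

definition phase_of :: "symbol list \<Rightarrow> 'n \<Rightarrow> int" where
  "phase_of l i = (\<Sum>v\<leftarrow>l. if coord (fst v) = i then exponent_sign (snd v) else 0)"

definition target_phase :: "'n \<Rightarrow> int" where
  "target_phase i = exponent_sign (\<epsilon> (inv_into {1..n} coord i))"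

definition word_coeff :: "symbol list list \<Rightarrow> complex" where
  "word_coeff w = (if phase_of (concat w) = target_phase
     then complex_of_real (p/2 gchoose length w) * word_trace (concat w) else 0)"

text \<open>Only words in which every variable occurs exactly once contribute to the coefficient of
  \<open>r\<^sub>1 \<cdots> r\<^sub>n\<close>.\<close>

abbreviation multilinear_coeff :: "symbol list list \<Rightarrow> complex" where
  "multilinear_coeff w \<equiv> if degree_of (concat w) = (\<lambda>_. 1) then word_coeff w else 0"

definition torus_point :: "real ^ 'n \<Rightarrow> real ^ 'n \<Rightarrow> nat \<Rightarrow> complex" where
  "torus_point r \<theta> j = complex_of_real (r $ coord j) * exp (\<i> * complex_of_real (\<theta> $ coord j))"

abbreviation conjugate_phases :: "real ^ 'n \<Rightarrow> complex" where
  "conjugate_phases \<theta> \<equiv> \<Prod>j=1..n. epow cnj (exp (- \<i> * complex_of_real (\<theta> $ coord j))) (\<epsilon> j)"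

definition circle_average :: "real ^ 'n \<Rightarrow> complex" where
  "circle_average r = complex_of_real (1 / (2 * pi) ^ n) * integral (cbox 0 (\<chi> i. 2 * pi)) (\<lambda>\<theta>.
     complex_of_real (Lp_norm \<tau> p (id_blinfun + perturbation (torus_point r \<theta>)) powr p) *
     conjugate_phases \<theta>)"

lemma CARD_n: "CARD('n) = n"
  using bij_betw_same_card[OF coord] by simp

lemma prod_coord: "(\<Prod>j=1..n. f (coord j)) = (\<Prod>i\<in>UNIV. f i)"
  using prod.reindex_bij_betw[OF coord] .

lemma total_degree_of: "total_degree (degree_of l) = length l"
proof (induction l)
  case (Cons v l)
  have "degree_of (v # l) = (\<lambda>i. (if coord (fst v) = i then 1 else 0) + degree_of l i)"
    by (simp add: degree_of_def fun_eq_iff)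
  thus ?case using Cons by (simp add: total_degree_def sum.distrib)
qed (simp add: total_degree_def degree_of_def)

lemma abs_phase_le_degree: "\<bar>phase_of l i\<bar> \<le> int (degree_of l i)"
  by (induction l) (auto simp: phase_of_def degree_of_def exponent_sign_def)

text \<open>The frequency of each variable is \<open>1\<close> or \<open>-1\<close> in a word that survives, hence not \<open>0\<close>.\<close>

lemma degree_of_pos:
  assumes "word_coeff w \<noteq> 0"
  shows "degree_of (concat w) i \<ge> 1"
proof -
  have "\<bar>phase_of (concat w) i\<bar> = 1"
    using assms by (auto simp: word_coeff_def target_phase_def exponent_sign_def split: if_splits)
  thus ?thesis using abs_phase_le_degree[of "concat w" i] by linarith
qed

lemma prod_sym_val:
  "prod_list (map (sym_val (torus_point r \<theta>)) l) =
    monomial (degree_of l) r * torus_character (phase_of l) \<theta>"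
proof (induction l)
  case Nil
  show ?case by (simp add: degree_of_def phase_of_def monomial_def)
next
  case (Cons v l)
  define k where "k = coord (fst v)"
  define s where "s = exponent_sign (snd v)"
  have val: "sym_val (torus_point r \<theta>) v = complex_of_real (r $ k) * exp (\<i> * of_int s * complex_of_real (\<theta> $ k))"
    by (cases "snd v") (auto simp: sym_val_def torus_point_def k_def s_def exponent_sign_def exp_cnj)
  have deg: "degree_of (v # l) = (\<lambda>i. (if i = k then 1 else 0) + degree_of l i)"
    by (auto simp: degree_of_def fun_eq_iff k_def)
  have "torus_character (phase_of (v # l)) \<theta> =
      (\<Prod>i\<in>UNIV. (if i = k then exp (\<i> * of_int s * complex_of_real (\<theta> $ k)) else 1) *
        exp (\<i> * of_int (phase_of l i) * complex_of_real (\<theta> $ i)))"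
    by (intro prod.cong refl) (auto simp: phase_of_def k_def s_def algebra_simps simp flip: exp_add)
  also have "\<dots> = exp (\<i> * of_int s * complex_of_real (\<theta> $ k)) *
      torus_character (phase_of l) \<theta>"
    by (simp add: prod.distrib)
  finally show ?case using Cons by (simp add: val deg monomial_add monomial_single)
qed

lemma prod_conjugate_phases:
  "conjugate_phases \<theta> =
    torus_character (\<lambda>i. - target_phase i) \<theta>"
proof -
  have "epow cnj (exp (- \<i> * complex_of_real (\<theta> $ coord j))) (\<epsilon> j) =
      exp (\<i> * of_int (- target_phase (coord j)) * complex_of_real (\<theta> $ coord j))" if j: "j \<in> {1..n}" for j
  proof -
    have "inv_into {1..n} coord (coord j) = j"
      using coord j by (simp add: bij_betw_def inv_into_f_f)
    thus ?thesis by (cases "\<epsilon> j") (auto simp: target_phase_def exponent_sign_def exp_cnj)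
  qed
  hence "conjugate_phases \<theta> =
      (\<Prod>j=1..n. exp (\<i> * of_int (- target_phase (coord j)) * complex_of_real (\<theta> $ coord j)))"
    by (intro prod.cong refl)
  thus ?thesis by (simp only: prod_coord[of "\<lambda>i. exp (\<i> * of_int (- target_phase i) * complex_of_real (\<theta> $ i))"])
qed

lemma word_integral:
  "((\<lambda>\<theta>. prod_list (map (sym_val (torus_point r \<theta>)) l) *
      conjugate_phases \<theta>) has_integral
    monomial (degree_of l) r * (if phase_of l = target_phase then complex_of_real ((2 * pi) ^ n) else 0))
    (cbox 0 (\<chi> i. 2 * pi))"
proof -
  have "((\<lambda>\<theta>. monomial (degree_of l) r *
      torus_character (\<lambda>i. phase_of l i - target_phase i) \<theta>) has_integral
    monomial (degree_of l) r * (if \<forall>i. phase_of l i - target_phase i = 0 then complex_of_real ((2 * pi) ^ CARD('n)) else 0))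
    (cbox 0 (\<chi> i. 2 * pi))"
    by (intro has_integral_mult_right has_integral_torus)
  moreover have "torus_character (phase_of l) \<theta> * torus_character (\<lambda>i. - target_phase i) \<theta> =
      torus_character (\<lambda>i. phase_of l i - target_phase i) \<theta>" for \<theta> :: "real ^ 'n"
    by (simp flip: prod.distrib exp_add) (simp add: algebra_simps)
  ultimately show ?thesis
    unfolding prod_sym_val prod_conjugate_phases mult.assoc CARD_n by (simp only: right_minus_eq fun_eq_iff)
qed

sublocale power_series_family "words n" R0 for R0
  by unfold_locales (rule finite_words_of_length[OF finite_blocks])

lemma sum_word_coeff_le:
  assumes "0 \<le> R"
  shows "(\<Sum>w\<in>words n d. cmod (word_coeff w) * R ^ length (concat w))
    \<le> 2 * (\<bar>p/2 gchoose d\<bar> * majorant R ^ d)"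
proof -
  have "(\<Sum>w\<in>words n d. cmod (word_coeff w) * R ^ length (concat w)) \<le>
      (\<Sum>w\<in>words n d. \<bar>p/2 gchoose d\<bar> * (cmod (word_trace (concat w)) * R ^ length (concat w)))"
  proof (intro sum_mono)
    fix w assume "w \<in> words n d"
    hence "length w = d" by (simp add: words_of_length_def)
    hence "cmod (word_coeff w) \<le> \<bar>p/2 gchoose d\<bar> * cmod (word_trace (concat w))"
      by (auto simp: word_coeff_def norm_mult)
    hence "cmod (word_coeff w) * R ^ length (concat w) \<le> \<bar>p/2 gchoose d\<bar> * cmod (word_trace (concat w)) * R ^ length (concat w)"
      using assms by (intro mult_right_mono) auto
    thus "cmod (word_coeff w) * R ^ length (concat w) \<le> \<bar>p/2 gchoose d\<bar> * (cmod (word_trace (concat w)) * R ^ length (concat w))"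
      by (simp add: mult.assoc)
  qed
  also have "\<dots> \<le> \<bar>p/2 gchoose d\<bar> * (2 * majorant R ^ d)"
    unfolding sum_distrib_left[symmetric] by (intro mult_left_mono sum_words_majorant assms) simp
  finally show ?thesis by simp
qed

context
  fixes R0 :: real
  assumes R0: "R0 > 0" "majorant R0 < 1"
begin

lemma abs_convergent_word_coeff: "abs_convergent R0 word_coeff (\<lambda>w. degree_of (concat w))"
  unfolding abs_convergent_def total_degree_of
proof (intro allI impI)
  fix R assume R: "0 \<le> R" "R < R0"
  have "majorant R < 1" using majorant_mono[of R R0] R R0 by linarith
  hence summ: "summable (\<lambda>d. 2 * (\<bar>p/2 gchoose d\<bar> * majorant R ^ d))"
    using R by (intro summable_mult summable_gbinomial majorant_nonneg)
  show "summable (\<lambda>d. \<Sum>w\<in>words n d. cmod (word_coeff w) * R ^ length (concat w))"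
    by (rule summable_comparison_test[OF _ summ], intro exI allI impI)
       (use sum_word_coeff_le[OF R(1)] R in \<open>simp add: sum_nonneg\<close>)
qed

text \<open>The expansion into words converges uniformly on the torus, so it may be integrated term by term.\<close>

lemma circle_average_eq_series:
  assumes r: "r \<in> polydisc R0"
  shows "circle_average r = series word_coeff (\<lambda>w. degree_of (concat w)) r"
proof -
  let ?box = "cbox 0 (\<chi> i. 2 * pi) :: (real ^ 'n) set"
  let ?W = "words n"
  define weight where "weight \<theta> = conjugate_phases \<theta>" for \<theta> :: "real ^ 'n"
  define G where "G d \<theta> = (\<Sum>w\<in>?W d. complex_of_real (p/2 gchoose d) * word_trace (concat w) *
      prod_list (map (sym_val (torus_point r \<theta>)) (concat w)))" for d \<theta>
  define N where "N \<theta> = complex_of_real (Lp_norm \<tau> p (id_blinfun + perturbation (torus_point r \<theta>)) powr p)" for \<theta>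
  have tp: "cmod (torus_point r \<theta> j) \<le> R0" for \<theta> j
    using r by (simp add: torus_point_def polydisc_def norm_mult less_imp_le)
  have sums: "(\<lambda>d. G d \<theta>) sums N \<theta>" for \<theta>
    unfolding G_def N_def by (rule Lp_norm_sums[OF p_pos tp R0(2)])
  have nw: "cmod (weight \<theta>) = 1" for \<theta>
    unfolding weight_def prod_conjugate_phases by (simp add: norm_mult flip: prod_norm)
  have nm: "cmod (prod_list (map (sym_val (torus_point r \<theta>)) l)) \<le> R0 ^ length l" for l \<theta>
    using cmod_monomial_le[OF r, of "degree_of l"] unfolding prod_sym_val norm_mult
    by (simp add: total_degree_of flip: prod_norm)
  have Gbound: "cmod (G d \<theta>) \<le> 2 * (\<bar>p/2 gchoose d\<bar> * majorant R0 ^ d)" for d \<theta>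
  proof -
    have "cmod (G d \<theta>) \<le> (\<Sum>w\<in>?W d. \<bar>p/2 gchoose d\<bar> * (cmod (word_trace (concat w)) * R0 ^ length (concat w)))"
      unfolding G_def
    proof (intro sum_norm_le)
      fix w
      have "cmod (word_trace (concat w)) * cmod (prod_list (map (sym_val (torus_point r \<theta>)) (concat w))) \<le>
          cmod (word_trace (concat w)) * R0 ^ length (concat w)"
        by (intro mult_left_mono nm) simp
      thus "cmod (complex_of_real (p/2 gchoose d) * word_trace (concat w) * prod_list (map (sym_val (torus_point r \<theta>)) (concat w)))
        \<le> \<bar>p/2 gchoose d\<bar> * (cmod (word_trace (concat w)) * R0 ^ length (concat w))"
        unfolding norm_mult norm_of_real mult.assoc by (rule mult_left_mono) simp
    qed
    also have "\<dots> \<le> \<bar>p/2 gchoose d\<bar> * (2 * majorant R0 ^ d)"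
      unfolding sum_distrib_left[symmetric] using R0 by (intro mult_left_mono sum_words_majorant) auto
    finally show ?thesis by simp
  qed
  have "uniform_limit ?box (\<lambda>K \<theta>. \<Sum>d<K. G d \<theta> * weight \<theta>) (\<lambda>\<theta>. \<Sum>d. G d \<theta> * weight \<theta>) sequentially"
    by (rule Weierstrass_m_test[where M = "\<lambda>d. 2 * (\<bar>p/2 gchoose d\<bar> * majorant R0 ^ d)"])
       (use R0 Gbound in \<open>auto simp: norm_mult nw intro!: summable_mult summable_gbinomial majorant_nonneg\<close>)
  moreover have "(\<Sum>d. G d \<theta> * weight \<theta>) = N \<theta> * weight \<theta>" for \<theta>
    using sums_mult2[OF sums] by (simp add: sums_iff)
  ultimately have ul: "uniform_limit ?box (\<lambda>K \<theta>. \<Sum>d<K. G d \<theta> * weight \<theta>) (\<lambda>\<theta>. N \<theta> * weight \<theta>) sequentially"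
    by simp
  have cont: "continuous_on ?box (\<lambda>\<theta>. \<Sum>d<K. G d \<theta> * weight \<theta>)" for K
    unfolding G_def weight_def prod_sym_val prod_conjugate_phases by (intro continuous_intros)
  have hi: "((\<lambda>\<theta>. \<Sum>d<K. G d \<theta> * weight \<theta>) has_integral
      (\<Sum>d<K. \<Sum>w\<in>?W d. complex_of_real ((2 * pi) ^ n) * (word_coeff w * monomial (degree_of (concat w)) r))) ?box" for K
  proof (intro has_integral_sum finite_lessThan)
    fix d
    have "((\<lambda>\<theta>. \<Sum>w\<in>?W d. complex_of_real (p/2 gchoose d) * word_trace (concat w) *
        (prod_list (map (sym_val (torus_point r \<theta>)) (concat w)) * weight \<theta>)) has_integral
        (\<Sum>w\<in>?W d. complex_of_real (p/2 gchoose d) * word_trace (concat w) * (monomial (degree_of (concat w)) r *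
        (if phase_of (concat w) = target_phase then complex_of_real ((2 * pi) ^ n) else 0)))) ?box"
      unfolding weight_def
      by (intro has_integral_sum finite_words_of_length finite_blocks has_integral_mult_right word_integral)
    also have "(\<lambda>\<theta>. \<Sum>w\<in>?W d. complex_of_real (p/2 gchoose d) * word_trace (concat w) *
        (prod_list (map (sym_val (torus_point r \<theta>)) (concat w)) * weight \<theta>)) = (\<lambda>\<theta>. G d \<theta> * weight \<theta>)"
      by (simp add: G_def fun_eq_iff sum_distrib_right mult.assoc)
    also have "(\<Sum>w\<in>?W d. complex_of_real (p/2 gchoose d) * word_trace (concat w) * (monomial (degree_of (concat w)) r *
        (if phase_of (concat w) = target_phase then complex_of_real ((2 * pi) ^ n) else 0))) =
        (\<Sum>w\<in>?W d. complex_of_real ((2 * pi) ^ n) * (word_coeff w * monomial (degree_of (concat w)) r))"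
      by (rule sum.cong) (auto simp: words_of_length_def word_coeff_def)
    finally show "((\<lambda>\<theta>. G d \<theta> * weight \<theta>) has_integral
        (\<Sum>w\<in>?W d. complex_of_real ((2 * pi) ^ n) * (word_coeff w * monomial (degree_of (concat w)) r))) ?box" .
  qed
  obtain I J where IJ: "\<And>K. ((\<lambda>\<theta>. \<Sum>d<K. G d \<theta> * weight \<theta>) has_integral I K) ?box"
    "((\<lambda>\<theta>. N \<theta> * weight \<theta>) has_integral J) ?box" "I \<longlonglongrightarrow> J"
    by (rule uniform_limit_integral_cbox[OF ul cont sequentially_bot]) blast
  have I: "I K = complex_of_real ((2 * pi) ^ n) * (\<Sum>d<K. \<Sum>w\<in>?W d. word_coeff w * monomial (degree_of (concat w)) r)" for K
    using has_integral_unique[OF IJ(1) hi] by (simp add: sum_distrib_left)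
  have "I \<longlonglongrightarrow> complex_of_real ((2 * pi) ^ n) * series word_coeff (\<lambda>w. degree_of (concat w)) r"
    unfolding I using series_sums[OF abs_convergent_word_coeff r]
    by (intro tendsto_mult tendsto_const) (simp add: sums_def)
  hence "J = complex_of_real ((2 * pi) ^ n) * series word_coeff (\<lambda>w. degree_of (concat w)) r"
    using IJ(3) LIMSEQ_unique by blast
  moreover have "integral ?box (\<lambda>\<theta>. N \<theta> * weight \<theta>) = J" using IJ(2) by (rule integral_unique)
  ultimately show ?thesis unfolding circle_average_def N_def[symmetric] weight_def[symmetric]
    by (simp add: divide_simps)
qed

text \<open>Every word that survives the averaging has positive degree in each variable, so \<open>\<Prod> r\<^sub>i\<close> divides
  the power series. The quotient converges on the same polydisc, since dividing a monomial by
  \<open>\<Prod> r\<^sub>i\<close> costs a factor \<open>1 / R\<^sub>1 ^ n\<close> for a slightly larger radius \<open>R\<^sub>1\<close>.\<close>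

lemma abs_convergent_quotient: "abs_convergent R0 word_coeff (\<lambda>w i. degree_of (concat w) i - 1)"
proof (rule abs_convergent_comparison[OF abs_convergent_word_coeff])
  fix R assume R: "0 \<le> R" "R < R0"
  obtain R1 where R1: "R < R1" "R1 < R0" using dense R by blast
  have bound: "cmod (word_coeff w) * R ^ total_degree (\<lambda>i. degree_of (concat w) i - 1) \<le>
      1 / R1 ^ n * (cmod (word_coeff w) * R1 ^ total_degree (degree_of (concat w)))" for w
  proof (cases "word_coeff w = 0")
    case False
    have "total_degree (degree_of (concat w)) = (\<Sum>i\<in>UNIV. (degree_of (concat w) i - 1) + 1)"
      unfolding total_degree_def
    proof (rule sum.cong[OF refl])
      fix i show "degree_of (concat w) i = (degree_of (concat w) i - 1) + 1"
        using degree_of_pos[OF False, of i] by linarith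
    qed
    also have "\<dots> = total_degree (\<lambda>i. degree_of (concat w) i - 1) + n"
      unfolding sum.distrib total_degree_def by (simp add: CARD_n)
    finally have deg: "total_degree (degree_of (concat w)) = total_degree (\<lambda>i. degree_of (concat w) i - 1) + n" .
    have "R ^ total_degree (\<lambda>i. degree_of (concat w) i - 1) \<le> R1 ^ total_degree (\<lambda>i. degree_of (concat w) i - 1)"
      using R R1 by (intro power_mono) auto
    also have "\<dots> = 1 / R1 ^ n * R1 ^ total_degree (degree_of (concat w))"
      using R R1 by (simp add: deg power_add)
    finally have "cmod (word_coeff w) * R ^ total_degree (\<lambda>i. degree_of (concat w) i - 1) \<le>
        cmod (word_coeff w) * (1 / R1 ^ n * R1 ^ total_degree (degree_of (concat w)))"
      by (intro mult_left_mono) auto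
    thus ?thesis by (simp add: mult_ac)
  qed simp
  show "\<exists>R' C. 0 \<le> R' \<and> R' < R0 \<and> (\<forall>w. cmod (word_coeff w) *
      R ^ total_degree (\<lambda>i. degree_of (concat w) i - 1) \<le>
      C * (cmod (word_coeff w) * R' ^ total_degree (degree_of (concat w))))"
    using bound R R1 by (intro exI[of _ R1] exI[of _ "1 / R1 ^ n"]) auto
qed

definition quotient_series :: "real ^ 'n \<Rightarrow> complex" where
  "quotient_series = series word_coeff (\<lambda>w i. degree_of (concat w) i - 1)"

lemma circle_average_eq_quotient:
  assumes r: "r \<in> polydisc R0"
  shows "circle_average r = (\<Prod>i\<in>UNIV. complex_of_real (r $ i)) * quotient_series r"
proof -
  have eq: "word_coeff w * monomial (degree_of (concat w)) r =
      (\<Prod>i\<in>UNIV. complex_of_real (r $ i)) * (word_coeff w * monomial (\<lambda>i. degree_of (concat w) i - 1) r)" for w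
  proof (cases "word_coeff w = 0")
    case False
    have "degree_of (concat w) i = 1 + (degree_of (concat w) i - 1)" for i
      using degree_of_pos[OF False, of i] by linarith
    hence "degree_of (concat w) = (\<lambda>i. 1 + (degree_of (concat w) i - 1))" by (rule ext)
    hence "monomial (degree_of (concat w)) r = monomial (\<lambda>i. 1 + (degree_of (concat w) i - 1)) r"
      by (rule arg_cong)
    also have "\<dots> = (\<Prod>i\<in>UNIV. complex_of_real (r $ i)) * monomial (\<lambda>i. degree_of (concat w) i - 1) r"
      unfolding monomial_add by (simp add: monomial_def)
    finally show ?thesis by simp
  qed simp
  have "(\<lambda>d. (\<Prod>i\<in>UNIV. complex_of_real (r $ i)) * (\<Sum>w\<in>words n d.
     word_coeff w * monomial (\<lambda>i. degree_of (concat w) i - 1) r)) sums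
     ((\<Prod>i\<in>UNIV. complex_of_real (r $ i)) * quotient_series r)"
    unfolding quotient_series_def by (intro sums_mult series_sums[OF abs_convergent_quotient r])
  thus ?thesis
    unfolding circle_average_eq_series[OF r] series_def eq sum_distrib_left[symmetric]
    by (intro sums_unique[symmetric])
qed

lemma smooth_circle_average: "smooth_on (polydisc R0) circle_average"
  unfolding smooth_on_def
  by (intro allI times_differentiable_on_cong[OF open_polydisc _ times_differentiable_on_series[OF abs_convergent_word_coeff]])
     (simp add: circle_average_eq_series)

lemma continuous_quotient: "continuous_on (polydisc R0) quotient_series"
  using times_differentiable_on_series[OF abs_convergent_quotient, of 0] by (simp add: quotient_series_def)

lemma iterated_deriv_circle_average:
  "foldr (\<lambda>j. partial_deriv (coord j)) [1..<n+1] circle_average 0 = quotient_series 0"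
proof -
  have "foldr partial_deriv (map coord [1..<n+1]) circle_average 0 =
      (\<Prod>i\<in>UNIV - set (map coord [1..<n+1]). complex_of_real (0 $ i)) * quotient_series 0"
  proof (rule iterated_partial_deriv[OF R0(1) continuous_quotient circle_average_eq_quotient])
    show "distinct (map coord [1..<n+1])"
      using coord by (auto simp: distinct_map bij_betw_def atLeastLessThanSuc_atLeastAtMost simp del: upt_Suc)
    show "0 \<in> polydisc R0" using R0 by (simp add: polydisc_def)
  qed simp_all
  moreover have "set (map coord [1..<n+1]) = UNIV"
    using coord by (simp add: bij_betw_def atLeastLessThanSuc_atLeastAtMost del: upt_Suc)
  ultimately show ?thesis by (simp add: foldr_map o_def del: upt_Suc)
qed

lemma circle_average_quotient_limit:
  "((\<lambda>r. circle_average r / complex_of_real (\<Prod>j=1..n. r $ coord j)) \<longlongrightarrow> quotient_series 0)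
    (at 0 within {r. \<forall>i. r $ i \<noteq> 0})"
proof -
  have 0: "0 \<in> polydisc R0" using R0 by (simp add: polydisc_def)
  have "isCont quotient_series 0"
    using continuous_quotient 0 open_polydisc continuous_on_eq_continuous_at by blast
  hence "(quotient_series \<longlongrightarrow> quotient_series 0) (at 0 within {r. \<forall>i. r $ i \<noteq> 0})"
    by (rule tendsto_within_subset[OF isContD subset_UNIV])
  thus ?thesis
  proof (rule Lim_transform_eventually)
    have "\<forall>\<^sub>F r in at 0 within {r. \<forall>i. r $ i \<noteq> 0}. r \<in> polydisc R0 \<and> r \<in> {r. \<forall>i. r $ i \<noteq> 0}"
      using 0 open_polydisc[of R0] by (auto simp: eventually_at_topological)
    thus "\<forall>\<^sub>F r in at 0 within {r. \<forall>i. r $ i \<noteq> 0}. quotient_series r =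
        circle_average r / complex_of_real (\<Prod>j=1..n. r $ coord j)"
    proof eventually_elim
      case (elim r)
      thus ?case
        by (simp only: prod_coord[of "\<lambda>i. r $ i"] of_real_prod) (simp add: circle_average_eq_quotient prod_zero_iff)
    qed
  qed
qed

lemma quotient_series_0:
  "quotient_series 0 = (\<Sum>d\<le>n. \<Sum>w\<in>words n d. multilinear_coeff w)"
proof -
  have termwise: "word_coeff w * monomial (\<lambda>i. degree_of (concat w) i - 1) 0 =
      multilinear_coeff w" for w
  proof (cases "word_coeff w = 0")
    case False
    have "monomial (\<lambda>i. degree_of (concat w) i - 1) 0 = (if \<forall>i. degree_of (concat w) i - 1 = 0 then 1 else 0)"
      by (auto simp: monomial_def not_le)
    also have "(\<forall>i. degree_of (concat w) i - 1 = 0) \<longleftrightarrow> degree_of (concat w) = (\<lambda>_. 1)"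
      using degree_of_pos[OF False] by (auto simp: fun_eq_iff le_Suc_eq intro: antisym)
    finally show ?thesis by simp
  qed simp
  have "quotient_series 0 = (\<Sum>d. \<Sum>w\<in>words n d. multilinear_coeff w)"
    unfolding quotient_series_def series_def termwise ..
  also have "\<dots> = (\<Sum>d\<le>n. \<Sum>w\<in>words n d. multilinear_coeff w)"
  proof (rule suminf_finite)
    fix d assume d: "d \<notin> {..n}"
    show "(\<Sum>w\<in>words n d. multilinear_coeff w) = 0"
    proof (intro sum.neutral ballI)
      fix w assume w: "w \<in> words n d"
      have "degree_of (concat w) \<noteq> (\<lambda>_. 1)"
      proof
        assume "degree_of (concat w) = (\<lambda>_. 1)"
        hence "length (concat w) = n" using total_degree_of[of "concat w"] by (simp add: total_degree_def CARD_n)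
        thus False
          using length_le_length_concat[of w n] w d by (simp add: words_of_length_def del: length_concat)
      qed
      thus "multilinear_coeff w = 0" by simp
    qed
  qed simp
  finally show ?thesis .
qed

end

end

section \<open>Counting factorisations into blocks\<close>

text \<open>Pairs of neighbours in the list that can form a block of two symbols; the last and the first
  entry are not neighbours.\<close>

fun star_one_pairs :: "(nat \<Rightarrow> exponent) \<Rightarrow> nat list \<Rightarrow> nat" where
  "star_one_pairs \<epsilon> (i # j # xs) = (if \<epsilon> i = Star \<and> \<epsilon> j = One then 1 else 0) + star_one_pairs \<epsilon> (j # xs)"
| "star_one_pairs \<epsilon> _ = 0"

definition factorisations :: "nat \<Rightarrow> (nat \<Rightarrow> exponent) \<Rightarrow> nat list \<Rightarrow> symbol list list set" where
  "factorisations n \<epsilon> xs = {w. set w \<subseteq> blocks n \<and> concat w = map (\<lambda>j. (j, \<epsilon> j)) xs}"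

lemma blocks_cases:
  "b \<in> blocks n \<Longrightarrow> (\<exists>j e. b = [(j, e)]) \<or> (\<exists>i j. b = [(i, Star), (j, One)])"
  by (auto simp: blocks_def)

lemma single_block: "j \<in> {1..n} \<Longrightarrow> [(j, e)] \<in> blocks n"
  by (cases e) (auto simp: blocks_def)

lemma double_block: "i \<in> {1..n} \<Longrightarrow> j \<in> {1..n} \<Longrightarrow> [(i, Star), (j, One)] \<in> blocks n"
  by (auto simp: blocks_def)

lemma factorisations_Nil: "factorisations n \<epsilon> [] = {[]}"
proof -
  have "w = []" if "set w \<subseteq> blocks n" "concat w = []" for w
    using that by (cases w) (auto dest!: blocks_cases)
  thus ?thesis by (auto simp: factorisations_def)
qed

lemma factorisations_single:
  assumes "i \<in> {1..n}"
  shows "factorisations n \<epsilon> [i] = {[[(i, \<epsilon> i)]]}"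
proof -
  have "w = [[(i, \<epsilon> i)]]" if w: "set w \<subseteq> blocks n" "concat w = [(i, \<epsilon> i)]" for w
  proof (cases w)
    case (Cons b w')
    have "b \<in> blocks n" using w Cons by simp
    hence b: "b = [(i, \<epsilon> i)]" "concat w' = []" using blocks_cases[of b n] w(2) Cons by auto
    moreover have "w' \<in> factorisations n \<epsilon> []" using w(1) Cons b by (simp add: factorisations_def)
    ultimately show ?thesis using Cons by (simp add: factorisations_Nil)
  qed (use w in simp)
  thus ?thesis using single_block[OF assms] by (auto simp: factorisations_def)
qed

lemma factorisations_Cons:
  assumes "i \<in> {1..n}" "j \<in> {1..n}"
  shows "factorisations n \<epsilon> (i # j # xs) = (#) [(i, \<epsilon> i)] ` factorisations n \<epsilon> (j # xs) \<union>
    (if \<epsilon> i = Star \<and> \<epsilon> j = One then (#) [(i, Star), (j, One)] ` factorisations n \<epsilon> xs else {})" (is "?L = ?R")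
proof
  show "?L \<subseteq> ?R"
  proof
    fix w assume "w \<in> ?L"
    hence w: "set w \<subseteq> blocks n" "concat w = (i, \<epsilon> i) # (j, \<epsilon> j) # map (\<lambda>j. (j, \<epsilon> j)) xs"
      by (auto simp: factorisations_def)
    obtain b w' where bw: "w = b # w'" using w(2) by (cases w) auto
    have b: "b \<in> blocks n" using w(1) bw by simp
    show "w \<in> ?R" using blocks_cases[OF b] w bw by (auto simp: factorisations_def)
  qed
  show "?R \<subseteq> ?L"
    using single_block[OF assms(1)] double_block[OF assms] by (auto simp: factorisations_def split: if_splits)
qed

lemma finite_factorisations: "finite (factorisations n \<epsilon> xs)"
proof (rule finite_subset)
  show "factorisations n \<epsilon> xs \<subseteq> {w. set w \<subseteq> blocks n \<and> length w \<le> length xs}"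
  proof
    fix w assume "w \<in> factorisations n \<epsilon> xs"
    thus "w \<in> {w. set w \<subseteq> blocks n \<and> length w \<le> length xs}"
      using length_le_length_concat[of w n] by (simp add: factorisations_def del: length_concat)
  qed
qed (rule finite_lists_length_le[OF finite_blocks])

lemma star_one_pairs_le: "star_one_pairs \<epsilon> xs \<le> length xs - 1"
  by (induction \<epsilon> xs rule: star_one_pairs.induct) auto

text \<open>The pairs that may be merged into one block are disjoint, so a factorisation amounts to an
  arbitrary subset of them; merging \<open>k\<close> pairs leaves \<open>k\<close> blocks fewer.\<close>

lemma sum_factorisations:
  fixes f :: "nat \<Rightarrow> complex"
  shows "set xs \<subseteq> {1..n} \<Longrightarrow> (\<Sum>w\<in>factorisations n \<epsilon> xs. f (length w)) =
    (\<Sum>k\<le>length xs. of_nat (star_one_pairs \<epsilon> xs choose k) * f (length xs - k))"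
proof (induction "length xs" arbitrary: xs f rule: less_induct)
  case less
  consider "xs = []" | i where "xs = [i]" | i j zs where "xs = i # j # zs"
    by (metis list.exhaust)
  thus ?case
  proof cases
    case 1
    thus ?thesis by (simp add: factorisations_Nil)
  next
    case (2 i)
    thus ?thesis using less.prems by (simp add: factorisations_single)
  next
    case (3 i j zs)
    have ij: "i \<in> {1..n}" "j \<in> {1..n}" and zs: "set (j # zs) \<subseteq> {1..n}" "set zs \<subseteq> {1..n}"
      using less.prems 3 by auto
    define m where "m = length zs"
    have IH1: "(\<Sum>w\<in>factorisations n \<epsilon> (j # zs). f (Suc (length w))) =
        (\<Sum>k\<le>Suc m. of_nat (star_one_pairs \<epsilon> (j # zs) choose k) * f (Suc (Suc m - k)))"
      using less.hyps[of "j # zs" "\<lambda>l. f (Suc l)"] zs 3 by (simp add: m_def)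
    have IH2: "(\<Sum>w\<in>factorisations n \<epsilon> zs. f (Suc (length w))) =
        (\<Sum>k\<le>m. of_nat (star_one_pairs \<epsilon> zs choose k) * f (Suc (m - k)))"
      using less.hyps[of zs "\<lambda>l. f (Suc l)"] zs 3 by (simp add: m_def)
    have inj: "inj_on ((#) b) A" for b :: "symbol list" and A by (simp add: inj_on_def)
    have S1: "(\<Sum>w\<in>(#) [(i, \<epsilon> i)] ` factorisations n \<epsilon> (j # zs). f (length w)) =
        (\<Sum>w\<in>factorisations n \<epsilon> (j # zs). f (Suc (length w)))"
      by (simp add: sum.reindex[OF inj])
    have S2: "(\<Sum>w\<in>(#) [(i, Star), (j, One)] ` factorisations n \<epsilon> zs. f (length w)) =
        (\<Sum>w\<in>factorisations n \<epsilon> zs. f (Suc (length w)))"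
      by (simp add: sum.reindex[OF inj])
    show ?thesis
    proof (cases "\<epsilon> i = Star \<and> \<epsilon> j = One")
      case False
      let ?b = "star_one_pairs \<epsilon> (j # zs)"
      have le: "?b \<le> m" using star_one_pairs_le[of \<epsilon> "j # zs"] by (simp add: m_def)
      have "(\<Sum>w\<in>factorisations n \<epsilon> xs. f (length w)) =
          (\<Sum>k\<le>Suc m. of_nat (?b choose k) * f (Suc (Suc m - k)))"
        using False by (auto simp: 3 factorisations_Cons[OF ij] S1 IH1 simp del: sum.atMost_Suc)
      also have "\<dots> = (\<Sum>k\<le>Suc m. of_nat (?b choose k) * f (Suc (Suc m) - k))"
        by (intro sum.cong refl) (simp add: Suc_diff_le)
      also have "\<dots> = (\<Sum>k\<le>Suc (Suc m). of_nat (?b choose k) * f (Suc (Suc m) - k))"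
        using le by (subst (2) sum.atMost_Suc) (simp add: binomial_eq_0)
      finally show ?thesis using False by (auto simp: 3 m_def simp del: sum.atMost_Suc)
    next
      case True
      \<comment> \<open>As \<open>\<epsilon> j\<close> is \<open>One\<close>, the index \<open>j\<close> cannot start a pair, and the two cases add up by Pascal's rule.\<close>
      let ?b = "star_one_pairs \<epsilon> zs"
      have le: "?b \<le> m" using star_one_pairs_le[of \<epsilon> zs] by (simp add: m_def)
      have bj: "star_one_pairs \<epsilon> (j # zs) = ?b" using True by (cases zs) auto
      have disj: "(#) [(i, \<epsilon> i)] ` factorisations n \<epsilon> (j # zs) \<inter>
          (#) [(i, Star), (j, One)] ` factorisations n \<epsilon> zs = {}" by auto
      have "(\<Sum>w\<in>factorisations n \<epsilon> xs. f (length w)) =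
          (\<Sum>k\<le>Suc m. of_nat (?b choose k) * f (Suc (Suc m - k))) +
          (\<Sum>k\<le>m. of_nat (?b choose k) * f (Suc (m - k)))"
        using True finite_factorisations disj
        by (simp add: 3 factorisations_Cons[OF ij] sum.union_disjoint S2 IH2 del: sum.atMost_Suc)
           (simp add: True[THEN conjunct1, symmetric] S1 IH1 bj del: sum.atMost_Suc)
      also have "(\<Sum>k\<le>Suc m. of_nat (?b choose k) * f (Suc (Suc m - k))) =
          (\<Sum>k\<le>Suc m. of_nat (?b choose k) * f (Suc (Suc m) - k))"
        by (intro sum.cong refl) (simp add: Suc_diff_le)
      also have "\<dots> = (\<Sum>k\<le>Suc (Suc m). of_nat (?b choose k) * f (Suc (Suc m) - k))"
        using le by (subst (2) sum.atMost_Suc) (simp add: binomial_eq_0)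
      also have "\<dots> = f (Suc (Suc m)) + (\<Sum>k\<le>Suc m. of_nat (?b choose Suc k) * f (Suc m - k))"
        by (subst sum.atMost_Suc_shift) simp
      also have "(\<Sum>k\<le>m. of_nat (?b choose k) * f (Suc (m - k))) =
          (\<Sum>k\<le>m. of_nat (?b choose k) * f (Suc m - k))"
        by (intro sum.cong refl) (simp add: Suc_diff_le)
      also have "\<dots> = (\<Sum>k\<le>Suc m. of_nat (?b choose k) * f (Suc m - k))"
        using le by (subst sum.atMost_Suc) (simp add: binomial_eq_0)
      also have "f (Suc (Suc m)) + (\<Sum>k\<le>Suc m. of_nat (?b choose Suc k) * f (Suc m - k)) +
          (\<Sum>k\<le>Suc m. of_nat (?b choose k) * f (Suc m - k)) =
          f (Suc (Suc m)) + (\<Sum>k\<le>Suc m. of_nat (Suc ?b choose Suc k) * f (Suc m - k))"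
        by (simp add: algebra_simps sum.distrib del: sum.atMost_Suc)
      also have "\<dots> = (\<Sum>k\<le>Suc (Suc m). of_nat (Suc ?b choose k) * f (Suc (Suc m) - k))"
        by (subst (2) sum.atMost_Suc_shift) simp
      finally show ?thesis using True bj by (simp add: 3 m_def del: sum.atMost_Suc binomial_Suc_Suc)
    qed
  qed
qed

definition cyclic_star_one :: "nat \<Rightarrow> (nat \<Rightarrow> exponent) \<Rightarrow> nat set" where
  "cyclic_star_one n \<epsilon> = {j\<in>{1..n}. \<epsilon> j = Star \<and> \<epsilon> (if j = n then 1 else j + 1) = One}"

lemma star_one_pairs_card:
  "star_one_pairs \<epsilon> xs = card {i. Suc i < length xs \<and> \<epsilon> (xs ! i) = Star \<and> \<epsilon> (xs ! Suc i) = One}"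
proof (induction \<epsilon> xs rule: star_one_pairs.induct)
  case (1 \<epsilon> a b xs)
  let ?A = "{i. Suc i < length (b # xs) \<and> \<epsilon> ((b # xs) ! i) = Star \<and> \<epsilon> ((b # xs) ! Suc i) = One}"
  let ?B = "{i. Suc i < length (a # b # xs) \<and> \<epsilon> ((a # b # xs) ! i) = Star \<and> \<epsilon> ((a # b # xs) ! Suc i) = One}"
  have "?B = (if \<epsilon> a = Star \<and> \<epsilon> b = One then {0} else {}) \<union> Suc ` ?A"
  proof (rule set_eqI)
    fix i show "i \<in> ?B \<longleftrightarrow> i \<in> (if \<epsilon> a = Star \<and> \<epsilon> b = One then {0} else {}) \<union> Suc ` ?A"
      by (cases i) auto
  qed
  moreover have "finite ?A" by (rule finite_subset[of _ "{..<length (b # xs)}"]) auto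
  ultimately show ?case using 1 by (simp add: card_image card_insert_if)
qed simp_all

lemma nth_rotate_upt: "i < n \<Longrightarrow> rotate s [1..<n+1] ! i = (s + i) mod n + 1"
  by (simp add: nth_rotate del: upt_Suc)

text \<open>A rotation is the cycle cut open behind its last entry, which is \<open>(s + n - 1) mod n + 1\<close>. The cut
  destroys the pair that starts at this entry, if there is one.\<close>

lemma star_one_pairs_rotate:
  assumes s: "s < n"
  shows "star_one_pairs \<epsilon> (rotate s [1..<n+1]) = card (cyclic_star_one n \<epsilon> - {(s + n - 1) mod n + 1})"
proof -
  let ?xs = "rotate s [1..<n+1]"
  let ?f = "\<lambda>i. (s + i) mod n + 1"
  have len: "length ?xs = n" by simp
  have nth: "?xs ! i = ?f i" if "i < n" for i
    using that by (rule nth_rotate_upt)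
  have succ: "?f (Suc i) = (if ?f i = n then 1 else ?f i + 1)" for i
    using s mod_Suc[of "s + i" n] by auto
  have bij: "bij_betw ?f {..<n} {1..n}"
  proof (rule bij_betw_imageI)
    show inj: "inj_on ?f {..<n}"
    proof (rule inj_onI)
      fix i j assume "i \<in> {..<n}" "j \<in> {..<n}" "?f i = ?f j"
      hence "[s + i = s + j] (mod n)" "i < n" "j < n" by (auto simp: cong_def)
      thus "i = j" by (simp add: cong_add_lcancel_nat cong_less_modulus_unique_nat)
    qed
    show "?f ` {..<n} = {1..n}"
    proof (rule card_subset_eq)
      show "?f ` {..<n} \<subseteq> {1..n}" using s by (auto simp: Suc_le_eq)
      show "card (?f ` {..<n}) = card {1..n}" by (simp only: card_image[OF inj] card_lessThan card_atLeastAtMost diff_Suc_1)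
    qed simp
  qed
  have "{i. Suc i < length ?xs \<and> \<epsilon> (?xs ! i) = Star \<and> \<epsilon> (?xs ! Suc i) = One} =
      {i. Suc i < n \<and> ?f i \<in> cyclic_star_one n \<epsilon>}"
  proof (rule Collect_cong, unfold len, rule conj_cong[OF refl])
    fix i assume i: "Suc i < n"
    have "?f i \<in> {1..n}" using bij i by (auto simp: bij_betw_def)
    thus "(\<epsilon> (?xs ! i) = Star \<and> \<epsilon> (?xs ! Suc i) = One) \<longleftrightarrow> ?f i \<in> cyclic_star_one n \<epsilon>"
      unfolding nth[OF i] nth[OF Suc_lessD[OF i]] succ cyclic_star_one_def by simp
  qed
  hence "star_one_pairs \<epsilon> ?xs = card {i. Suc i < n \<and> ?f i \<in> cyclic_star_one n \<epsilon>}"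
    by (simp only: star_one_pairs_card)
  also have "\<dots> = card (?f ` {i. Suc i < n \<and> ?f i \<in> cyclic_star_one n \<epsilon>})"
    by (rule card_image[symmetric]) (rule inj_on_subset[OF bij_betw_imp_inj_on[OF bij]], auto)
  also have "?f ` {i. Suc i < n \<and> ?f i \<in> cyclic_star_one n \<epsilon>} = cyclic_star_one n \<epsilon> - {?f (n - 1)}"
  proof (intro set_eqI iffI)
    fix j assume "j \<in> ?f ` {i. Suc i < n \<and> ?f i \<in> cyclic_star_one n \<epsilon>}"
    then obtain i where i: "Suc i < n" "j = ?f i" "j \<in> cyclic_star_one n \<epsilon>" by auto
    have "?f i \<noteq> ?f (n - 1)"
      using inj_onD[OF bij_betw_imp_inj_on[OF bij], of i "n - 1"] i s by fastforce
    thus "j \<in> cyclic_star_one n \<epsilon> - {?f (n - 1)}" using i by simp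
  next
    fix j assume j: "j \<in> cyclic_star_one n \<epsilon> - {?f (n - 1)}"
    hence "j \<in> ?f ` {..<n}" using bij by (auto simp: bij_betw_def cyclic_star_one_def)
    then obtain i where i: "i < n" "j = ?f i" by auto
    hence "i \<noteq> n - 1" using j by auto
    thus "j \<in> ?f ` {i. Suc i < n \<and> ?f i \<in> cyclic_star_one n \<epsilon>}" using i j by auto
  qed
  also have "?f (n - 1) = (s + n - 1) mod n + 1" using s by simp
  finally show ?thesis .
qed

text \<open>Of the \<open>n\<close> cuts, \<open>\<alpha>\<close> destroy a pair, so the weight of \<open>F k\<close> is
  \<open>\<alpha> (\<alpha> - 1 choose k) + (n - \<alpha>) (\<alpha> choose k)\<close>, and \<open>\<alpha> (\<alpha> - 1 choose k) = (\<alpha> - k) (\<alpha> choose k)\<close>.\<close>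

lemma sum_rotations:
  fixes F :: "nat \<Rightarrow> complex" and n :: nat and \<epsilon> :: "nat \<Rightarrow> exponent"
  assumes n: "n \<ge> 1"
  defines "\<alpha> \<equiv> card (cyclic_star_one n \<epsilon>)"
  shows "(\<Sum>s<n. \<Sum>k\<le>n. of_nat (star_one_pairs \<epsilon> (rotate s [1..<n+1]) choose k) * F k) =
    (\<Sum>k=0..\<alpha>. (of_nat n - of_nat k) * F k * of_nat (\<alpha> choose k))"
proof -
  let ?C = "cyclic_star_one n \<epsilon>"
  have C: "?C \<subseteq> {1..n}" by (auto simp: cyclic_star_one_def)
  hence fin: "finite ?C" by (rule finite_subset) simp
  have \<alpha>n: "\<alpha> \<le> n" using card_mono[OF _ C] by (simp add: \<alpha>_def)
  define G where "G \<beta> = (\<Sum>k\<le>n. of_nat (\<beta> choose k) * F k)" for \<beta>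
  have bij: "bij_betw (\<lambda>s. (s + n - 1) mod n + 1) {..<n} {1..n}"
  proof (rule bij_betw_imageI)
    show inj: "inj_on (\<lambda>s. (s + n - 1) mod n + 1) {..<n}"
    proof (rule inj_onI)
      fix i j assume ij: "i \<in> {..<n}" "j \<in> {..<n}" "(i + n - 1) mod n + 1 = (j + n - 1) mod n + 1"
      hence "[i + (n - 1) = j + (n - 1)] (mod n)" "i < n" "j < n" using n by (auto simp: cong_def)
      thus "i = j" using cong_add_rcancel_nat cong_less_modulus_unique_nat by metis
    qed
    show "(\<lambda>s. (s + n - 1) mod n + 1) ` {..<n} = {1..n}"
    proof (rule card_subset_eq)
      show "(\<lambda>s. (s + n - 1) mod n + 1) ` {..<n} \<subseteq> {1..n}" using n by (auto simp: Suc_le_eq)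
      show "card ((\<lambda>s. (s + n - 1) mod n + 1) ` {..<n}) = card {1..n}" by (simp only: card_image[OF inj] card_lessThan card_atLeastAtMost diff_Suc_1)
    qed simp
  qed
  have "(\<Sum>s<n. \<Sum>k\<le>n. of_nat (star_one_pairs \<epsilon> (rotate s [1..<n+1]) choose k) * F k) =
      (\<Sum>s<n. G (card (?C - {(s + n - 1) mod n + 1})))"
    by (rule sum.cong[OF refl]) (simp only: star_one_pairs_rotate G_def lessThan_iff)
  also have "\<dots> = (\<Sum>j\<in>{1..n}. G (card (?C - {j})))"
    by (rule sum.reindex_bij_betw[OF bij])
  also have "\<dots> = (\<Sum>j\<in>?C. G (card (?C - {j}))) + (\<Sum>j\<in>{1..n} - ?C. G (card (?C - {j})))"
    using C by (subst sum.subset_diff[of ?C]) (auto simp: add.commute)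
  also have "(\<Sum>j\<in>?C. G (card (?C - {j}))) = of_nat \<alpha> * G (\<alpha> - 1)"
    using fin by (simp add: \<alpha>_def)
  also have "(\<Sum>j\<in>{1..n} - ?C. G (card (?C - {j}))) = (\<Sum>j\<in>{1..n} - ?C. G \<alpha>)"
    by (intro sum.cong refl) (simp add: \<alpha>_def)
  also have "\<dots> = (of_nat n - of_nat \<alpha>) * G \<alpha>"
    using C fin \<alpha>n by (simp add: card_Diff_subset \<alpha>_def of_nat_diff)
  also have "of_nat \<alpha> * G (\<alpha> - 1) + (of_nat n - of_nat \<alpha>) * G \<alpha> =
      (\<Sum>k\<le>n. (of_nat n - of_nat k) * F k * of_nat (\<alpha> choose k))"
  proof -
    have "of_nat \<alpha> * (of_nat (\<alpha> - 1 choose k) * F k) + (of_nat n - of_nat \<alpha>) * (of_nat (\<alpha> choose k) * F k) =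
        (of_nat n - of_nat k) * F k * of_nat (\<alpha> choose k)" for k
    proof -
      have "of_nat \<alpha> * of_nat (\<alpha> - 1 choose k) = (of_nat \<alpha> - of_nat k) * (of_nat (\<alpha> choose k) :: complex)"
      proof (cases "k \<le> \<alpha>")
        case True
        thus ?thesis using binomial_absorb_comp[of \<alpha> k] by (metis of_nat_diff of_nat_mult)
      qed (simp add: binomial_eq_0)
      thus ?thesis by (simp only: mult.assoc[symmetric]) (simp add: algebra_simps)
    qed
    thus ?thesis by (simp add: G_def sum_distrib_left sum.distrib[symmetric])
  qed
  also have "\<dots> = (\<Sum>k=0..\<alpha>. (of_nat n - of_nat k) * F k * of_nat (\<alpha> choose k))"
    using \<alpha>n by (intro sum.mono_neutral_right) (auto simp: binomial_eq_0)
  finally show ?thesis .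
qed

section \<open>The leading coefficient\<close>

lemma mat_list_prod_map: "mat_list_prod f (map g l) = mat_list_prod (\<lambda>v. f (g v)) l"
  by (induction l) simp_all

lemma op_list_prod_map: "op_list_prod f (map g l) = op_list_prod (\<lambda>v. f (g v)) l"
  by (induction l) simp_all

definition cyclic_lists :: "nat \<Rightarrow> nat list set" where
  "cyclic_lists n = (\<lambda>s. rotate s [1..<n+1]) ` {..<n}"

lemma permutation_of_list:
  assumes "distinct xs" "set xs = {1..n}"
  shows "\<exists>\<sigma>. \<sigma> permutes {1..n} \<and> xs = map \<sigma> [1..<n+1]"
proof -
  have len: "length xs = n" using distinct_card[OF assms(1)] assms(2) by simp
  define \<sigma> where "\<sigma> j = (if j \<in> {1..n} then xs ! (j - 1) else j)" for j
  have xs: "xs = map \<sigma> [1..<n+1]"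
    by (rule nth_equalityI) (auto simp: len \<sigma>_def simp del: upt_Suc)
  have upt: "set [1..<n+1] = {1..n}" by (auto simp del: upt_Suc)
  have "\<sigma> ` {1..n} = {1..n}" using assms(2) unfolding upt[symmetric] by (subst (asm) xs) (simp del: upt_Suc)
  moreover have "inj_on \<sigma> {1..n}" using assms(1) unfolding upt[symmetric]
    by (subst (asm) xs) (simp add: distinct_map del: upt_Suc)
  ultimately have "\<sigma> permutes {1..n}" by (intro bij_imp_permutes) (auto simp: bij_betw_def \<sigma>_def)
  thus ?thesis using xs by blast
qed

text \<open>The shift \<open>k\<close> of a circular permutation, reduced modulo \<open>n\<close>, is the amount of rotation.\<close>

lemma circular_iff_cyclic_list:
  assumes \<sigma>: "\<sigma> permutes {1..n}" and n: "n \<ge> 1"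
  shows "circular n \<sigma> \<longleftrightarrow> map \<sigma> [1..<n+1] \<in> cyclic_lists n"
proof
  assume "circular n \<sigma>"
  then obtain k :: int where k: "\<And>j. j \<in> {1..n} \<Longrightarrow> [int (\<sigma> j) = int j + k] (mod int n)"
    unfolding circular_def by blast
  define s where "s = nat (k mod int n)"
  have s: "int s = k mod int n" "s < n" using n by (auto simp: s_def nat_less_iff)
  have "map \<sigma> [1..<n+1] = rotate s [1..<n+1]"
  proof (rule nth_equalityI)
    fix i assume "i < length (map \<sigma> [1..<n+1])"
    hence i: "i < n" by (simp del: upt_Suc)
    hence r: "\<sigma> (i + 1) \<in> {1..n}" using permutes_in_image[OF \<sigma>, of "i + 1"] by simp
    have "[int (\<sigma> (i + 1)) - 1 = int i + k] (mod int n)"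
      using cong_diff[OF k[of "i + 1"] cong_refl[of 1]] i by simp
    also have "[int i + k = int i + int s] (mod int n)"
      by (simp add: s cong_def mod_add_right_eq)
    finally have "(int (\<sigma> (i + 1)) - 1) mod int n = int ((s + i) mod n)"
      by (simp add: cong_def zmod_int add.commute)
    hence "int (\<sigma> (i + 1)) - 1 = int ((s + i) mod n)" using r by simp
    hence "\<sigma> (i + 1) = (s + i) mod n + 1" by linarith
    thus "map \<sigma> [1..<n+1] ! i = rotate s [1..<n+1] ! i"
      using i nth_rotate_upt[OF i, of s] by (simp del: upt_Suc)
  qed simp
  thus "map \<sigma> [1..<n+1] \<in> cyclic_lists n" using s(2) by (auto simp: cyclic_lists_def)
next
  assume "map \<sigma> [1..<n+1] \<in> cyclic_lists n"
  then obtain s where s: "s < n" "map \<sigma> [1..<n+1] = rotate s [1..<n+1]" by (auto simp: cyclic_lists_def)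
  have "[int (\<sigma> j) = int j + int s] (mod int n)" if j: "j \<in> {1..n}" for j
  proof -
    have "\<sigma> j = map \<sigma> [1..<n+1] ! (j - 1)" using j by (auto simp del: upt_Suc)
    also have "\<dots> = (s + (j - 1)) mod n + 1" unfolding s(2) by (rule nth_rotate_upt) (use j in auto)
    finally have "int (\<sigma> j) = (int s + int j - 1) mod int n + 1"
      using j by (simp add: zmod_int of_nat_diff)
    moreover have "[(int s + int j - 1) mod int n + 1 = (int s + int j - 1) + 1] (mod int n)"
      by (intro cong_add) (auto simp: cong_def)
    ultimately show ?thesis by (simp add: add.commute)
  qed
  thus "circular n \<sigma>" unfolding circular_def by blast
qed

lemma cyclic_lists_permutation: "xs \<in> cyclic_lists n \<Longrightarrow> distinct xs \<and> set xs = {1..n}"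
  by (auto simp: cyclic_lists_def atLeastLessThanSuc_atLeastAtMost simp del: upt_Suc)

lemma inj_rotate_upt: "inj_on (\<lambda>s. rotate s [1..<n+1]) {..<n}"
proof (rule inj_onI)
  fix s t assume st: "s \<in> {..<n}" "t \<in> {..<n}" "rotate s [1..<n+1] = rotate t [1..<n+1]"
  hence "rotate s [1..<n+1] ! 0 = rotate t [1..<n+1] ! 0" by simp
  thus "s = t" using st by (subst (asm) nth_rotate_upt, simp, subst (asm) nth_rotate_upt, simp, simp)
qed

context twisted_family_on_torus
begin

lemma target_phase_coord: "j \<in> {1..n} \<Longrightarrow> target_phase (coord j) = exponent_sign (\<epsilon> j)"
  using coord by (simp add: target_phase_def bij_betw_def inv_into_f_f)

lemma exponent_sign_inj: "exponent_sign e = exponent_sign e' \<Longrightarrow> e = e'"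
  by (cases e; cases e') (auto simp: exponent_sign_def)

lemma degree_phase_absent:
  "i \<notin> (\<lambda>v. coord (fst v)) ` set l \<Longrightarrow> degree_of l i = 0 \<and> phase_of l i = 0"
  by (induction l) (auto simp: degree_of_def phase_of_def)

lemma degree_phase_distinct:
  "distinct (map (\<lambda>v. coord (fst v)) l) \<Longrightarrow> v \<in> set l \<Longrightarrow>
    degree_of l (coord (fst v)) = 1 \<and> phase_of l (coord (fst v)) = exponent_sign (snd v)"
proof (induction l)
  case (Cons u l)
  show ?case
  proof (cases "v \<in> set l")
    case True
    hence "coord (fst u) \<noteq> coord (fst v)" using Cons.prems by auto
    thus ?thesis using Cons True by (simp add: degree_of_def phase_of_def)
  next
    case False
    hence "v = u" using Cons.prems by simp
    thus ?thesis using degree_phase_absent[of "coord (fst u)" l] Cons.prems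
      by (simp add: degree_of_def phase_of_def)
  qed
qed simp

text \<open>Degree one in each of the \<open>n\<close> variables means that every index occurs exactly once; the phase of
  a single occurrence then forces its exponent.\<close>

lemma multilinear_word_iff:
  assumes l: "\<And>v. v \<in> set l \<Longrightarrow> fst v \<in> {1..n}"
  shows "degree_of l = (\<lambda>_. 1) \<and> phase_of l = target_phase \<longleftrightarrow>
    (\<exists>xs. l = map (\<lambda>j. (j, \<epsilon> j)) xs \<and> distinct xs \<and> set xs = {1..n})"
proof
  assume dp: "degree_of l = (\<lambda>_. 1) \<and> phase_of l = target_phase"
  have onto: "(\<lambda>v. coord (fst v)) ` set l = UNIV"
    using degree_phase_absent[of _ l] dp by fastforce
  have "length l = n" using total_degree_of[of l] dp by (simp add: total_degree_def CARD_n)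
  hence dist: "distinct (map (\<lambda>v. coord (fst v)) l)"
    using onto by (intro card_distinct) (simp add: CARD_n)
  have "(fst v, \<epsilon> (fst v)) = v" if v: "v \<in> set l" for v
  proof -
    have "exponent_sign (snd v) = exponent_sign (\<epsilon> (fst v))"
      using degree_phase_distinct[OF dist v] dp target_phase_coord[OF l[OF v]] by simp
    thus ?thesis using exponent_sign_inj by (metis prod.collapse)
  qed
  hence "map (\<lambda>j. (j, \<epsilon> j)) (map fst l) = l" by (simp add: map_idI)
  moreover have "distinct (map coord (map fst l))" using dist by (simp add: o_def)
  hence "distinct (map fst l)" by (simp only: distinct_map)
  moreover have "set (map fst l) = {1..n}"
  proof
    show "set (map fst l) \<subseteq> {1..n}" using l by auto
    show "{1..n} \<subseteq> set (map fst l)"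
    proof
      fix j assume j: "j \<in> {1..n}"
      obtain v where v: "v \<in> set l" "coord j = coord (fst v)" using onto by (metis UNIV_I imageE)
      hence "j = fst v" using coord j l[OF v(1)] by (auto simp: bij_betw_def dest: inj_onD)
      thus "j \<in> set (map fst l)" using v by simp
    qed
  qed
  ultimately show "\<exists>xs. l = map (\<lambda>j. (j, \<epsilon> j)) xs \<and> distinct xs \<and> set xs = {1..n}" by metis
next
  assume "\<exists>xs. l = map (\<lambda>j. (j, \<epsilon> j)) xs \<and> distinct xs \<and> set xs = {1..n}"
  then obtain xs where xs: "l = map (\<lambda>j. (j, \<epsilon> j)) xs" "distinct xs" "set xs = {1..n}" by blast
  have dist: "distinct (map (\<lambda>v. coord (fst v)) l)"
    using xs coord by (simp add: o_def distinct_map bij_betw_def)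
  have "degree_of l i = 1 \<and> phase_of l i = target_phase i" for i
  proof -
    have "i \<in> coord ` {1..n}" using coord by (simp add: bij_betw_def)
    then obtain j where j: "j \<in> {1..n}" "i = coord j" by blast
    hence "(j, \<epsilon> j) \<in> set l" using xs by auto
    thus ?thesis using degree_phase_distinct[OF dist, of "(j, \<epsilon> j)"] target_phase_coord[OF j(1)] j(2) by simp
  qed
  thus "degree_of l = (\<lambda>_. 1) \<and> phase_of l = target_phase" by auto
qed

abbreviation starred :: "nat \<Rightarrow> ('h \<Rightarrow>\<^sub>L 'h)" where
  "starred j \<equiv> epow op_adj (x j) (\<epsilon> j)"

lemma starred_in: "j \<in> {1..n} \<Longrightarrow> starred j \<in> M"
  by (cases "\<epsilon> j") (auto simp: x_in M_adj)

lemma op_list_prod_starred_in: "set l \<subseteq> {1..n} \<Longrightarrow> op_list_prod starred l \<in> M"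
  by (induction l) (auto intro!: M_compose M_id starred_in)

lemma word_trace_multilinear:
  "word_trace (map (\<lambda>j. (j, \<epsilon> j)) xs) = tr_normalized (mat_list_prod a xs) * \<tau> (op_list_prod starred xs)"
proof -
  have "sym_mat (j, \<epsilon> j) = a j" for j by (cases "\<epsilon> j") (simp_all add: sym_mat_def mat_adj_adj)
  thus ?thesis by (simp add: word_trace_def mat_list_prod_map op_list_prod_map sym_op_def)
qed

lemma tau_rotate: "set l \<subseteq> {1..n} \<Longrightarrow> \<tau> (op_list_prod starred (rotate s l)) = \<tau> (op_list_prod starred l)"
proof (induction s)
  case (Suc s)
  have "\<tau> (op_list_prod starred (rotate1 l')) = \<tau> (op_list_prod starred l')" if "set l' \<subseteq> {1..n}" for l'
    using that by (cases l') (auto simp: op_list_prod_append intro!: tau_commute op_list_prod_starred_in starred_in)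
  thus ?case using Suc by simp
qed simp

text \<open>Only factorisations of the rotations of \<open>1, \<dots>, n\<close> can have non-zero multilinear coefficient; they all
  have the same trace, and a factorisation is weighted according to its number of
  blocks only. Counting them rotation by rotation gives the binomial sum.\<close>

lemma quotient_series_0_closed_form:
  assumes R0: "R0 > 0" "majorant R0 < 1" and n: "n \<ge> 1"
    and tr: "\<And>\<sigma>. \<sigma> permutes {1..n} \<Longrightarrow>
      tr_normalized (mat_prod n (\<lambda>j. a (\<sigma> j))) = (if circular n \<sigma> then 1 else 0)"
  shows "quotient_series 0 = \<tau> (op_prod n starred) * (\<Sum>k=0..star_one_count n \<epsilon>.
     (of_nat n - of_nat k) * (complex_of_real (p / 2) gchoose (n - k)) * of_nat (star_one_count n \<epsilon> choose k))"
proof -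
  let ?lift = "map (\<lambda>j. (j, \<epsilon> j))"
  let ?\<tau>0 = "\<tau> (op_prod n starred)"
  define F where "F d = complex_of_real (p/2 gchoose d) * ?\<tau>0" for d
  have tr': "tr_normalized (mat_list_prod a xs) = (if xs \<in> cyclic_lists n then 1 else 0)"
    if xs: "distinct xs" "set xs = {1..n}" for xs
  proof -
    obtain \<sigma> where \<sigma>: "\<sigma> permutes {1..n}" "xs = map \<sigma> [1..<n+1]" using permutation_of_list[OF xs] by blast
    have "mat_list_prod a xs = mat_prod n (\<lambda>j. a (\<sigma> j))"
      by (simp add: \<sigma>(2) mat_list_prod_map del: upt_Suc) (simp add: mat_list_prod_def mat_prod_def del: upt_Suc)
    thus ?thesis using tr[OF \<sigma>(1)] circular_iff_cyclic_list[OF \<sigma>(1) n] \<sigma>(2) by (simp del: upt_Suc)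
  qed
  have \<tau>0: "\<tau> (op_list_prod starred xs) = ?\<tau>0" if "xs \<in> cyclic_lists n" for xs
  proof -
    have "set [1..<n+1] \<subseteq> {1..n}" by (auto simp del: upt_Suc)
    thus ?thesis using that by (auto simp: cyclic_lists_def tau_rotate op_prod_def op_list_prod_def simp del: upt_Suc
          simp flip: op_list_prod_def)
  qed
  have summand: "multilinear_coeff w =
      (if concat w \<in> ?lift ` cyclic_lists n then F (length w) else 0)"
    if w: "w \<in> words n d" for w d
  proof (cases "degree_of (concat w) = (\<lambda>_. 1) \<and> phase_of (concat w) = target_phase")
    case True
    then obtain xs where xs: "concat w = ?lift xs" "distinct xs" "set xs = {1..n}"
      using multilinear_word_iff[OF word_index[OF w]] by blast
    have inj: "inj ?lift" by (intro inj_mapI injI) simp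
    have "word_coeff w = complex_of_real (p/2 gchoose length w) *
        ((if xs \<in> cyclic_lists n then 1 else 0) * \<tau> (op_list_prod starred xs))"
      using True by (simp only: word_coeff_def xs(1) word_trace_multilinear tr'[OF xs(2,3)]) simp
    thus ?thesis using True xs(1) \<tau>0[of xs] by (auto simp: F_def inj_image_mem_iff[OF inj])
  next
    case False
    hence "concat w \<notin> ?lift ` cyclic_lists n"
      using multilinear_word_iff[OF word_index[OF w]] cyclic_lists_permutation by blast
    thus ?thesis using False by (auto simp: word_coeff_def)
  qed
  let ?A = "\<Union>d\<in>{..n}. words n d"
  have len_cyc: "length xs = n" if "xs \<in> cyclic_lists n" for xs
    using that by (auto simp: cyclic_lists_def simp del: upt_Suc)
  have "{w \<in> ?A. concat w \<in> ?lift ` cyclic_lists n} = (\<Union>xs\<in>cyclic_lists n. factorisations n \<epsilon> xs)"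
  proof (intro set_eqI iffI)
    fix w assume "w \<in> {w \<in> ?A. concat w \<in> ?lift ` cyclic_lists n}"
    thus "w \<in> (\<Union>xs\<in>cyclic_lists n. factorisations n \<epsilon> xs)"
      by (auto simp: words_of_length_def factorisations_def)
  next
    fix w assume "w \<in> (\<Union>xs\<in>cyclic_lists n. factorisations n \<epsilon> xs)"
    then obtain xs where xs: "xs \<in> cyclic_lists n" "set w \<subseteq> blocks n" "concat w = ?lift xs"
      by (auto simp: factorisations_def)
    have "length w \<le> n" using length_le_length_concat[OF xs(2)] xs(3) len_cyc[OF xs(1)] by simp
    thus "w \<in> {w \<in> ?A. concat w \<in> ?lift ` cyclic_lists n}"
      using xs by (auto simp: words_of_length_def)
  qed
  note sets = this
  have "quotient_series 0 = (\<Sum>d\<le>n. \<Sum>w\<in>words n d.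
      if concat w \<in> ?lift ` cyclic_lists n then F (length w) else 0)"
    unfolding quotient_series_0[OF R0] by (intro sum.cong refl summand)
  also have "\<dots> = (\<Sum>w\<in>?A. if concat w \<in> ?lift ` cyclic_lists n then F (length w) else 0)"
    by (rule sum.UNION_disjoint[symmetric]) (auto simp: finite_words_of_length finite_blocks, auto simp: words_of_length_def)
  also have "\<dots> = (\<Sum>w\<in>{w \<in> ?A. concat w \<in> ?lift ` cyclic_lists n}. F (length w))"
    by (rule sum.inter_filter[symmetric]) (auto simp: finite_words_of_length finite_blocks)
  also have "\<dots> = (\<Sum>xs\<in>cyclic_lists n. \<Sum>w\<in>factorisations n \<epsilon> xs. F (length w))"
    unfolding sets
  proof (rule sum.UNION_disjoint)
    have inj: "inj ?lift" by (intro inj_mapI injI) simp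
    show "\<forall>xs\<in>cyclic_lists n. \<forall>ys\<in>cyclic_lists n. xs \<noteq> ys \<longrightarrow> factorisations n \<epsilon> xs \<inter> factorisations n \<epsilon> ys = {}"
      using injD[OF inj] by (auto simp: factorisations_def)
  qed (auto simp: cyclic_lists_def finite_factorisations simp del: upt_Suc)
  also have "\<dots> = (\<Sum>xs\<in>cyclic_lists n. \<Sum>k\<le>n. of_nat (star_one_pairs \<epsilon> xs choose k) * F (n - k))"
  proof (rule sum.cong[OF refl])
    fix xs assume xs: "xs \<in> cyclic_lists n"
    thus "(\<Sum>w\<in>factorisations n \<epsilon> xs. F (length w)) = (\<Sum>k\<le>n. of_nat (star_one_pairs \<epsilon> xs choose k) * F (n - k))"
      using sum_factorisations[of xs n F \<epsilon>] cyclic_lists_permutation[OF xs] len_cyc[OF xs] by simp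
  qed
  also have "\<dots> = (\<Sum>s<n. \<Sum>k\<le>n. of_nat (star_one_pairs \<epsilon> (rotate s [1..<n+1]) choose k) * F (n - k))"
    unfolding cyclic_lists_def by (subst sum.reindex[OF inj_rotate_upt]) (simp add: o_def)
  also have "\<dots> = (\<Sum>k=0..star_one_count n \<epsilon>. (of_nat n - of_nat k) * F (n - k) * of_nat (star_one_count n \<epsilon> choose k))"
    using sum_rotations[OF n, of \<epsilon> "\<lambda>k. F (n - k)"]
    by (simp add: star_one_count_def cyclic_star_one_def del: upt_Suc)
  also have "\<dots> = ?\<tau>0 * (\<Sum>k=0..star_one_count n \<epsilon>.
     (of_nat n - of_nat k) * (complex_of_real (p / 2) gchoose (n - k)) * of_nat (star_one_count n \<epsilon> choose k))"
  proof -
    have "complex_of_real (p/2 gchoose d) = complex_of_real (p/2) gchoose d" for d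
      by (simp add: gbinomial_prod_rev)
    thus ?thesis by (simp add: F_def sum_distrib_left mult_ac)
  qed
  finally show ?thesis .
qed

end

theorem lemma2p2:
  fixes M :: "('h::complex_hilbert \<Rightarrow>\<^sub>L 'h) set"
    and \<tau> :: "('h \<Rightarrow>\<^sub>L 'h) \<Rightarrow> complex"
    and p :: real
    and n :: nat
    and coord :: "nat \<Rightarrow> 'n::finite"
    and x :: "nat \<Rightarrow> ('h \<Rightarrow>\<^sub>L 'h)"
    and \<epsilon> :: "nat \<Rightarrow> exponent"
    and a :: "nat \<Rightarrow> complex ^ 'm ^ 'm::finite"
    and S :: "complex ^ 'n \<Rightarrow> (('h ^ 'm) \<Rightarrow>\<^sub>L ('h ^ 'm))"
    and \<phi> :: "real ^ 'n \<Rightarrow> complex"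
    and \<alpha> :: nat
    and L :: complex
  assumes "von_neumann_algebra M"
    and "normal_faithful_normalized_trace M \<tau>"
    and "0 < p"
    and "n \<ge> 1"
    and "bij_betw coord {1..n} UNIV"
    and "\<forall>j\<in>{1..n}. x j \<in> M"
    and "\<forall>\<sigma>. \<sigma> permutes {1..n} \<longrightarrow>
           tr_normalized (mat_prod n (\<lambda>j. a (\<sigma> j))) = (if circular n \<sigma> then 1 else 0)"
  defines "S \<equiv> \<lambda>z. id_blinfun +
             (\<Sum>j=1..n. op_scaleC (z $ coord j) (mat_tensor (epow mat_adj (a j) (\<epsilon> j)) (x j)))"
    and "\<phi> \<equiv> \<lambda>r. complex_of_real (1 / (2 * pi) ^ n) *
             integral (cbox 0 (\<chi> i. 2 * pi)) (\<lambda>\<theta>.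
               complex_of_real
                 (Lp_norm \<tau> p (S (\<chi> i. complex_of_real (r $ i) * exp (\<i> * complex_of_real (\<theta> $ i)))) powr p) *
               (\<Prod>j=1..n. epow cnj (exp (- \<i> * complex_of_real (\<theta> $ coord j))) (\<epsilon> j)))"
    and "\<alpha> \<equiv> star_one_count n \<epsilon>"
    and "L \<equiv> \<tau> (op_prod n (\<lambda>j. epow op_adj (x j) (\<epsilon> j))) *
             (\<Sum>k=0..\<alpha>. (of_nat n - of_nat k) * (complex_of_real (p / 2) gchoose (n - k)) * of_nat (\<alpha> choose k))"
  shows "(\<exists>U. open U \<and> 0 \<in> U \<and> smooth_on U \<phi>) \<and>
         foldr (\<lambda>j. partial_deriv (coord j)) [1..<n+1] \<phi> 0 = L \<and>
         ((\<lambda>r. \<phi> r / complex_of_real (\<Prod>j=1..n. r $ coord j)) \<longlongrightarrow> L)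
           (at 0 within {r. \<forall>i. r $ i \<noteq> 0})"
proof -
  interpret twisted_family_on_torus M \<tau> n x \<epsilon> a coord p
    by unfold_locales (use assms(1-6) in auto)
  have "S (\<chi> i. complex_of_real (r $ i) * exp (\<i> * complex_of_real (\<theta> $ i))) =
      id_blinfun + perturbation (torus_point r \<theta>)" for r \<theta>
    by (simp add: S_def perturbation_def torus_point_def sym_tensor_def sym_mat_def sym_op_def)
  hence \<phi>: "\<phi> = circle_average"
    by (simp add: \<phi>_def circle_average_def fun_eq_iff)
  obtain R0 where R0: "R0 > 0" "majorant R0 < 1" using majorant_radius by blast
  have L: "quotient_series 0 = L"
    unfolding L_def \<alpha>_def by (rule quotient_series_0_closed_form[OF R0 assms(4)]) (use assms(7) in blast)
  have "0 \<in> polydisc R0" using R0 by (simp add: polydisc_def)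
  thus ?thesis
    using open_polydisc smooth_circle_average[OF R0] iterated_deriv_circle_average[OF R0]
      circle_average_quotient_limit[OF R0]
    unfolding \<phi> L by blast
qed

end
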